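(* Let $k\ge 1$, let $K=\{z_1,\dots,z_{2k}\}\subset\mathbb{C}$ be a set of $2k$ distinct points, let $X=\mathbb{C}\setminus K$ and $D(z)=\prod_{i=1}^{2k}(z-z_i)$. There is a natural one-to-one correspondence between any two of the following three kinds of objects: (1) $\mathbb{Z}_2$ harmonic functions $f$ on $X$; (2) admissible entire functions $u(z)$ on $\mathbb{C}$; (3) equivalence classes $[h]$ of real-valued harmonic functions $h$ on $\mathbb{C}\setminus\{0\}$, where $h_1\sim h_2$ if and only if there is a constant $C$ such that $h_1(z)-h_2(z)\to C$ as $|z|\to+\infty$. More precisely, the correspondences are given by $$f(z)=\mathrm{Re}\left(\int_{z_1}^{z}\frac{u(\zeta)}{\sqrt{D(\zeta)}}\,d\zeta\right)\qquad\text{and}\qquad \lim_{|z|\to+\infty}\bigl(f(z)-h(z)\bigr)=C\ \text{ for some constant } C,$$ where in the second relation $f$ is viewed as an ordinary function near infinity via the fixed trivialization $\iota$.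
   Context: Identify $\mathbb{R}^2$ with $\mathbb{C}$. $\mathcal{L}$ denotes the unique real line bundle on $X$ with monodromy $-1$ around each point of $K$. A $\mathbb{Z}_2$ function is a section of $\mathcal{L}$; in a local trivialization it is an ordinary real function, well defined up to sign, so derivatives and $|f|$, $|\nabla f|$ make sense. A $\mathbb{Z}_2$ harmonic function is a $\mathbb{Z}_2$ function $f$ with $\Delta f=(\partial_x^2+\partial_y^2)f=0$ in every local trivialization, and such that $|\nabla f|$ has finite $L^2$ norm on every bounded open subset of $X$ (including punctured neighborhoods of the points of $K$). A large disk $B\supset K$ is chosen, $\mathcal{L}$ is trivial on $\mathbb{C}\setminus B$, and a trivialization $\iota$ of $\mathcal{L}$ over $\mathbb{C}\setminus B$ is fixed; via $\iota$, $\mathbb{Z}_2$ functions are ordinary real functions on $\mathbb{C}\setminus B$. An entire function $u$ is admissible if $\mathrm{Re}\bigl(\int_{z_1}^{z_j}\frac{u(z)}{\sqrt{D(z)}}dz\bigr)=0$ for all $j=2,\dots,2k$ (each integral taken along some path from $z_1$ to $z_j$ with interior in $X$, with a continuous choice of $\sqrt{D}$ along it; the condition does not depend on these choices). A sign convention for $\sqrt{D(z)}$ as a section of $\mathcal{L}\otimes\mathbb{C}$ is fixed; for admissible $u$, $\mathrm{Re}\int_{z_1}^z u/\sqrt{D}$ is independent of the path up to the sign of $\sqrt D$ at the endpoint and so is regarded as a section of $\mathcal{L}$. *)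

theory Defs
  imports "HOL-Complex_Analysis.Complex_Analysis"
begin

section \<open>Harmonic functions of two real variables\<close>

definition pdx :: "(complex \<Rightarrow> real) \<Rightarrow> complex \<Rightarrow> real" where
  "pdx f x = frechet_derivative f (at x) 1"

definition pdy :: "(complex \<Rightarrow> real) \<Rightarrow> complex \<Rightarrow> real" where
  "pdy f x = frechet_derivative f (at x) \<i>"

definition grad_norm :: "(complex \<Rightarrow> real) \<Rightarrow> complex \<Rightarrow> real" where
  "grad_norm f x = sqrt ((pdx f x)\<^sup>2 + (pdy f x)\<^sup>2)"

text \<open>The next two notions are meant for open sets \<open>S\<close>.\<close>

definition C1_on :: "(complex \<Rightarrow> real) \<Rightarrow> complex set \<Rightarrow> bool" where
  "C1_on f S \<longleftrightarrow> (\<forall>x\<in>S. f differentiable (at x)) \<and>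
     continuous_on S (pdx f) \<and> continuous_on S (pdy f)"

definition harmonic_on :: "(complex \<Rightarrow> real) \<Rightarrow> complex set \<Rightarrow> bool" where
  "harmonic_on f S \<longleftrightarrow> C1_on f S \<and> C1_on (pdx f) S \<and> C1_on (pdy f) S \<and>
     (\<forall>x\<in>S. pdx (pdx f) x + pdy (pdy f) x = 0)"


section \<open>The real line bundle with monodromy \<open>-1\<close>\<close>

definition branch_points :: "(nat \<Rightarrow> complex) \<Rightarrow> nat \<Rightarrow> complex set" where
  "branch_points z k = z ` {1..2*k}"

definition branch_poly :: "(nat \<Rightarrow> complex) \<Rightarrow> nat \<Rightarrow> complex \<Rightarrow> complex" where
  "branch_poly z k x = (\<Prod>i=1..2*k. x - z i)"

text \<open>
  The line bundle is modelled through its \<open>\<plusminus>1\<close> frames: the points \<open>(x, w)\<close> with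
  \<open>w\<^sup>2 = D x\<close> form a two-sheeted cover of the complement of the branch points, the bundle is
  the quotient of cover times \<open>\<real>\<close> by \<open>(x, w, t) \<sim> (x, -w, -t)\<close>, and a section is an odd
  real function on the cover.  That going once around a branch point exchanges the two frames
  is \<open>root_cover_monodromy\<close> below.  In this model the function \<open>(x, w) \<mapsto> w\<close> is the
  square root of \<open>D\<close> as a section of the complexified bundle; the other sign convention
  amounts to the automorphism \<open>(x, w) \<mapsto> (x, -w)\<close> of the cover.
\<close>

definition root_cover :: "(nat \<Rightarrow> complex) \<Rightarrow> nat \<Rightarrow> (complex \<times> complex) set" where
  "root_cover z k = {(x, w). x \<notin> branch_points z k \<and> w\<^sup>2 = branch_poly z k x}"

text \<open>A continuous root of \<open>D\<close> on a set is the same as a (flat, \<open>\<plusminus>1\<close>) trivialization there;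
  it turns a section \<open>f\<close> into the ordinary function \<open>\<lambda>x. f (x, s x)\<close>.\<close>

definition trivialization ::
  "(nat \<Rightarrow> complex) \<Rightarrow> nat \<Rightarrow> complex set \<Rightarrow> (complex \<Rightarrow> complex) \<Rightarrow> bool" where
  "trivialization z k U s \<longleftrightarrow> U \<inter> branch_points z k = {} \<and> continuous_on U s \<and>
     (\<forall>x\<in>U. (s x)\<^sup>2 = branch_poly z k x)"

definition z2_function ::
  "(nat \<Rightarrow> complex) \<Rightarrow> nat \<Rightarrow> (complex \<times> complex \<Rightarrow> real) \<Rightarrow> bool" where
  "z2_function z k f \<longleftrightarrow> f \<in> extensional (root_cover z k) \<and>
     (\<forall>(x, w) \<in> root_cover z k. f (x, -w) = - f (x, w))"

text \<open>The choice of the trivialization near \<open>x\<close> affects only the sign of the gradient.\<close>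

definition z2_grad_norm ::
  "(nat \<Rightarrow> complex) \<Rightarrow> nat \<Rightarrow> (complex \<times> complex \<Rightarrow> real) \<Rightarrow> complex \<Rightarrow> real" where
  "z2_grad_norm z k f x =
     (let s = (SOME s. \<exists>U. open U \<and> x \<in> U \<and> trivialization z k U s)
      in grad_norm (\<lambda>y. f (y, s y)) x)"

definition z2_harmonic ::
  "(nat \<Rightarrow> complex) \<Rightarrow> nat \<Rightarrow> (complex \<times> complex \<Rightarrow> real) set" where
  "z2_harmonic z k = {f. z2_function z k f \<and>
     (\<forall>U s. open U \<longrightarrow> trivialization z k U s \<longrightarrow> harmonic_on (\<lambda>x. f (x, s x)) U) \<and>
     (\<forall>U. open U \<longrightarrow> bounded U \<longrightarrow> U \<subseteq> - branch_points z k \<longrightarrow>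
        set_integrable lborel U (\<lambda>x. (z2_grad_norm z k f x)\<^sup>2))}"


section \<open>Integrals of \<open>u / \<surd>D\<close> and admissible entire functions\<close>

text \<open>A path whose interior avoids the branch points, with a continuous choice \<open>s\<close> of the root
  of \<open>D\<close> along it.  The path may start or end at a branch point.\<close>

definition root_path ::
  "(nat \<Rightarrow> complex) \<Rightarrow> nat \<Rightarrow> (real \<Rightarrow> complex) \<Rightarrow> (real \<Rightarrow> complex) \<Rightarrow> bool" where
  "root_path z k g s \<longleftrightarrow> valid_path g \<and> g ` {0<..<1} \<subseteq> - branch_points z k \<and>
     continuous_on {0..1} s \<and> (\<forall>t\<in>{0..1}. (s t)\<^sup>2 = branch_poly z k (g t))"

text \<open>This is \<open>has_contour_integral\<close> with \<open>s t\<close>, which need not be a function of \<open>g t\<close>, in the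
  denominator.  As the gauge integral on \<open>{0..1}\<close> contains improper integrals, the singularity
  of the integrand at an end point that is a branch point is covered.\<close>

definition has_root_integral ::
  "(complex \<Rightarrow> complex) \<Rightarrow> (real \<Rightarrow> complex) \<Rightarrow> (real \<Rightarrow> complex) \<Rightarrow> complex \<Rightarrow> bool" where
  "has_root_integral u g s I \<longleftrightarrow>
     ((\<lambda>t. u (g t) / s t * vector_derivative g (at t within {0..1})) has_integral I) {0..1}"

definition admissible :: "(nat \<Rightarrow> complex) \<Rightarrow> nat \<Rightarrow> (complex \<Rightarrow> complex) set" where
  "admissible z k = {u. u holomorphic_on UNIV \<and>
     (\<forall>j\<in>{2..2*k}. \<exists>g s I. root_path z k g s \<and> pathstart g = z 1 \<and> pathfinish g = z j \<and>
        has_root_integral u g s I \<and> Re I = 0)}"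


section \<open>The correspondences\<close>

definition integral_rel :: "(nat \<Rightarrow> complex) \<Rightarrow> nat \<Rightarrow>
    (complex \<times> complex \<Rightarrow> real) \<Rightarrow> (complex \<Rightarrow> complex) \<Rightarrow> bool" where
  "integral_rel z k f u \<longleftrightarrow> (\<forall>(x, w) \<in> root_cover z k. \<forall>g s.
     root_path z k g s \<longrightarrow> pathstart g = z 1 \<longrightarrow> pathfinish g = x \<longrightarrow> s 1 = w \<longrightarrow>
     (\<exists>I. has_root_integral u g s I \<and> f (x, w) = Re I))"

definition punctured_harmonic :: "(complex \<Rightarrow> real) set" where
  "punctured_harmonic = {h. h \<in> extensional (- {0}) \<and> harmonic_on h (- {0})}"

definition asymp_rel :: "((complex \<Rightarrow> real) \<times> (complex \<Rightarrow> real)) set" where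
  "asymp_rel = {(h1, h2). h1 \<in> punctured_harmonic \<and> h2 \<in> punctured_harmonic \<and>
     (\<exists>C. ((\<lambda>x. h1 x - h2 x) \<longlongrightarrow> C) at_infinity)}"

text \<open>\<open>\<sigma>\<close> is the trivialization near infinity, \<open>c\<close> a class of \<open>asymp_rel\<close>.\<close>

definition infinity_rel ::
  "(complex \<Rightarrow> complex) \<Rightarrow> (complex \<times> complex \<Rightarrow> real) \<Rightarrow> (complex \<Rightarrow> real) set \<Rightarrow> bool" where
  "infinity_rel \<sigma> f c \<longleftrightarrow>
     (\<forall>h\<in>c. \<exists>C. ((\<lambda>x. f (x, \<sigma> x) - h x) \<longlongrightarrow> C) at_infinity)"

definition one_to_one :: "'a set \<Rightarrow> 'b set \<Rightarrow> ('a \<Rightarrow> 'b \<Rightarrow> bool) \<Rightarrow> bool" where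
  "one_to_one A B R \<longleftrightarrow>
     (\<forall>a\<in>A. \<exists>!b. b \<in> B \<and> R a b) \<and> (\<forall>b\<in>B. \<exists>!a. a \<in> A \<and> R a b)"


section \<open>Consistency of the model\<close>

lemma branch_poly_eq_0_iff: "branch_poly z k x = 0 \<longleftrightarrow> x \<in> branch_points z k"
  by (auto simp: branch_poly_def branch_points_def)

lemma continuous_on_branch_poly [continuous_intros]:
  "continuous_on S g \<Longrightarrow> continuous_on S (\<lambda>x. branch_poly z k (g x))"
  unfolding branch_poly_def by (intro continuous_intros)

lemma root_cover_local_trivialization:
  assumes "x \<notin> branch_points z k"
  shows "\<exists>U s. open U \<and> x \<in> U \<and> trivialization z k U s"
proof -
  have "open (- branch_points z k)"
    by (auto simp: branch_points_def intro!: finite_imp_closed)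
  then obtain r where r: "r > 0" "ball x r \<subseteq> - branch_points z k"
    using assms by (meson ComplI openE)
  have "\<And>y. y \<in> ball x r \<Longrightarrow> branch_poly z k y \<noteq> 0"
    using r by (auto simp: branch_poly_eq_0_iff)
  then obtain s where "continuous_on (ball x r) s"
      "\<And>y. y \<in> ball x r \<Longrightarrow> branch_poly z k y = (s y)\<^sup>2"
    using continuous_sqrt_on_contractible[of "ball x r" "branch_poly z k"]
      continuous_on_branch_poly[of "ball x r" "\<lambda>x. x" z k] convex_imp_contractible[of "ball x r"]
    by (metis continuous_on_id convex_ball)
  then show ?thesis
    using r by (intro exI[of _ "ball x r"] exI[of _ s]) (auto simp: trivialization_def)
qed

lemma root_cover_monodromy:
  assumes inj: "inj_on z {1..2*k}" and i: "i \<in> {1..2*k}" and r: "r > 0"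
    and K: "cball (z i) r \<inter> branch_points z k = {z i}"
    and s: "continuous_on {0..1} s"
      "\<And>t. t \<in> {0..1} \<Longrightarrow> (s t)\<^sup>2 = branch_poly z k (circlepath (z i) r t)"
  shows "s 1 = - s 0"
proof -
  define q where "q = (\<lambda>x. \<Prod>j\<in>{1..2*k} - {i}. x - z j)"
  have D: "branch_poly z k x = (x - z i) * q x" for x
    unfolding branch_poly_def q_def using i by (simp add: prod.remove)
  have "q x \<noteq> 0" if "x \<in> cball (z i) r" for x
  proof
    assume "q x = 0"
    then have "\<exists>j\<in>{1..2*k} - {i}. x = z j"
      unfolding q_def by (subst (asm) prod_zero_iff) simp_all
    then obtain j where j: "j \<in> {1..2*k}" "j \<noteq> i" "x = z j"
      by blast
    then have "x \<in> cball (z i) r \<inter> branch_points z k"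
      using that unfolding branch_points_def by blast
    then have "z j = z i"
      using K j(3) by blast
    then show False
      using inj i j(1,2) by (meson inj_onD)
  qed
  moreover have "continuous_on (cball (z i) r) q"
    unfolding q_def by (intro continuous_intros)
  ultimately obtain p where p: "continuous_on (cball (z i) r) p"
      "\<And>x. x \<in> cball (z i) r \<Longrightarrow> q x = (p x)\<^sup>2" "\<And>x. x \<in> cball (z i) r \<Longrightarrow> q x \<noteq> 0"
    using continuous_sqrt_on_contractible[of "cball (z i) r" q]
      convex_imp_contractible[of "cball (z i) r"]
    by (metis convex_cball)
  define c where "c = circlepath (z i) r"
  have c: "c t = z i + of_real r * exp (2 * of_real pi * \<i> * of_real t)" for t
    by (simp add: c_def circlepath)
  have cin: "c t \<in> cball (z i) r" for t
    using r by (simp add: c dist_norm norm_mult)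
  define m where "m = (\<lambda>t::real. of_real (sqrt r) * exp (of_real pi * \<i> * of_real t) * p (c t))"
  have contc: "continuous_on {0..1} c"
    unfolding c by (intro continuous_intros)
  have contm: "continuous_on {0..1} m"
    unfolding m_def
    by (intro continuous_intros continuous_on_compose2[OF p(1) contc]) (use cin in auto)
  have m2: "(m t)\<^sup>2 = branch_poly z k (c t)" for t
  proof -
    have "(exp (of_real pi * \<i> * of_real t))\<^sup>2 = exp (2 * of_real pi * \<i> * complex_of_real t)"
      by (simp flip: exp_double add: mult_ac)
    moreover have "(of_real (sqrt r))\<^sup>2 = complex_of_real r"
      using r by (simp flip: of_real_power)
    ultimately show ?thesis
      by (simp add: m_def power_mult_distrib D p(2)[OF cin, symmetric])
        (simp add: c)
  qed
  have m0: "m t \<noteq> 0" for t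
    using r p(2)[OF cin] p(3)[OF cin] by (auto simp: m_def)
  have "continuous_on {0..1} (\<lambda>t. s t / m t)"
    by (intro continuous_intros s contm) (use m0 in auto)
  moreover have "s t / m t \<in> {1, -1}" if "t \<in> {0..1}" for t
  proof -
    have "(s t)\<^sup>2 = (m t)\<^sup>2"
      using s(2)[OF that] m2[of t] by (simp add: c_def)
    then have "s t = m t \<or> s t = - m t"
      by (rule power2_eq_iff[THEN iffD1])
    then show ?thesis
      using m0[of t] by auto
  qed
  ultimately have "(\<lambda>t. s t / m t) constant_on {0..1}"
  proof (intro continuous_finite_range_constant)
    have "(\<lambda>t. s t / m t) ` {0..1} \<subseteq> {1, -1}"
      using \<open>\<And>t. t \<in> {0..1} \<Longrightarrow> s t / m t \<in> {1, -1}\<close> by blast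
    then show "finite ((\<lambda>t. s t / m t) ` {0..1})"
      by (rule finite_subset) simp
  qed simp_all
  then have "s 1 / m 1 = s 0 / m 0"
    by (auto simp: constant_on_def)
  moreover have "m 1 = - m 0"
    by (simp add: m_def c exp_pi_i mult_ac)
  ultimately have "- s 1 = s 0"
    using m0[of 0] by (simp add: field_simps)
  then show ?thesis
    by (metis minus_minus)
qed

lemma trivialization_at_infinity:
  assumes "branch_points z k \<subseteq> cball a R"
  shows "\<exists>\<sigma>. trivialization z k (- cball a R) \<sigma>"
proof (intro exI)
  let ?\<sigma> = "\<lambda>x. (x - a) ^ k * (\<Prod>i=1..2*k. csqrt (1 - (z i - a) / (x - a)))"
  have zi: "z i \<in> cball a R" if "i \<in> {1..2*k}" for i
    using assms that unfolding branch_points_def by blast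
  have lt: "norm ((z i - a) / (x - a)) < 1" and nz: "x \<noteq> a"
    if "x \<in> - cball a R" "i \<in> {1..2*k}" for x i
  proof -
    have "norm (z i - a) \<le> R" "R < norm (x - a)"
      using zi[OF that(2)] that(1) by (auto simp: dist_norm norm_minus_commute)
    moreover from this show "x \<noteq> a"
      by (metis norm_ge_zero norm_zero not_le order_trans right_minus_eq)
    ultimately show "norm ((z i - a) / (x - a)) < 1"
      by (simp add: norm_divide divide_simps)
  qed
  have slit: "1 - (z i - a) / (x - a) \<notin> \<real>\<^sub>\<le>\<^sub>0"
    if "x \<in> - cball a R" "i \<in> {1..2*k}" for x i
  proof -
    have "Re ((z i - a) / (x - a)) < 1"
      using lt[OF that] complex_Re_le_cmod le_less_trans by blast
    then show ?thesis
      by (auto simp: complex_nonpos_Reals_iff)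
  qed
  have "continuous_on (- cball a R) (\<lambda>x. csqrt (1 - (z i - a) / (x - a)))"
    if "i \<in> {1..2*k}" for i
  proof (rule continuous_on_compose2[OF continuous_on_csqrt])
    show "continuous_on (- cball a R) (\<lambda>x. 1 - (z i - a) / (x - a))"
      using nz that by (intro continuous_intros) auto
    show "(\<lambda>x. 1 - (z i - a) / (x - a)) ` (- cball a R) \<subseteq> - \<real>\<^sub>\<le>\<^sub>0"
      using slit that by blast
  qed
  then have "continuous_on (- cball a R) ?\<sigma>"
    by (intro continuous_on_mult continuous_on_prod continuous_on_power continuous_on_diff
        continuous_on_id continuous_on_const)
  moreover have "(?\<sigma> x)\<^sup>2 = branch_poly z k x" if x: "x \<in> - cball a R" for x
  proof -
    have "(?\<sigma> x)\<^sup>2 = (x - a) ^ (2 * k) * (\<Prod>i=1..2*k. (csqrt (1 - (z i - a) / (x - a)))\<^sup>2)"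
      by (simp only: power_mult_distrib prod_power_distrib power_even_eq)
    also have "\<dots> = (\<Prod>i=1..2*k. x - a) * (\<Prod>i=1..2*k. 1 - (z i - a) / (x - a))"
      by simp
    also have "\<dots> = branch_poly z k x"
      unfolding branch_poly_def prod.distrib[symmetric]
    proof (intro prod.cong refl)
      fix i assume "i \<in> {1..2*k}"
      then have "(x - a) * ((z i - a) / (x - a)) = z i - a"
        using nz[OF x] by simp
      then show "(x - a) * (1 - (z i - a) / (x - a)) = x - z i"
        by (simp only: right_diff_distrib mult_1_right) simp
    qed
    finally show ?thesis .
  qed
  ultimately show "trivialization z k (- cball a R) ?\<sigma>"
    using assms by (auto simp: trivialization_def)
qed

lemma equiv_asymp_rel: "equiv punctured_harmonic asymp_rel"
proof (rule equivI)
  show "asymp_rel \<subseteq> punctured_harmonic \<times> punctured_harmonic"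
    by (auto simp: asymp_rel_def)
  show "refl_on punctured_harmonic asymp_rel"
    by (auto simp: refl_on_def asymp_rel_def)
  show "sym asymp_rel"
  proof (rule symI)
    fix h1 h2 assume "(h1, h2) \<in> asymp_rel"
    then obtain C where "((\<lambda>x. h1 x - h2 x) \<longlongrightarrow> C) at_infinity"
        "h1 \<in> punctured_harmonic" "h2 \<in> punctured_harmonic"
      by (auto simp: asymp_rel_def)
    then show "(h2, h1) \<in> asymp_rel"
      using tendsto_minus[of "\<lambda>x. h1 x - h2 x" C at_infinity] by (auto simp: asymp_rel_def)
  qed
  show "trans asymp_rel"
  proof (rule transI)
    fix h1 h2 h3 assume "(h1, h2) \<in> asymp_rel" "(h2, h3) \<in> asymp_rel"
    then obtain C C' where "((\<lambda>x. h1 x - h2 x) \<longlongrightarrow> C) at_infinity"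
        "((\<lambda>x. h2 x - h3 x) \<longlongrightarrow> C') at_infinity"
        "h1 \<in> punctured_harmonic" "h3 \<in> punctured_harmonic"
      by (auto simp: asymp_rel_def)
    then show "(h1, h3) \<in> asymp_rel"
      using tendsto_add[of "\<lambda>x. h1 x - h2 x" C at_infinity "\<lambda>x. h2 x - h3 x" C']
      by (auto simp: asymp_rel_def)
  qed
qed

end

theory Submission
  imports Defs
begin

text \<open>
  In a local trivialization \<open>u = \<surd>D (f\<^sub>x - \<i> f\<^sub>y)\<close> does not depend on the sign, and the finite
  energy makes its singularities at the branch points removable; so \<open>f\<close> is the real part of a
  primitive of \<open>u / \<surd>D\<close>, and vanishes at the branch points because it is odd on the cover.
  Conversely, in the plane slit along rays from the branch points \<open>u / \<surd>D\<close> has a primitive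
  \<open>\<Phi>\<close>, and \<open>\<Phi> - \<Phi> (z 1)\<close> is well defined on the cover up to the group generated by the numbers
  \<open>2 (\<Phi> (z j) - \<Phi> (z 1))\<close>.  Admissibility says that the real parts of the \<open>\<Phi> (z j) - \<Phi> (z 1)\<close>
  solve a homogeneous integral linear system that is the identity modulo 2, so they vanish.

  At infinity \<open>f = Re E + c ln \<bar>x\<bar> + const + o(1)\<close> with \<open>E\<close> entire, and every class of harmonic
  functions on the punctured plane is represented by such an \<open>E\<close> and \<open>c\<close>.  A bounded \<open>f\<close> is zero, by
  the maximum principle for \<open>\<bar>f\<bar>\<close> and its vanishing at the branch points.  This gives uniqueness.
  It also gives existence: \<open>u\<close> is the entire part of \<open>\<surd>D E'\<close> plus a polynomial of degree less than \<open>k\<close>, whose \<open>2 k\<close> real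
  coefficients have to satisfy \<open>2 k\<close> real linear
  equations, whose homogeneous version only has the trivial solution.
\<close>

subsection \<open>Harmonic functions and their gradients\<close>

text \<open>Admissibility speaks of one path per branch point, \<open>integral_rel\<close> of all
  paths, \<open>z2_harmonic\<close> of derivatives in local trivializations.
  \<open>re_primitive\<close> mediates: an odd function on the cover, branch points included, that
  is locally the real part of a primitive of u / \<surd>D.

  The count of real equations works out because the imaginary part of the residue \<rho> at infinity
  is not among them. Once the periods vanish, f is single valued near infinity, and continuing Re
  (\<rho> Log x) around a circle forces Im \<rho> = 0. So 2k - 1 periods and one logarithmic
  coefficient face 2k real coefficients.

  Removability at a branch point is quantitative: the energy density is |u|^2 / |D|, and comparing
  |u(x)|^2 with its mean over a disc of half the distance d to the branch point gives |(x - z i)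
  u(x)| = O(sqrt d).

  A bounded f need not attain its supremum, which may be approached at infinity only; the logarithm
  in the maximum principle pulls the maximum back to a compact set.\<close>

lemma has_derivative_pd:
  assumes "f differentiable (at x)"
  shows "(f has_derivative (\<lambda>d. Re d * pdx f x + Im d * pdy f x)) (at x)"
proof -
  have *: "(f has_derivative frechet_derivative f (at x)) (at x)"
    using assms frechet_derivative_works by blast
  then interpret bounded_linear "frechet_derivative f (at x)"
    by (rule has_derivative_bounded_linear)
  have "frechet_derivative f (at x) d = Re d * pdx f x + Im d * pdy f x" for d
  proof -
    have "d = Re d *\<^sub>R 1 + Im d *\<^sub>R \<i>"
      by (simp add: complex_eq_iff)
    then have "frechet_derivative f (at x) d = frechet_derivative f (at x) (Re d *\<^sub>R 1 + Im d *\<^sub>R \<i>)"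
      by simp
    then show ?thesis
      unfolding pdx_def pdy_def add scale by simp
  qed
  then show ?thesis using * by (metis (no_types, lifting) ext)
qed

lemma
  assumes "(f has_derivative f') (at x)"
  shows pdx_eqI: "pdx f x = f' 1" and pdy_eqI: "pdy f x = f' \<i>"
  using frechet_derivative_at[OF assms] by (simp_all add: pdx_def pdy_def)

lemma
  assumes "open U" "x \<in> U" "\<And>y. y \<in> U \<Longrightarrow> f y = g y"
  shows pdx_cong_open: "pdx f x = pdx g x" and pdy_cong_open: "pdy f x = pdy g x"
    and differentiable_cong_open: "f differentiable (at x) \<longleftrightarrow> g differentiable (at x)"
proof -
  have *: "(f has_derivative f') (at x) \<longleftrightarrow> (g has_derivative f') (at x)" for f'
    using has_derivative_transform_within_open[OF _ assms(1,2)] assms(3) by metis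
  then show "pdx f x = pdx g x" "pdy f x = pdy g x" "f differentiable (at x) \<longleftrightarrow> g differentiable (at x)"
    by (simp_all add: pdx_def pdy_def frechet_derivative_def differentiable_def)
qed

lemma C1_on_cong_open:
  assumes U: "open U" and eq: "\<And>x. x \<in> U \<Longrightarrow> f x = g x"
  shows "C1_on f U \<longleftrightarrow> C1_on g U"
  unfolding C1_on_def using differentiable_cong_open[OF U _ eq] pdx_cong_open[OF U _ eq]
    pdy_cong_open[OF U _ eq] by (intro conj_cong continuous_on_cong refl ball_cong) auto

lemma has_derivative_Re_holomorphic:
  assumes "(P has_field_derivative c) (at x)"
  shows "((\<lambda>y. Re (P y)) has_derivative (\<lambda>d. Re (c * d))) (at x)"
  using has_derivative_Re[OF has_field_derivative_imp_has_derivative[OF assms]] by simp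

lemma Re_mult_cancel: "(\<And>d. Re (a * d) = Re (b * d)) \<Longrightarrow> a = b"
proof -
  assume *: "\<And>d. Re (a * d) = Re (b * d)"
  show "a = b" using *[of 1] *[of \<i>] by (simp add: complex_eq_iff)
qed

text \<open>The partial derivatives of Re P are Re P' and Re (i P'), again real parts of holomorphic
  functions, so the one fact \<open>C1\<close> about real parts yields all three smoothness
  conditions.\<close>

lemma harmonic_on_Re:
  assumes P: "P holomorphic_on U" and U: "open U"
  shows "harmonic_on (\<lambda>x. Re (P x)) U"
proof -
  have hd: "((\<lambda>y. Re (Q y)) has_derivative (\<lambda>d. Re (deriv Q x * d))) (at x)"
    if "Q holomorphic_on U" "x \<in> U" for Q x
    using that has_derivative_Re_holomorphic holomorphic_derivI[OF that(1) U that(2)] by blast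
  have px: "pdx (\<lambda>x. Re (Q x)) x = Re (deriv Q x)" and py: "pdy (\<lambda>x. Re (Q x)) x = Re (\<i> * deriv Q x)"
    if "Q holomorphic_on U" "x \<in> U" for Q x
    using pdx_eqI[OF hd[OF that]] pdy_eqI[OF hd[OF that]] by simp_all
  have C1: "C1_on (\<lambda>x. Re (Q x)) U" if Q: "Q holomorphic_on U" for Q
    unfolding C1_on_def
  proof (intro conjI ballI)
    show "(\<lambda>x. Re (Q x)) differentiable at x" if "x \<in> U" for x
      using hd[OF Q that] differentiable_def by blast
    have c: "continuous_on U (deriv Q)"
      using Q U holomorphic_deriv holomorphic_on_imp_continuous_on by blast
    show "continuous_on U (pdx (\<lambda>x. Re (Q x)))"
      by (rule continuous_on_eq[of _ "\<lambda>x. Re (deriv Q x)"])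
        (use px[OF Q] in \<open>auto intro!: continuous_intros c\<close>)
    show "continuous_on U (pdy (\<lambda>x. Re (Q x)))"
      by (rule continuous_on_eq[of _ "\<lambda>x. Re (\<i> * deriv Q x)"])
        (use py[OF Q] in \<open>auto intro!: continuous_intros c\<close>)
  qed
  note C1_cong = C1_on_cong_open[OF U]
  define P' where "P' = deriv P"
  have P': "P' holomorphic_on U" "(\<lambda>x. \<i> * P' x) holomorphic_on U"
    unfolding P'_def using P U by (auto intro!: holomorphic_intros holomorphic_deriv)
  have d: "deriv (\<lambda>x. \<i> * P' x) x = \<i> * deriv P' x" if "x \<in> U" for x
    using P'(1) U that holomorphic_on_imp_differentiable_at by (intro deriv_cmult) blast
  show ?thesis
    unfolding harmonic_on_def
  proof (intro conjI ballI)
    show "C1_on (\<lambda>x. Re (P x)) U" using C1[OF P] .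
    show "C1_on (pdx (\<lambda>x. Re (P x))) U"
      using C1_cong[THEN iffD2, OF _ C1[OF P'(1)]] px[OF P] by (simp add: P'_def)
    show "C1_on (pdy (\<lambda>x. Re (P x))) U"
      using C1_cong[THEN iffD2, OF _ C1[OF P'(2)]] py[OF P] by (simp add: P'_def)
    fix x assume x: "x \<in> U"
    have "pdx (pdx (\<lambda>x. Re (P x))) x = Re (deriv P' x)"
      using pdx_cong_open[OF U x, of "pdx (\<lambda>x. Re (P x))" "\<lambda>x. Re (P' x)"] px[OF P] px[OF P'(1) x]
      by (simp add: P'_def)
    moreover have "pdy (pdy (\<lambda>x. Re (P x))) x = - Re (deriv P' x)"
      using pdy_cong_open[OF U x, of "pdy (\<lambda>x. Re (P x))" "\<lambda>x. Re (\<i> * P' x)"] py[OF P] py[OF P'(2) x] d[OF x]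
      by (simp add: P'_def)
    ultimately show "pdx (pdx (\<lambda>x. Re (P x))) x + pdy (pdy (\<lambda>x. Re (P x))) x = 0" by simp
  qed
qed

text \<open>Harmonicity is local, so local choices of \<open>P\<close> suffice where no global one
  exists, as for ln |x| on the punctured plane.\<close>

lemma harmonic_on_local:
  assumes "\<And>x. x \<in> S \<Longrightarrow> \<exists>U P. open U \<and> x \<in> U \<and> P holomorphic_on U \<and> (\<forall>y\<in>U. h y = Re (P y))"
  shows "harmonic_on h S"
proof -
  have loc: "\<exists>U. open U \<and> x \<in> U \<and> harmonic_on h U" if x: "x \<in> S" for x
  proof -
    obtain U P where U: "open U" "x \<in> U" "P holomorphic_on U" "\<And>y. y \<in> U \<Longrightarrow> h y = Re (P y)"
      using assms[OF x] by blast
    have H: "harmonic_on (\<lambda>x. Re (P x)) U" by (rule harmonic_on_Re) fact+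
    note C1_cong = C1_on_cong_open[OF U(1)]
    have x1: "pdx h y = pdx (\<lambda>x. Re (P x)) y" "pdy h y = pdy (\<lambda>x. Re (P x)) y" if "y \<in> U" for y
      using pdx_cong_open[OF U(1) that U(4)] pdy_cong_open[OF U(1) that U(4)] by auto
    have "harmonic_on h U"
      using H C1_cong[OF U(4)] C1_cong[OF x1(1)] C1_cong[OF x1(2)]
        pdx_cong_open[OF U(1) _ x1(1)] pdy_cong_open[OF U(1) _ x1(2)]
      unfolding harmonic_on_def by auto
    then show ?thesis using U by blast
  qed
  have C1: "C1_on f S" if "\<And>U. harmonic_on h U \<Longrightarrow> C1_on f U" for f
  proof -
    have *: "\<exists>U. open U \<and> x \<in> U \<and> C1_on f U" if "x \<in> S" for x
      using loc[OF that] \<open>\<And>U. harmonic_on h U \<Longrightarrow> C1_on f U\<close> by blast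
    show ?thesis
      unfolding C1_on_def
    proof (intro conjI ballI)
      show "f differentiable at x" if "x \<in> S" for x using *[OF that] by (auto simp: C1_on_def)
      have "isCont (pdx f) x" "isCont (pdy f) x" if "x \<in> S" for x
        using *[OF that] by (auto simp: C1_on_def continuous_on_eq_continuous_at)
      then show "continuous_on S (pdx f)" "continuous_on S (pdy f)"
        by (auto intro: continuous_at_imp_continuous_on)
    qed
  qed
  show ?thesis
    unfolding harmonic_on_def
  proof (intro conjI ballI)
    show "C1_on h S" "C1_on (pdx h) S" "C1_on (pdy h) S"
      by (rule C1, simp add: harmonic_on_def)+
    show "pdx (pdx h) x + pdy (pdy h) x = 0" if "x \<in> S" for x
      using loc[OF that] by (auto simp: harmonic_on_def)
  qed
qed

text \<open>Schwarz's theorem: the mean value theorem, applied twice in either order, turns the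
  second difference \<Delta> of \<open>f\<close> over a small square into t^2 times a value of
  either mixed partial.\<close>

lemma mixed_partials_commute:
  assumes S: "open S" "x0 \<in> S" and f: "C1_on f S" "C1_on (pdx f) S" "C1_on (pdy f) S"
  shows "pdy (pdx f) x0 = pdx (pdy f) x0"
proof (rule ccontr)
  define A where "A = pdy (pdx f)"
  define B where "B = pdx (pdy f)"
  assume "\<not> ?thesis"
  then have ne: "dist (A x0) (B x0) > 0" by (simp add: A_def B_def)
  define e where "e = dist (A x0) (B x0) / 2"
  have e: "e > 0" using ne by (simp add: e_def)
  have "isCont A x0" "isCont B x0"
    using f S by (auto simp: C1_on_def continuous_on_eq_continuous_at A_def B_def)
  then obtain d1 d2 where d12: "d1 > 0" "d2 > 0" "\<And>y. dist y x0 < d1 \<Longrightarrow> dist (A y) (A x0) < e"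
      "\<And>y. dist y x0 < d2 \<Longrightarrow> dist (B y) (B x0) < e"
    unfolding continuous_at_eps_delta using e by (metis (no_types, lifting) dist_commute)
  obtain d3 where d3: "d3 > 0" "ball x0 d3 \<subseteq> S" using S openE by blast
  \<comment> \<open>Points of the square of side \<open>t\<close> with corner \<open>x0\<close> have
    distance at most 2t < 3t from \<open>x0\<close>, so they stay in all three balls.\<close>
  define t where "t = min d1 (min d2 d3) / 3"
  have t: "t > 0" using d12 d3 by (simp add: t_def)
  define Z where "Z = (\<lambda>a b. x0 + Complex a b)"
  have Z: "dist (Z a b) x0 < 3 * t" if "0 \<le> a" "a \<le> t" "0 \<le> b" "b \<le> t" for a b
  proof -
    have "dist (Z a b) x0 = cmod (Complex a b)" by (simp add: Z_def dist_norm)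
    also have "\<dots> \<le> \<bar>a\<bar> + \<bar>b\<bar>" using cmod_le[of "Complex a b"] by simp
    finally show ?thesis using that t by simp
  qed
  have ZS: "Z a b \<in> S" if "0 \<le> a" "a \<le> t" "0 \<le> b" "b \<le> t" for a b
    using Z[OF that] d3 by (auto simp: t_def dist_commute)
  have dx: "((\<lambda>r. g (Z r b)) has_real_derivative pdx g (Z a b)) (at a)"
    and dy: "((\<lambda>r. g (Z a r)) has_real_derivative pdy g (Z a b)) (at b)"
    if "C1_on g S" "Z a b \<in> S" for g a b
  proof -
    have g: "(g has_derivative (\<lambda>d. Re d * pdx g (Z a b) + Im d * pdy g (Z a b))) (at (Z a b))"
      using that has_derivative_pd by (auto simp: C1_on_def)
    have "((\<lambda>r. Z r b) has_derivative (\<lambda>r. of_real r)) (at a)"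
    proof -
      have "(\<lambda>r. Z r b) = (\<lambda>r. x0 + (of_real r + \<i> * of_real b))" by (simp add: Z_def Complex_eq)
      then show ?thesis by (auto intro!: derivative_eq_intros)
    qed
    from has_derivative_compose[OF this g]
    show "((\<lambda>r. g (Z r b)) has_real_derivative pdx g (Z a b)) (at a)"
      by (simp add: has_field_derivative_def mult_commute_abs)
    have "((\<lambda>r. Z a r) has_derivative (\<lambda>r. \<i> * of_real r)) (at b)"
    proof -
      have "(\<lambda>r. Z a r) = (\<lambda>r. x0 + (of_real a + \<i> * of_real r))" by (simp add: Z_def Complex_eq)
      then show ?thesis by (auto intro!: derivative_eq_intros)
    qed
    from has_derivative_compose[OF this g]
    show "((\<lambda>r. g (Z a r)) has_real_derivative pdy g (Z a b)) (at b)"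
      by (simp add: has_field_derivative_def mult_commute_abs)
  qed
  define \<Delta> where "\<Delta> = f (Z t t) - f (Z t 0) - f (Z 0 t) + f (Z 0 0)"
  have "\<exists>a b. 0 < a \<and> a < t \<and> 0 < b \<and> b < t \<and> \<Delta> = t * (t * A (Z a b))"
  proof -
    have "\<exists>a. 0 < a \<and> a < t \<and> (f (Z t t) - f (Z t 0)) - (f (Z 0 t) - f (Z 0 0))
        = (t - 0) * (pdx f (Z a t) - pdx f (Z a 0))"
      by (rule MVT2) (use t f ZS in \<open>auto intro!: DERIV_diff dx\<close>)
    then obtain a where a: "0 < a" "a < t" "\<Delta> = t * (pdx f (Z a t) - pdx f (Z a 0))"
      by (auto simp: \<Delta>_def)
    have "\<exists>b. 0 < b \<and> b < t \<and> pdx f (Z a t) - pdx f (Z a 0) = (t - 0) * A (Z a b)"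
      unfolding A_def by (rule MVT2) (use t f ZS a in \<open>auto intro!: dy\<close>)
    then show ?thesis using a by auto
  qed
  then obtain a b where ab: "0 < a" "a < t" "0 < b" "b < t" "\<Delta> = t * (t * A (Z a b))" by blast
  have "\<exists>a b. 0 < a \<and> a < t \<and> 0 < b \<and> b < t \<and> \<Delta> = t * (t * B (Z a b))"
  proof -
    have "\<exists>b. 0 < b \<and> b < t \<and> (f (Z t t) - f (Z 0 t)) - (f (Z t 0) - f (Z 0 0))
        = (t - 0) * (pdy f (Z t b) - pdy f (Z 0 b))"
      by (rule MVT2) (use t f ZS in \<open>auto intro!: DERIV_diff dy\<close>)
    then obtain b where b: "0 < b" "b < t" "\<Delta> = t * (pdy f (Z t b) - pdy f (Z 0 b))"
      by (auto simp: \<Delta>_def)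
    have "\<exists>a. 0 < a \<and> a < t \<and> pdy f (Z t b) - pdy f (Z 0 b) = (t - 0) * B (Z a b)"
      unfolding B_def by (rule MVT2) (use t f ZS b in \<open>auto intro!: dx\<close>)
    then show ?thesis using b by auto
  qed
  then obtain a' b' where ab': "0 < a'" "a' < t" "0 < b'" "b' < t" "\<Delta> = t * (t * B (Z a' b'))" by blast
  have "A (Z a b) = B (Z a' b')" using ab(5) ab'(5) t by simp
  moreover have "dist (A (Z a b)) (A x0) < e"
    using Z[of a b] ab by (intro d12) (auto simp: t_def)
  moreover have "dist (B (Z a' b')) (B x0) < e"
    using Z[of a' b'] ab' by (intro d12) (auto simp: t_def)
  ultimately show False
    unfolding e_def using dist_triangle3[of "A x0" "B x0" "A (Z a b)"] by simp
qed

text \<open>For h_x - i h_y the Cauchy-Riemann equations are the Laplace equation and the equality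
  of the mixed partials.\<close>

lemma
  assumes S: "open S" and h: "harmonic_on h S"
  shows harmonic_on_gradient_holomorphic: "(\<lambda>x. Complex (pdx h x) (- pdy h x)) holomorphic_on S"
    and harmonic_on_has_derivative:
      "x \<in> S \<Longrightarrow> (h has_derivative (\<lambda>d. Re (Complex (pdx h x) (- pdy h x) * d))) (at x)"
proof -
  have C: "C1_on h S" "C1_on (pdx h) S" "C1_on (pdy h) S"
    using h by (auto simp: harmonic_on_def)
  show "(\<lambda>x. Complex (pdx h x) (- pdy h x)) holomorphic_on S"
    unfolding holomorphic_on_open[OF S]
  proof
    fix x assume x: "x \<in> S"
    define a where "a = pdx (pdx h) x"
    define b where "b = pdy (pdx h) x"
    have b: "pdx (pdy h) x = b" using mixed_partials_commute[OF S x C] by (simp add: b_def)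
    have a: "pdy (pdy h) x = - a" using h x by (auto simp: harmonic_on_def a_def)
    have 1: "(pdx h has_derivative (\<lambda>d. Re d * a + Im d * b)) (at x)"
      using has_derivative_pd[of "pdx h" x] C x by (auto simp: C1_on_def a_def b_def)
    have 2: "(pdy h has_derivative (\<lambda>d. Re d * b + Im d * (- a))) (at x)"
      using has_derivative_pd[of "pdy h" x] C x a b by (auto simp: C1_on_def)
    have "((\<lambda>x. of_real (pdx h x) + \<i> * of_real (- pdy h x)) has_derivative
        (\<lambda>d. of_real (Re d * a + Im d * b) + \<i> * of_real (- (Re d * b + Im d * (- a))))) (at x)"
      by (intro has_derivative_add has_derivative_mult_right has_derivative_of_real has_derivative_minus 1 2)
    moreover have "(\<lambda>d. of_real (Re d * a + Im d * b) + \<i> * of_real (- (Re d * b + Im d * (- a))))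
        = (*) (Complex a (- b))"
      by (auto simp: fun_eq_iff complex_eq_iff algebra_simps)
    ultimately show "\<exists>f'. ((\<lambda>x. Complex (pdx h x) (- pdy h x)) has_field_derivative f') (at x)"
      unfolding has_field_derivative_def by (auto simp: Complex_eq)
  qed
  show "(h has_derivative (\<lambda>d. Re (Complex (pdx h x) (- pdy h x) * d))) (at x)" if x: "x \<in> S"
    using has_derivative_pd[of h x] C x by (auto simp: C1_on_def mult.commute)
qed

subsection \<open>Expansions at infinity\<close>

lemma contour_integral_concentric_circlepaths:
  assumes f: "f holomorphic_on - cball 0 m" and "0 \<le> m" "m < r1" "r1 \<le> r2"
  shows "contour_integral (circlepath 0 r1) f = contour_integral (circlepath 0 r2) f"
proof (rule Cauchy_theorem_homotopic_loops[OF _ _ f])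
  show "homotopic_loops (- cball 0 m) (circlepath 0 r1) (circlepath 0 r2)"
  proof (rule homotopic_loops_linear)
    fix t :: real
    show "closed_segment (circlepath 0 r1 t) (circlepath 0 r2 t) \<subseteq> - cball 0 m"
    proof
      fix x assume "x \<in> closed_segment (circlepath 0 r1 t) (circlepath 0 r2 t)"
      then obtain v where v: "0 \<le> v" "v \<le> 1"
          "x = (1 - v) *\<^sub>R circlepath 0 r1 t + v *\<^sub>R circlepath 0 r2 t"
        by (auto simp: in_segment)
      then have "x = of_real ((1 - v) * r1 + v * r2) * exp (2 * of_real pi * \<i> * t)"
        by (simp add: circlepath scaleR_conv_of_real algebra_simps)
      then have "norm x = \<bar>(1 - v) * r1 + v * r2\<bar>"
        by (simp only: norm_mult norm_of_real) simp
      moreover have "(1 - v) * r1 + v * r2 \<ge> (1 - v) * r1 + v * r1"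
        using v assms by (intro add_left_mono mult_left_mono) auto
      ultimately show "x \<in> - cball 0 m"
        using assms by (simp add: algebra_simps)
    qed
  qed simp_all
qed (simp_all add: open_Compl)

text \<open>In the coordinate 1/x this is Riemann's theorem on removable singularities at 0.\<close>

lemma bounded_at_infinity_imp_convergent:
  assumes f: "f holomorphic_on - cball 0 R" and B: "\<forall>\<^sub>F x in at_infinity. norm (f x) \<le> B"
  shows "\<exists>l. (f \<longlongrightarrow> l) at_infinity"
proof -
  define r where "r = 1 / max R 1"
  have r: "r > 0" by (simp add: r_def)
  have "(f \<circ> inverse) holomorphic_on ball 0 r - {0}"
  proof (rule holomorphic_on_compose_gen[OF _ f])
    show "inverse ` (ball 0 r - {0 :: complex}) \<subseteq> - cball 0 R"
    proof
      fix x assume "x \<in> inverse ` (ball 0 r - {0 :: complex})"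
      then obtain y where "x = inverse y" "y \<in> ball 0 r - {0}" by blast
      then have y: "x = inverse y" "y \<noteq> 0" "norm y < r" by auto
      then have "inverse r < inverse (norm y)" by (intro less_imp_inverse_less) auto
      then show "x \<in> - cball 0 R" using y by (simp add: r_def norm_inverse)
    qed
  qed (auto intro!: holomorphic_intros)
  then have "(\<lambda>y. f (inverse y)) holomorphic_on ball 0 r - {0}"
    by (simp add: o_def)
  moreover have "\<forall>\<^sub>F y in at 0. norm (f (inverse y)) \<le> B"
    using B unfolding at_to_infinity[where 'a=complex] by (simp add: eventually_filtermap)
  ultimately obtain g where g: "g holomorphic_on ball 0 r" "\<And>y. y \<in> ball 0 r - {0} \<Longrightarrow> g y = f (inverse y)"
    using holomorphic_on_extend_bounded[of "\<lambda>y. f (inverse y)" "ball 0 r" 0] r by auto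
  have "isCont g 0"
    using g(1) r holomorphic_on_imp_continuous_on continuous_on_eq_continuous_at[of "ball 0 r"]
    by (metis centre_in_ball open_ball)
  then have "g \<midarrow>0\<rightarrow> g 0" by (simp add: isCont_def)
  moreover have "\<forall>\<^sub>F y in at 0. g y = (f \<circ> inverse) y"
    using r g(2) eventually_at[of _ "0::complex" UNIV] by (force simp: dist_norm)
  ultimately have "((f \<circ> inverse) \<longlongrightarrow> g 0) (at 0)"
    using tendsto_cong by blast
  then show ?thesis using lim_at_infinity_0 by blast
qed

text \<open>The entire part \<open>e\<close> of the Laurent expansion of \<open>f\<close> at infinity; \<open>\<rho>\<close> is the coefficient
  of \<open>1 / x\<close>.\<close>

lemma Laurent_entire_part:
  assumes f: "f holomorphic_on - cball 0 R"
  shows "\<exists>e \<rho>. e holomorphic_on UNIV \<and> ((\<lambda>x. (f x - e x) * x) \<longlongrightarrow> \<rho>) at_infinity"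
proof -
  define R0 where "R0 = max R 0"
  have f0: "f holomorphic_on - cball 0 R0" and R0: "R0 \<ge> 0"
    using f by (auto simp: R0_def elim!: holomorphic_on_subset)
  define I where "I = (\<lambda>\<rho> x. contour_integral (circlepath 0 \<rho>) (\<lambda>\<zeta>. f \<zeta> / (\<zeta> - x)))"
  have cf: "continuous_on (path_image (circlepath 0 \<rho>)) f" if "\<rho> > R0" for \<rho>
    using that R0 by (intro holomorphic_on_imp_continuous_on holomorphic_on_subset[OF f0]) auto
  have int: "(\<lambda>\<zeta>. f \<zeta> / (\<zeta> - x)) contour_integrable_on (circlepath 0 \<rho>)"
    if "\<rho> > R0" "norm x \<noteq> \<rho>" for x \<rho>
    using that R0 cf[OF that(1)]
    by (intro contour_integrable_continuous_circlepath continuous_intros) auto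
  have indep: "I r1 x = I r2 x" if "norm x < r1" "R0 < r1" "r1 \<le> r2" for x r1 r2
    unfolding I_def
  proof (rule contour_integral_concentric_circlepaths[of _ "max R0 (norm x)"])
    show "(\<lambda>\<zeta>. f \<zeta> / (\<zeta> - x)) holomorphic_on - cball 0 (max R0 (norm x))"
      by (intro holomorphic_intros holomorphic_on_subset[OF f0]) (use that in auto)
  qed (use that R0 in auto)
  have hol: "I \<rho> holomorphic_on ball 0 \<rho>" if "\<rho> > R0" for \<rho>
  proof -
    have i: "((\<lambda>u. f u / (u - w) ^ 1) has_contour_integral I \<rho> w) (circlepath 0 \<rho>)"
      if "w \<in> ball 0 \<rho>" for w
      unfolding I_def using int[of \<rho> w] that \<open>\<rho> > R0\<close> by (simp add: has_contour_integral_integral)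
    show ?thesis
      unfolding holomorphic_on_open[OF open_ball]
      using Cauchy_next_derivative_circlepath(2)[OF cf[OF that] i one_neq_zero] by blast
  qed
  \<comment> \<open>The radius varies with \<open>x\<close> so that \<open>e\<close> is defined on
    the whole plane; by \<open>indep\<close> it is near each point a Cauchy integral over a fixed
    circle.\<close>
  define e where "e = (\<lambda>x. I (max R0 (norm x) + 1) x / (2 * of_real pi * \<i>))"
  have e: "e x = I \<rho> x / (2 * of_real pi * \<i>)" if "\<rho> > R0" "norm x < \<rho>" for x \<rho>
  proof -
    have m: "norm x < max R0 (norm x) + 1" "R0 < max R0 (norm x) + 1" by simp_all
    consider "\<rho> \<le> max R0 (norm x) + 1" | "max R0 (norm x) + 1 \<le> \<rho>" by linarith
    then have "I (max R0 (norm x) + 1) x = I \<rho> x"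
      using indep[OF that(2,1)] indep[OF m] by cases metis+
    then show ?thesis by (simp only: e_def)
  qed
  have "e holomorphic_on UNIV"
    unfolding holomorphic_on_def
  proof
    fix x :: complex
    define \<rho> where "\<rho> = max R0 (norm x) + 1"
    have \<rho>: "\<rho> > R0" "norm x < \<rho>" by (auto simp: \<rho>_def)
    have "(\<lambda>x. I \<rho> x / (2 * of_real pi * \<i>)) holomorphic_on ball 0 \<rho>"
      by (intro holomorphic_intros hol \<rho>) auto
    then have "e holomorphic_on ball 0 \<rho>"
      by (rule holomorphic_transform) (use e \<rho> in auto)
    then show "e field_differentiable at x within UNIV"
      using \<rho> by (auto simp: holomorphic_on_imp_differentiable_at)
  qed
  moreover have "\<exists>\<rho>. ((\<lambda>x. (f x - e x) * x) \<longlongrightarrow> \<rho>) at_infinity"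
  proof -
    define r where "r = R0 + 1"
    have r: "r > R0" "r > 0" using R0 by (auto simp: r_def)
    have n: "f x - e x = - I r x / (2 * of_real pi * \<i>)" if x: "norm x > r" for x
    proof -
      define \<rho> where "\<rho> = norm x + 1"
      \<comment> \<open>\<open>K\<close> is holomorphic across \<open>x\<close>, so its integrals
        over the circle of radius \<open>r\<close>, which leaves \<open>x\<close> outside, and over
        that of radius \<open>\<rho>\<close>, which encloses \<open>x\<close>, agree. This is the
        Cauchy formula for an annulus.\<close>
      define K where "K = (\<lambda>\<zeta>. if \<zeta> = x then deriv f x else (f \<zeta> - f x) / (\<zeta> - x))"
      have K: "K holomorphic_on - cball 0 R0"
        unfolding K_def by (rule pole_lemma_open[OF f0]) auto
      have eq: "contour_integral (circlepath 0 s) K = I s x - f x * contour_integral (circlepath 0 s) (\<lambda>\<zeta>. 1 / (\<zeta> - x))"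
        if s: "s > R0" "norm x \<noteq> s" for s
      proof -
        have i1: "(\<lambda>\<zeta>. 1 / (\<zeta> - x)) contour_integrable_on (circlepath 0 s)"
          using s R0 by (intro contour_integrable_continuous_circlepath continuous_intros) auto
        have "contour_integral (circlepath 0 s) K
            = contour_integral (circlepath 0 s) (\<lambda>\<zeta>. f \<zeta> / (\<zeta> - x) - f x * (1 / (\<zeta> - x)))"
          using s R0 by (intro contour_integral_cong) (auto simp: K_def diff_divide_distrib)
        also have "\<dots> = I s x - f x * contour_integral (circlepath 0 s) (\<lambda>\<zeta>. 1 / (\<zeta> - x))"
          using int[OF s] i1 unfolding I_def
          by (subst contour_integral_diff[OF _ contour_integrable_lmul]) (simp_all only: contour_integral_lmul)
        finally show ?thesis .
      qed
      have "contour_integral (circlepath 0 r) K = contour_integral (circlepath 0 \<rho>) K"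
        using x r R0 by (intro contour_integral_concentric_circlepaths[OF K]) (auto simp: \<rho>_def)
      moreover have "contour_integral (circlepath 0 r) (\<lambda>\<zeta>. 1 / (\<zeta> - x)) = 0"
        using x r by (intro contour_integral_unique Cauchy_theorem_disc_simple[of _ 0 "norm x"])
          (auto intro!: holomorphic_intros)
      moreover have "contour_integral (circlepath 0 \<rho>) (\<lambda>\<zeta>. 1 / (\<zeta> - x)) = 2 * of_real pi * \<i>"
        using contour_integral_unique[OF Cauchy_integral_circlepath_simple[of "\<lambda>_. 1" 0 \<rho> x]]
        by (simp add: \<rho>_def)
      ultimately have "I r x = I \<rho> x - f x * (2 * of_real pi * \<i>)"
        using eq[of r] eq[of \<rho>] x r by (simp add: \<rho>_def)
      moreover have "e x = I \<rho> x / (2 * of_real pi * \<i>)"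
        using x r by (intro e) (auto simp: \<rho>_def)
      ultimately show ?thesis by (simp add: field_simps)
    qed
    have "compact (f ` sphere 0 r)"
      using r R0 by (intro compact_continuous_image holomorphic_on_imp_continuous_on holomorphic_on_subset[OF f0]) auto
    then obtain B where B: "B > 0" "\<And>\<zeta>. norm \<zeta> = r \<Longrightarrow> norm (f \<zeta>) \<le> B"
      using compact_imp_bounded bounded_pos by (metis imageI mem_sphere_0)
    \<comment> \<open>\<open>f - e\<close> is a Cauchy integral over |\<zeta>| = r, hence O(1 / (|x|
      - r)), and |x| \<ge> 2 r gives |x| \<le> 2 (|x| - r).\<close>
    have bound: "norm ((f x - e x) * x) \<le> 2 * B * r" if x: "norm x \<ge> 2 * r" for x
    proof -
      have x': "norm x > r" using x r by auto
      have "norm (I r x) \<le> B / (norm x - r) * (2 * pi * r)"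
      proof (rule has_contour_integral_bound_circlepath)
        show "((\<lambda>\<zeta>. f \<zeta> / (\<zeta> - x)) has_contour_integral I r x) (circlepath 0 r)"
          unfolding I_def using int[of r x] r x' by (simp add: has_contour_integral_integral)
        fix \<zeta> :: complex assume z: "norm (\<zeta> - 0) = r"
        then have "norm (\<zeta> - x) \<ge> norm x - r" using norm_triangle_ineq2[of x \<zeta>] by (simp add: norm_minus_commute)
        then show "norm (f \<zeta> / (\<zeta> - x)) \<le> B / (norm x - r)"
          using B z x' by (auto simp: norm_divide intro!: frac_le)
      qed (use B r x' in auto)
      then have "norm (f x - e x) \<le> B / (norm x - r) * r"
        unfolding n[OF x'] using x' by (simp add: norm_divide norm_mult divide_simps mult_ac)
      then have "norm ((f x - e x) * x) \<le> B / (norm x - r) * r * norm x"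
        unfolding norm_mult by (rule mult_right_mono) simp
      also have "\<dots> \<le> 2 * B * r"
      proof -
        have "norm x / (norm x - r) \<le> 2" using x x' by (simp add: field_simps)
        then have "B * r * (norm x / (norm x - r)) \<le> B * r * 2"
          using B r by (intro mult_left_mono) auto
        then show ?thesis by (simp add: mult_ac)
      qed
      finally show ?thesis .
    qed
    show ?thesis
    proof (rule bounded_at_infinity_imp_convergent[of _ R0])
      show "(\<lambda>x. (f x - e x) * x) holomorphic_on - cball 0 R0"
        using f0 \<open>e holomorphic_on UNIV\<close> by (auto intro!: holomorphic_intros elim: holomorphic_on_subset)
      show "\<forall>\<^sub>F x in at_infinity. norm ((f x - e x) * x) \<le> 2 * B * r"
        using bound unfolding eventually_at_infinity by blast
    qed
  qed
  ultimately show ?thesis by blast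
qed

lemma derivative_of_entire:
  assumes "\<And>x. (E has_field_derivative e x) (at x)"
  shows "e holomorphic_on UNIV"
proof -
  have "E holomorphic_on UNIV" using assms by (auto simp: holomorphic_on_open)
  moreover have "e = deriv E" using DERIV_imp_deriv[OF assms] by auto
  ultimately show ?thesis by (simp add: holomorphic_deriv)
qed

text \<open>\<open>f - e\<close> is \<rho> / x plus a term of order x^(-2). The latter has a
  single-valued primitive with a limit at infinity, and Re (\<rho> Log x) can belong to the
  single-valued \<phi> only if \<rho> is real.\<close>

lemma harmonic_asymptotics:
  fixes \<phi> :: "complex \<Rightarrow> real"
  assumes f: "f holomorphic_on - cball 0 R"
    and \<phi>: "\<And>x. x \<in> - cball 0 R \<Longrightarrow> (\<phi> has_derivative (\<lambda>d. Re (f x * d))) (at x)"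
    and e: "\<And>x. (E has_field_derivative e x) (at x)"
    and lim: "((\<lambda>x. (f x - e x) * x) \<longlongrightarrow> \<rho>) at_infinity"
  shows "Im \<rho> = 0 \<and> (\<exists>C. ((\<lambda>x. \<phi> x - (Re (E x) + Re \<rho> * ln (norm x))) \<longlongrightarrow> C) at_infinity)"
proof -
  define R0 where "R0 = max R 1"
  have R0: "R0 > 0" by (simp add: R0_def)
  define r where "r = 1 / R0"
  have r: "r > 0" using R0 by (simp add: r_def)
  have R: "x \<in> - cball 0 R" "x \<noteq> 0" "inverse x \<in> ball 0 r" if "norm x > R0" for x :: complex
  proof -
    show "x \<in> - cball 0 R" "x \<noteq> 0" using that R0 by (auto simp: R0_def)
    have "inverse (norm x) < inverse R0" using that R0 by (rule less_imp_inverse_less)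
    then show "inverse x \<in> ball 0 r" by (simp add: r_def norm_inverse inverse_eq_divide norm_divide)
  qed
  have eh: "e holomorphic_on UNIV" by (rule derivative_of_entire[OF e])
  \<comment> \<open>\<open>b\<close> is x (f(x) - e(x)) in the coordinate y = 1/x;
    \<open>lim\<close> makes \<rho> its value at 0.\<close>
  define b where "b = (\<lambda>y. if y = 0 then \<rho> else (f (inverse y) - e (inverse y)) * inverse y)"
  have "b holomorphic_on ball 0 r"
  proof (rule no_isolated_singularity[of _ _ "{0}"])
    have "(\<lambda>y. (f (inverse y) - e (inverse y)) * inverse y) holomorphic_on ball 0 r - {0}"
    proof (intro holomorphic_intros)
      have i: "inverse holomorphic_on ball 0 r - {0}" by (auto intro!: holomorphic_intros)
      have "inverse ` (ball 0 r - {0 :: complex}) \<subseteq> - cball 0 R"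
      proof
        fix x assume "x \<in> inverse ` (ball 0 r - {0 :: complex})"
        then obtain y where "x = inverse y" "y \<in> ball 0 r - {0}" by blast
      then have y: "x = inverse y" "y \<noteq> 0" "norm y < r" by auto
        then have "inverse r < inverse (norm y)" by (intro less_imp_inverse_less) auto
        then show "x \<in> - cball 0 R" using y R0 by (simp add: r_def R0_def norm_inverse)
      qed
      then show "(\<lambda>y. f (inverse y)) holomorphic_on ball 0 r - {0}"
        using holomorphic_on_compose_gen[OF i f] by (simp add: o_def)
      show "(\<lambda>y. e (inverse y)) holomorphic_on ball 0 r - {0}"
        using holomorphic_on_compose_gen[OF i eh] by (simp add: o_def)
    qed auto
    then show h: "b holomorphic_on ball 0 r - {0}"
      by (rule holomorphic_transform) (auto simp: b_def)
    have "((\<lambda>y. (f (inverse y) - e (inverse y)) * inverse y) \<longlongrightarrow> \<rho>) (at 0)"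
      using lim by (simp add: lim_at_infinity_0 o_def)
    then have "(b \<longlongrightarrow> \<rho>) (at 0)"
      by (rule Lim_transform_eventually) (auto simp: b_def eventually_at_filter)
    then have "isCont b 0" by (simp add: isCont_def b_def)
    moreover have "isCont b y" if "y \<in> ball 0 r" "y \<noteq> 0" for y
      using holomorphic_on_imp_continuous_on[OF h] that
      by (auto simp: continuous_on_eq_continuous_at open_delete)
    ultimately show "continuous_on (ball 0 r) b"
      by (intro continuous_at_imp_continuous_on) metis
  qed auto
  then have kh: "(\<lambda>y. if y = 0 then deriv b 0 else (b y - b 0) / (y - 0)) holomorphic_on ball 0 r"
    by (rule pole_lemma_open) auto
  then obtain N where N: "\<And>y. y \<in> ball 0 r \<Longrightarrow>
      (N has_field_derivative (if y = 0 then deriv b 0 else (b y - b 0) / (y - 0))) (at y)"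
    using holomorphic_convex_primitive'[OF convex_ball open_ball kh] by (metis at_within_open open_ball)
  \<comment> \<open>Substituting y = 1/x contributes the factor -1/x^2, so the primitive
    \<open>N\<close> of (b(y) - b(0)) / y becomes a primitive of \<rho> / x - (f - e) with limit
    \<open>N 0\<close> at infinity.\<close>
  define M where "M = (\<lambda>x. N (inverse x))"
  have M: "(M has_field_derivative (\<rho> / x - (f x - e x))) (at x)" if "norm x > R0" for x
  proof -
    have "(M has_field_derivative (if inverse x = 0 then deriv b 0 else (b (inverse x) - b 0) / (inverse x - 0)) * (- (inverse x * 1 * inverse x))) (at x)"
      unfolding M_def by (rule DERIV_chain2[where f=N and g=inverse, OF N[OF R(3)[OF that]]])
        (use R[OF that] in \<open>auto intro!: derivative_eq_intros\<close>)
    moreover have "(if inverse x = 0 then deriv b 0 else (b (inverse x) - b 0) / (inverse x - 0)) * (- (inverse x * 1 * inverse x))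
        = \<rho> / x - (f x - e x)"
      using R[OF that] by (simp add: b_def field_simps)
    ultimately show ?thesis by simp
  qed
  define T where "T = (\<lambda>x. \<phi> x - Re (E x) - Re \<rho> * ln (norm x) + Re (M x))"
  have T: "(T has_derivative (\<lambda>d. Re (\<i> * Im \<rho> / x * d))) (at x)" if x: "norm x > R0" for x
  proof -
    have ln: "((\<lambda>x. ln (norm x)) has_derivative (\<lambda>d. Re (1 / x * d))) (at x)"
    proof -
      have x0: "x \<noteq> 0" using R[OF x] by auto
      have "((\<lambda>x. ln (norm x)) has_derivative (\<lambda>d. (1 / norm x) * (inner x d / norm x))) (at x)"
        using has_derivative_ln[OF _ has_derivative_norm[OF x0]] x0
        by (simp add: sgn_div_norm inner_commute field_simps)
      moreover have "(1 / norm x) * (inner x d / norm x) = Re (1 / x * d)" for d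
        using x0 by (simp add: inner_complex_def Re_divide cmod_def add_nonneg_nonneg field_simps flip: power2_eq_square)
      ultimately show ?thesis by simp
    qed
    have "(T has_derivative (\<lambda>d. Re (f x * d) - Re (e x * d) - Re \<rho> * Re (1 / x * d) + Re ((\<rho> / x - (f x - e x)) * d))) (at x)"
      unfolding T_def
      by (intro has_derivative_add has_derivative_diff has_derivative_mult_right ln \<phi> R x)
        (use has_derivative_Re[OF has_field_derivative_imp_has_derivative[OF e]]
          has_derivative_Re[OF has_field_derivative_imp_has_derivative[OF M[OF x]]] in auto)
    moreover have "Re (f x * d) - Re (e x * d) - Re \<rho> * Re (1 / x * d) + Re ((\<rho> / x - (f x - e x)) * d)
        = Re (\<i> * Im \<rho> / x * d)" for d
    proof -
      have "Re \<rho> * Re (1 / x * d) = Re (Re \<rho> * (1 / x * d))"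
        by (simp only: times_complex.sel Re_complex_of_real Im_complex_of_real mult_zero_left diff_zero)
      then have "Re (f x * d) - Re (e x * d) - Re \<rho> * Re (1 / x * d) + Re ((\<rho> / x - (f x - e x)) * d)
        = Re ((\<rho> - Re \<rho>) / x * d)"
        by (simp only: flip: minus_complex.sel plus_complex.sel) (simp add: algebra_simps diff_divide_distrib)
      also have "\<rho> - Re \<rho> = \<i> * Im \<rho>" by (simp add: complex_eq_iff)
      finally show ?thesis .
    qed
    ultimately show ?thesis by simp
  qed
  \<comment> \<open>The differential of \<open>T\<close> is - Im \<rho> times that of the angle, so
    one turn around a circle would change \<open>T\<close> by -2 pi Im \<rho>; but \<open>T\<close>
    is single valued.\<close>
  have im: "Im \<rho> = 0"
  proof -
    define c where "c = (\<lambda>t::real. of_real (R0 + 1) * exp (\<i> * of_real t))"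
    have nc: "norm (c t) > R0" "c t \<noteq> 0" for t
    proof -
      show "norm (c t) > R0" using R0 unfolding c_def norm_mult norm_of_real by simp
      then show "c t \<noteq> 0" using R0 by auto
    qed
    have "((\<lambda>t. T (c t)) has_real_derivative - Im \<rho>) (at t)" for t
    proof -
      have "(c has_vector_derivative (\<i> * c t)) (at t)"
      proof -
        have "((\<lambda>z. of_real (R0 + 1) * exp (\<i> * z)) has_field_derivative (\<i> * c t)) (at (of_real t))"
          unfolding c_def by (auto intro!: derivative_eq_intros)
        then show ?thesis
          unfolding c_def by (rule has_vector_derivative_real_field)
      qed
      then have "(c has_derivative (\<lambda>h. h *\<^sub>R (\<i> * c t))) (at t)"
        by (simp add: has_vector_derivative_def)
      from has_derivative_compose[OF this T[OF nc(1)]]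
      have "((\<lambda>t. T (c t)) has_derivative (\<lambda>h. Re (\<i> * Im \<rho> / c t * (h *\<^sub>R (\<i> * c t))))) (at t)" .
      moreover have "Re (\<i> * Im \<rho> / c t * (h *\<^sub>R (\<i> * c t))) = - Im \<rho> * h" for h
        using nc(2)[of t] by (simp add: scaleR_conv_of_real)
      ultimately show ?thesis by (simp only: has_field_derivative_def)
    qed
    then have "T (c (2 * pi)) - T (c 0) = (2 * pi - 0) * (- Im \<rho>)"
      using MVT2[of 0 "2 * pi" "\<lambda>t. T (c t)" "\<lambda>_. - Im \<rho>"] by auto
    moreover have "c (2 * pi) = c 0" by (simp add: c_def exp_eq_polar cis_2pi)
    ultimately show ?thesis by simp
  qed
  moreover have "\<exists>C. ((\<lambda>x. \<phi> x - (Re (E x) + Re \<rho> * ln (norm x))) \<longlongrightarrow> C) at_infinity"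
  proof -
    have "connected (- cball 0 R0 :: complex set)"
      by (rule connected_complement_bounded_convex) auto
    then have const: "T x = T y" if "norm x > R0" "norm y > R0" for x y
      using has_derivative_zero_unique_connected[of "- cball 0 R0" T x y] T im that by auto
    define C where "C = T (of_real (R0 + 1))"
    have ev: "\<forall>\<^sub>F x in at_infinity. C - Re (M x) = \<phi> x - (Re (E x) + Re \<rho> * ln (norm x))"
      unfolding eventually_at_infinity
    proof (intro exI allI impI)
      fix x :: complex assume "R0 + 1 \<le> norm x"
      then have "T x = C" using R0 unfolding C_def by (intro const) auto
      then show "C - Re (M x) = \<phi> x - (Re (E x) + Re \<rho> * ln (norm x))" by (simp add: T_def)
    qed
    have "isCont N 0" using N[of 0] r DERIV_isCont by auto
    then have "(M \<longlongrightarrow> N 0) at_infinity"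
      unfolding M_def using isCont_tendsto_compose tendsto_inverse_0 by blast
    then have "((\<lambda>x. C - Re (M x)) \<longlongrightarrow> C - Re (N 0)) at_infinity"
      by (intro tendsto_intros)
    then show ?thesis using Lim_transform_eventually[OF _ ev] by blast
  qed
  ultimately show ?thesis by blast
qed

subsection \<open>Area integrals of holomorphic functions\<close>

lemma measurable_Complex [measurable]:
  "(\<lambda>(a, b). Complex a b) \<in> borel_measurable (lborel \<Otimes>\<^sub>M lborel)"
proof -
  have "continuous_on UNIV (\<lambda>p. Complex (fst p) (snd p))"
    by (intro continuous_intros)
  then have "(\<lambda>p. Complex (fst p) (snd p)) \<in> borel_measurable borel"
    by (rule borel_measurable_continuous_onI)
  then show ?thesis by (simp add: case_prod_unfold lborel_prod)
qed

text \<open>Gives access to Fubini's theorem in the coordinates Re and Im.\<close>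

lemma lborel_complex_eq: "lborel = distr (lborel \<Otimes>\<^sub>M lborel) borel (\<lambda>(a, b). Complex a b)"
proof (rule lborel_eqI)
  fix l u :: complex assume le: "\<And>b. b \<in> Basis \<Longrightarrow> l \<bullet> b \<le> u \<bullet> b"
  have le': "Re l \<le> Re u" "Im l \<le> Im u"
    using le[of 1] le[of \<i>] by (auto simp: Basis_complex_def)
  have "(\<lambda>(a, b). Complex a b) -` box l u \<inter> space (lborel \<Otimes>\<^sub>M lborel) = {Re l<..<Re u} \<times> {Im l<..<Im u}"
    by (auto simp: box_def Basis_complex_def space_pair_measure)
  then have "emeasure (distr (lborel \<Otimes>\<^sub>M lborel) borel (\<lambda>(a, b). Complex a b)) (box l u)
      = emeasure lborel {Re l<..<Re u} * emeasure lborel {Im l<..<Im u}"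
    by (simp add: emeasure_distr lborel.emeasure_pair_measure_Times)
  also have "\<dots> = ennreal ((Re u - Re l) * (Im u - Im l))"
    using le' by (simp add: ennreal_mult)
  finally show "emeasure (distr (lborel \<Otimes>\<^sub>M lborel) borel (\<lambda>(a, b). Complex a b)) (box l u)
      = (\<Prod>b\<in>Basis. (u - l) \<bullet> b)"
    by (simp add: Basis_complex_def)
qed simp

text \<open>A shear translates every horizontal or vertical line by an amount that depends on the
  line, so Fubini reduces the claim to translation invariance on the real line.\<close>

lemma
  fixes g :: "complex \<Rightarrow> ennreal"
  assumes [measurable]: "g \<in> borel_measurable borel"
  shows nn_integral_shear_Re: "(\<integral>\<^sup>+z. g (Complex (Re z + s * Im z) (Im z)) \<partial>lborel) = (\<integral>\<^sup>+z. g z \<partial>lborel)"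
    and nn_integral_shear_Im: "(\<integral>\<^sup>+z. g (Complex (Re z) (Im z + s * Re z)) \<partial>lborel) = (\<integral>\<^sup>+z. g z \<partial>lborel)"
proof -
  have C: "(\<lambda>z. Complex (Re z + s * Im z) (Im z)) \<in> borel_measurable borel"
     "(\<lambda>z. Complex (Re z) (Im z + s * Re z)) \<in> borel_measurable borel"
    by (intro borel_measurable_continuous_onI continuous_intros)+
  have pair: "(\<integral>\<^sup>+z. h z \<partial>lborel) = (\<integral>\<^sup>+p. h (Complex (fst p) (snd p)) \<partial>(lborel \<Otimes>\<^sub>M lborel))"
    if [measurable]: "h \<in> borel_measurable borel" for h :: "complex \<Rightarrow> ennreal"
    by (subst lborel_complex_eq, subst nn_integral_distr) (auto simp: case_prod_unfold)
  have m: "(\<lambda>p. g (Complex (fst p + a * snd p) (snd p + b * fst p))) \<in> borel_measurable (lborel \<Otimes>\<^sub>M lborel)" for a b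
  proof -
    have "(\<lambda>p. Complex (fst p + a * snd p) (snd p + b * fst p)) \<in> borel_measurable borel"
      by (intro borel_measurable_continuous_onI continuous_intros)
    then have "(\<lambda>p. g (Complex (fst p + a * snd p) (snd p + b * fst p))) \<in> borel_measurable borel"
      by measurable
    then show ?thesis by (simp add: lborel_prod)
  qed
  have mg: "(\<lambda>x. g (Complex x b)) \<in> borel_measurable borel" "(\<lambda>x. g (Complex b x)) \<in> borel_measurable borel" for b
    by (intro measurable_compose[OF _ assms] borel_measurable_continuous_onI continuous_intros)+
  have "(\<integral>\<^sup>+z. g (Complex (Re z + s * Im z) (Im z)) \<partial>lborel)
      = (\<integral>\<^sup>+y. (\<integral>\<^sup>+x. g (Complex (x + s * y) y) \<partial>lborel) \<partial>lborel)"
    using pair[OF measurable_compose[OF C(1) assms]] lborel_pair.nn_integral_snd[OF m[of s 0]] by simp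
  also have "\<dots> = (\<integral>\<^sup>+y. (\<integral>\<^sup>+x. g (Complex x y) \<partial>lborel) \<partial>lborel)"
    using nn_integral_real_affine[OF mg(1), where c = 1 and t = "s * y" for y]
    by (simp add: add.commute[of _ "s * _"])
  also have "\<dots> = (\<integral>\<^sup>+z. g z \<partial>lborel)"
    using pair[OF assms] lborel_pair.nn_integral_snd[OF m[of 0 0]] by simp
  finally show "(\<integral>\<^sup>+z. g (Complex (Re z + s * Im z) (Im z)) \<partial>lborel) = (\<integral>\<^sup>+z. g z \<partial>lborel)" .
  have "(\<integral>\<^sup>+z. g (Complex (Re z) (Im z + s * Re z)) \<partial>lborel)
      = (\<integral>\<^sup>+x. (\<integral>\<^sup>+y. g (Complex x (y + s * x)) \<partial>lborel) \<partial>lborel)"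
    using pair[OF measurable_compose[OF C(2) assms]] lborel.nn_integral_fst[OF m[of 0 s]] by simp
  also have "\<dots> = (\<integral>\<^sup>+x. (\<integral>\<^sup>+y. g (Complex x y) \<partial>lborel) \<partial>lborel)"
    using nn_integral_real_affine[OF mg(2), where c = 1 and t = "s * y" for y]
    by (simp add: add.commute[of _ "s * _"])
  also have "\<dots> = (\<integral>\<^sup>+z. g z \<partial>lborel)"
    using pair[OF assms] lborel.nn_integral_fst[OF m[of 0 0]] by simp
  finally show "(\<integral>\<^sup>+z. g (Complex (Re z) (Im z + s * Re z)) \<partial>lborel) = (\<integral>\<^sup>+z. g z \<partial>lborel)" .
qed

text \<open>A rotation by an angle that is not a multiple of \<open>\<pi>\<close> is a product of three shears.\<close>

lemma nn_integral_rotation: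
  fixes g :: "complex \<Rightarrow> ennreal"
  assumes g: "g \<in> borel_measurable borel" and c: "norm c = 1"
  shows "(\<integral>\<^sup>+z. g (c * z) \<partial>lborel) = (\<integral>\<^sup>+z. g z \<partial>lborel)"
proof -
  have main: "(\<integral>\<^sup>+z. g (c * z) \<partial>lborel) = (\<integral>\<^sup>+z. g z \<partial>lborel)"
    if g: "g \<in> borel_measurable borel" and c: "norm c = 1" "Im c \<noteq> 0"
    for c and g :: "complex \<Rightarrow> ennreal"
  proof -
    define s where "s = Im c"
    \<comment> \<open>For c = exp (i t) this is - tan (t / 2); the shears by \<open>a\<close>,
      \<open>s\<close>, \<open>a\<close> compose to the rotation by t.\<close>
    define a where "a = (Re c - 1) / s"
    define X where "X = (\<lambda>z. Complex (Re z + a * Im z) (Im z))"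
    define Y where "Y = (\<lambda>z. Complex (Re z) (Im z + s * Re z))"
    have XY: "X \<in> borel_measurable borel" "Y \<in> borel_measurable borel"
      unfolding X_def Y_def by (intro borel_measurable_continuous_onI continuous_intros)+
    have s: "s \<noteq> 0" "a * s = Re c - 1" using c by (auto simp: s_def a_def)
    have "s * (a * (Re c + 1)) = s * (- s)"
    proof -
      have "(Re c)\<^sup>2 + s\<^sup>2 = 1" using c by (simp add: cmod_def s_def)
      then have "(Re c - 1) * (Re c + 1) = - (s * s)" by (simp add: algebra_simps power2_eq_square)
      then show ?thesis using s by (metis mult.assoc mult.commute mult_minus_right)
    qed
    then have as: "a * (Re c + 1) = - s" using s by (metis mult_cancel_left)
    have "X (Y (X z)) = c * z" for z
    proof -
      have "Re z + a * Im z + a * (Im z + s * (Re z + a * Im z)) = (1 + a * s) * Re z + (a * (a * s + 1) + a) * Im z"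
        by (simp add: algebra_simps)
      also have "\<dots> = Re c * Re z - s * Im z"
        using as by (simp add: s(2) algebra_simps)
      finally have 1: "Re z + a * Im z + a * (Im z + s * (Re z + a * Im z)) = Re c * Re z - s * Im z" .
      have "Im z + s * (Re z + a * Im z) = (1 + a * s) * Im z + s * Re z" by (simp add: algebra_simps)
      then have 2: "Im z + s * (Re z + a * Im z) = Re c * Im z + s * Re z" by (simp add: s(2))
      show ?thesis using 1 2 by (simp add: X_def Y_def complex_eq_iff s_def)
    qed
    then have "(\<integral>\<^sup>+z. g (c * z) \<partial>lborel) = (\<integral>\<^sup>+z. g (X (Y (X z))) \<partial>lborel)" by simp
    also have "\<dots> = (\<integral>\<^sup>+z. g (X (Y z)) \<partial>lborel)"
      using nn_integral_shear_Re[OF measurable_compose[OF XY(2) measurable_compose[OF XY(1) g]], of a]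
      by (simp add: X_def)
    also have "\<dots> = (\<integral>\<^sup>+z. g (X z) \<partial>lborel)"
      using nn_integral_shear_Im[OF measurable_compose[OF XY(1) g], of s] by (simp add: Y_def)
    also have "\<dots> = (\<integral>\<^sup>+z. g z \<partial>lborel)"
      using nn_integral_shear_Re[OF g, of a] by (simp add: X_def)
    finally show ?thesis .
  qed
  \<comment> \<open>Rotating twice by a square root of \<open>c\<close> covers c = -1, where
    \<open>Im c\<close> = 0; \<open>w\<close> itself is real only if c = 1.\<close>
  define w where "w = csqrt c"
  have w: "w * w = c" by (metis w_def power2_csqrt power2_eq_square)
  have wn: "norm w = 1" using c by (simp add: w_def)
  show ?thesis
  proof (cases "Im w = 0")
    case True
    then have "Re c \<ge> 0" "Im c = 0" by (simp_all flip: w)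
    then have "c = 1" using c by (simp add: complex_eq_iff cmod_def)
    then show ?thesis by simp
  next
    case False
    have "(\<lambda>z. w * z) \<in> borel_measurable borel"
      by (intro borel_measurable_continuous_onI continuous_intros)
    then have "(\<integral>\<^sup>+z. g (w * (w * z)) \<partial>lborel) = (\<integral>\<^sup>+z. g (w * z) \<partial>lborel)"
      using main[OF measurable_compose[OF _ g] wn False, of "\<lambda>z. w * z"] by simp
    then show ?thesis using main[OF g wn False] by (simp add: mult.assoc flip: w)
  qed
qed

text \<open>Averages over circles become an integral over the disc without polar coordinates: for
  every \<open>y\<close> the average over the circle of radius |y| bounds the value at the centre.
  Integrating over \<open>y\<close> and exchanging the integrals leaves a rotated integral for every
  angle, equal to the unrotated one.\<close>

lemma holomorphic_norm_mean_value_le: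
  assumes v: "v holomorphic_on ball x0 r" and r: "r > 0"
  shows "ennreal (norm (v x0) * (pi * r\<^sup>2)) \<le> (\<integral>\<^sup>+x. ennreal (norm (v x)) * indicator (ball x0 r) x \<partial>lborel)"
proof -
  \<comment> \<open>\<open>v\<close> is recentred at 0 and extended by 0, which makes it measurable
    on the plane and its domain invariant under rotations.\<close>
  define w where "w = (\<lambda>y. indicator (ball 0 r) y *\<^sub>R v (x0 + y))"
  have cont: "continuous_on (ball 0 r) (\<lambda>y. v (x0 + y))"
    by (rule continuous_on_compose2[OF holomorphic_on_imp_continuous_on[OF v]])
      (auto intro!: continuous_intros simp: dist_norm)
  have w [measurable]: "w \<in> borel_measurable borel"
    unfolding w_def using cont by (intro borel_measurable_continuous_on_indicator) auto
  define e where "e = (\<lambda>t::real. exp (2 * of_real pi * \<i> * of_real t))"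
  have e [measurable]: "e \<in> borel_measurable borel"
    unfolding e_def by (intro borel_measurable_continuous_onI continuous_intros)
  have ne: "norm (e t) = 1" for t by (simp add: e_def)
  have circ: "ennreal (norm (v x0)) \<le> (\<integral>\<^sup>+t. indicator {0..1} t * ennreal (norm (w (e t * y))) \<partial>lborel)"
    if y: "y \<in> ball 0 r" for y
  proof -
    define p where "p = (\<lambda>x. v (x0 + y * x))"
    have yr: "norm (y * x) < r" if "norm x \<le> 1" for x
      using mult_left_mono[OF that norm_ge_zero[of y]] y by (simp add: norm_mult)
    have "p holomorphic_on cball 0 1"
      unfolding p_def by (rule holomorphic_on_compose_gen[OF _ v, unfolded o_def])
        (use yr in \<open>auto intro!: holomorphic_intros simp: dist_norm\<close>)
    then have "((\<lambda>u. p u / (u - 0)) has_contour_integral (2 * of_real pi * \<i> * p 0)) (circlepath 0 1)"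
      by (rule Cauchy_integral_circlepath_simple) auto
    then have "((\<lambda>t. p (e t) / e t * (2 * of_real pi * \<i> * e t)) has_integral (2 * of_real pi * \<i> * p 0)) {0..1}"
      unfolding has_contour_integral_def
      by (rule has_integral_eq[rotated]) (simp add: vector_derivative_circlepath01, simp add: circlepath e_def)
    then have J: "((\<lambda>t. (2 * of_real pi * \<i>) * p (e t)) has_integral (2 * of_real pi * \<i>) * p 0) {0..1}"
      by (rule has_integral_eq[rotated]) (use ne in \<open>simp add: e_def\<close>)
    have k: "1 / (2 * of_real pi * \<i>) * (2 * of_real pi * \<i> * x) = x" for x :: complex by simp
    have I: "((\<lambda>t. p (e t)) has_integral p 0) {0..1}"
      using has_integral_mult_right[OF J, of "1 / (2 * of_real pi * \<i>)"] by (simp only: k)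
    have pc: "continuous_on {0..1} (\<lambda>t. p (e t))"
      unfolding p_def using yr ne
      by (intro continuous_on_compose2[OF holomorphic_on_imp_continuous_on[OF v]])
        (auto intro!: continuous_intros simp: dist_norm e_def)
    then have N: "((\<lambda>t. norm (p (e t))) has_integral integral {0..1} (\<lambda>t. norm (p (e t)))) {0..1}"
      by (intro integrable_integral integrable_continuous_interval continuous_intros)
    have "norm (v x0) = norm (integral {0..1} (\<lambda>t. p (e t)))"
      using integral_unique[OF I] by (simp add: p_def)
    also have "\<dots> \<le> integral {0..1} (\<lambda>t. norm (p (e t)))"
      using I N by (intro integral_norm_bound_integral) (auto simp: has_integral_iff)
    finally have "ennreal (norm (v x0)) \<le> ennreal (integral {0..1} (\<lambda>t. norm (p (e t))))"
      by (rule ennreal_leI)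
    also have "\<dots> = (\<integral>\<^sup>+t. indicator {0..1} t * norm (p (e t)) \<partial>lborel)"
      by (rule nn_integral_has_integral_lebesgue[OF _ N, symmetric]) auto
    also have "\<dots> = (\<integral>\<^sup>+t. indicator {0..1} t * ennreal (norm (w (e t * y))) \<partial>lborel)"
    proof (intro nn_integral_cong)
      fix t :: real
      have "w (e t * y) = p (e t)" using yr[of "e t"] ne[of t] by (simp add: w_def p_def mult.commute)
      then show "ennreal (indicator {0..1} t * norm (p (e t))) = indicator {0..1} t * ennreal (norm (w (e t * y)))"
        by (simp split: split_indicator)
    qed
    finally show ?thesis .
  qed
  have "ennreal (norm (v x0) * (pi * r\<^sup>2)) = ennreal (norm (v x0)) * emeasure lborel (ball (0::complex) r)"
    using r by (simp add: emeasure_ball ennreal_mult unit_ball_vol_2 power2_eq_square)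
  also have "\<dots> = (\<integral>\<^sup>+y. ennreal (norm (v x0)) * indicator (ball (0::complex) r) y \<partial>lborel)"
    by (simp add: nn_integral_cmult_indicator)
  also have "\<dots> \<le> (\<integral>\<^sup>+y. (\<integral>\<^sup>+t. indicator {0..1} t * ennreal (norm (w (e t * y))) \<partial>lborel) \<partial>lborel)"
    using circ by (intro nn_integral_mono) (auto split: split_indicator)
  also have "\<dots> = (\<integral>\<^sup>+t. (\<integral>\<^sup>+y. indicator {0..1} t * ennreal (norm (w (e t * y))) \<partial>lborel) \<partial>lborel)"
  proof (rule lborel_pair.Fubini')
    have "(\<lambda>p. e (fst p) * snd p) \<in> borel_measurable (borel \<Otimes>\<^sub>M borel)" by measurable
    then have "(\<lambda>p. w (e (fst p) * snd p)) \<in> borel_measurable (borel \<Otimes>\<^sub>M borel)"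
      by (rule measurable_compose[OF _ w])
    then show "(\<lambda>(t, y). indicator {0..1} t * ennreal (norm (w (e t * y)))) \<in> borel_measurable (lborel \<Otimes>\<^sub>M lborel)"
      unfolding case_prod_unfold by measurable
  qed
  also have "\<dots> = (\<integral>\<^sup>+t. indicator {0..1::real} t * (\<integral>\<^sup>+y. ennreal (norm (w y)) \<partial>lborel) \<partial>lborel)"
  proof (rule nn_integral_cong)
    fix t :: real
    have "(\<lambda>y. ennreal (norm (w (e t * y)))) \<in> borel_measurable borel"
    proof -
      have "(\<lambda>y. e t * y) \<in> borel_measurable borel"
        by (intro borel_measurable_continuous_onI continuous_intros)
      then show ?thesis by measurable
    qed
    then have "(\<integral>\<^sup>+y. indicator {0..1} t * ennreal (norm (w (e t * y))) \<partial>lborel)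
        = indicator {0..1} t * (\<integral>\<^sup>+y. ennreal (norm (w (e t * y))) \<partial>lborel)"
      by (intro nn_integral_cmult) auto
    also have "(\<integral>\<^sup>+y. ennreal (norm (w (e t * y))) \<partial>lborel) = (\<integral>\<^sup>+y. ennreal (norm (w y)) \<partial>lborel)"
      by (rule nn_integral_rotation[OF _ ne]) measurable
    finally show "(\<integral>\<^sup>+y. indicator {0..1} t * ennreal (norm (w (e t * y))) \<partial>lborel)
        = indicator {0..1} t * (\<integral>\<^sup>+y. ennreal (norm (w y)) \<partial>lborel)" .
  qed
  also have "\<dots> = (\<integral>\<^sup>+y. ennreal (norm (w y)) \<partial>lborel)"
    by (subst nn_integral_multc) auto
  also have "\<dots> = (\<integral>\<^sup>+y. ennreal (norm (w (- x0 + y))) \<partial>lborel)"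
    by (subst lborel_distr_plus[of "- x0", symmetric], subst nn_integral_distr) auto
  also have "\<dots> = (\<integral>\<^sup>+x. ennreal (norm (v x)) * indicator (ball x0 r) x \<partial>lborel)"
    by (intro nn_integral_cong) (auto simp: w_def dist_norm norm_minus_commute split: split_indicator)
  finally show ?thesis .
qed

text \<open>The weight is the one that 1 / |D| has at a simple zero of \<open>D\<close>. The mean
  value inequality for u^2 turns the integral bound into a pointwise one that excludes a
  pole.\<close>

lemma removable_singularity_weighted_L2:
  assumes u: "u holomorphic_on ball z r - {z}" and r: "r > 0"
    and fin: "(\<integral>\<^sup>+x. ennreal ((norm (u x))\<^sup>2 / norm (x - z)) * indicator (ball z r - {z}) x \<partial>lborel) < \<infinity>"
  shows "\<exists>g. g holomorphic_on ball z r \<and> (\<forall>x\<in>ball z r - {z}. g x = u x)"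
proof -
  define J where "J = (\<integral>\<^sup>+x. ennreal ((norm (u x))\<^sup>2 / norm (x - z)) * indicator (ball z r - {z}) x \<partial>lborel)"
  obtain K where K: "K \<ge> 0" "J = ennreal K"
    using fin unfolding J_def[symmetric] by (cases J) auto
  \<comment> \<open>With d = |x - z| the disc of radius d / 2 around \<open>x\<close> gives |u|^2 pi
    (d / 2)^2 \<le> (3 / 2) d K, since |y - z| \<le> (3 / 2) d on it; solving for (d |u|)^2 gives
    the constant 6 K / pi.\<close>
  have bound: "norm ((x - z) * u x) \<le> sqrt (6 * K / pi * norm (x - z))" if x: "x \<noteq> z" "norm (x - z) < r / 2" for x
  proof -
    define d where "d = norm (x - z)"
    have d: "d > 0" "d < r / 2" using x by (auto simp: d_def)
    have sub: "ball x (d / 2) \<subseteq> ball z r - {z}" and near: "\<And>y. y \<in> ball x (d / 2) \<Longrightarrow> norm (y - z) \<le> 3 / 2 * d"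
    proof -
      have *: "norm (y - z) \<le> 3 / 2 * d \<and> y \<noteq> z" if "y \<in> ball x (d / 2)" for y
      proof -
        have "norm (y - x) < d / 2" using that by (simp add: dist_norm norm_minus_commute)
        moreover have "norm (y - z) \<le> norm (y - x) + d" "d \<le> norm (y - z) + norm (y - x)"
          using norm_triangle_ineq[of "y - x" "x - z"] norm_triangle_ineq[of "y - z" "x - y"]
          by (simp_all add: d_def norm_minus_commute)
        ultimately show ?thesis using d by auto
      qed
      then show "\<And>y. y \<in> ball x (d / 2) \<Longrightarrow> norm (y - z) \<le> 3 / 2 * d" by blast
      show "ball x (d / 2) \<subseteq> ball z r - {z}"
      proof
        fix y assume "y \<in> ball x (d / 2)"
        then show "y \<in> ball z r - {z}" using *[of y] d by (simp add: dist_norm norm_minus_commute)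
      qed
    qed
    have "(\<lambda>x. (u x)\<^sup>2) holomorphic_on ball x (d / 2)"
      by (intro holomorphic_intros holomorphic_on_subset[OF u] sub)
    then have "ennreal (norm ((u x)\<^sup>2) * (pi * (d / 2)\<^sup>2))
        \<le> (\<integral>\<^sup>+y. ennreal (norm ((u y)\<^sup>2)) * indicator (ball x (d / 2)) y \<partial>lborel)"
      using d by (intro holomorphic_norm_mean_value_le) auto
    also have "\<dots> \<le> (\<integral>\<^sup>+y. ennreal (3 / 2 * d) * (ennreal ((norm (u y))\<^sup>2 / norm (y - z)) * indicator (ball z r - {z}) y) \<partial>lborel)"
    proof (rule nn_integral_mono)
      fix y
      show "ennreal (norm ((u y)\<^sup>2)) * indicator (ball x (d / 2)) y
        \<le> ennreal (3 / 2 * d) * (ennreal ((norm (u y))\<^sup>2 / norm (y - z)) * indicator (ball z r - {z}) y)"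
      proof (cases "y \<in> ball x (d / 2)")
        case True
        then have y: "y \<in> ball z r - {z}" "norm (y - z) \<le> 3 / 2 * d" using sub near by auto
        then have "(norm (u y))\<^sup>2 * norm (y - z) \<le> (norm (u y))\<^sup>2 * (3 / 2 * d)"
          by (intro mult_left_mono) auto
        then have "(norm (u y))\<^sup>2 \<le> 3 / 2 * d * ((norm (u y))\<^sup>2 / norm (y - z))"
          using y by (simp add: field_simps)
        then have "ennreal ((norm (u y))\<^sup>2) \<le> ennreal (3 / 2 * d) * ennreal ((norm (u y))\<^sup>2 / norm (y - z))"
          using d by (subst ennreal_mult[symmetric]) (auto intro: ennreal_leI)
        then show ?thesis using True y by (simp add: norm_power)
      qed simp
    qed
    also have "\<dots> = ennreal (3 / 2 * d) * J"
      unfolding J_def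
    proof (rule nn_integral_cmult)
      have "(\<lambda>x. indicator (ball z r - {z}) x *\<^sub>R ((norm (u x))\<^sup>2 / norm (x - z))) \<in> borel_measurable borel"
        by (intro borel_measurable_continuous_on_indicator continuous_intros holomorphic_on_imp_continuous_on[OF u])
          auto
      then have "(\<lambda>x. ennreal (indicator (ball z r - {z}) x *\<^sub>R ((norm (u x))\<^sup>2 / norm (x - z)))) \<in> borel_measurable lborel"
        by simp
      then show "(\<lambda>x. ennreal ((norm (u x))\<^sup>2 / norm (x - z)) * indicator (ball z r - {z}) x) \<in> borel_measurable lborel"
        by (rule measurable_cong[THEN iffD1, rotated]) (auto split: split_indicator)
    qed
    also have "\<dots> = ennreal (3 / 2 * d * K)" using K d by (subst ennreal_mult) auto
    finally have "norm ((u x)\<^sup>2) * (pi * (d / 2)\<^sup>2) \<le> 3 / 2 * d * K"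
      using K d by (subst (asm) ennreal_le_iff) auto
    then have "(norm ((x - z) * u x))\<^sup>2 \<le> 6 * K / pi * d"
      unfolding norm_mult norm_power power_mult_distrib d_def[symmetric]
      using d by (simp add: field_simps power2_eq_square)
    then show ?thesis unfolding d_def by (rule real_le_rsqrt)
  qed
  have "((\<lambda>x. (x - z) * u x) \<longlongrightarrow> 0) (at z)"
  proof (rule Lim_null_comparison)
    show "\<forall>\<^sub>F x in at z. norm ((x - z) * u x) \<le> sqrt (6 * K / pi * norm (x - z))"
      unfolding eventually_at using bound r by (intro exI[of _ "r / 2"]) (auto simp: dist_norm)
    have "isCont (\<lambda>x. sqrt (6 * K / pi * norm (x - z))) z" by (intro continuous_intros)
    then show "((\<lambda>x. sqrt (6 * K / pi * norm (x - z))) \<longlongrightarrow> 0) (at z)"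
      by (simp add: isCont_def)
  qed
  then show ?thesis
    using holomorphic_on_extend_lim[OF u] r by simp
qed

text \<open>Dyadic discs replace polar coordinates: on the ring r / 2^(n+1) \<le> |x - c| < r / 2^n
  the integrand is at most \<open>a n\<close>, and the term number n integrates to 2 pi r /
  2^n.\<close>

lemma nn_integral_inverse_norm_finite:
  fixes c :: complex assumes r: "r > 0"
  shows "(\<integral>\<^sup>+x. ennreal (1 / norm (x - c)) * indicator (ball c r) x \<partial>lborel) < \<infinity>"
proof -
  define a where "a = (\<lambda>n. 2 ^ Suc n / r :: real)"
  define B where "B = (\<lambda>n. ball c (r / 2 ^ n))"
  have "(\<integral>\<^sup>+x. ennreal (1 / norm (x - c)) * indicator (ball c r) x \<partial>lborel)
      \<le> (\<integral>\<^sup>+x. (\<Sum>n. ennreal (a n) * indicator (B n) x) \<partial>lborel)"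
  proof (rule nn_integral_mono)
    fix x
    show "ennreal (1 / norm (x - c)) * indicator (ball c r) x \<le> (\<Sum>n. ennreal (a n) * indicator (B n) x)"
    \<comment> \<open>At the centre the integrand is 0, as 1 / 0 = 0.\<close>
    proof (cases "x \<in> ball c r \<and> x \<noteq> c")
      case True
      define d where "d = norm (x - c)"
      have d: "d > 0" "d < r" using True by (auto simp: d_def dist_norm norm_minus_commute)
      have "\<exists>n. r / 2 ^ n \<le> d"
      proof -
        obtain n where "(1 / 2) ^ n < d / r" using d r real_arch_pow_inv[of "d / r" "1 / 2"] by auto
        then show ?thesis using r by (intro exI[of _ n]) (simp add: field_simps power_divide)
      qed
      then have ex: "r / 2 ^ (LEAST n. r / 2 ^ n \<le> d) \<le> d" by (rule LeastI_ex)
      obtain m where m: "(LEAST n. r / 2 ^ n \<le> d) = Suc m"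
        using ex d by (cases "LEAST n. r / 2 ^ n \<le> d") auto
      have "d < r / 2 ^ m" using not_less_Least[of m "\<lambda>n. r / 2 ^ n \<le> d"] m by auto
      then have "x \<in> B m" by (simp add: B_def d_def dist_norm norm_minus_commute)
      moreover have "1 / d \<le> a m" using ex d r unfolding m a_def by (simp add: field_simps)
      ultimately have "ennreal (1 / norm (x - c)) * indicator (ball c r) x \<le> ennreal (a m) * indicator (B m) x"
        using True by (simp add: d_def ennreal_leI)
      also have "\<dots> \<le> (\<Sum>n. ennreal (a n) * indicator (B n) x)"
        using sum_le_suminf[of "\<lambda>n. ennreal (a n) * indicator (B n) x" "{m}"]
        by (simp only: sum.insert finite.emptyI empty_iff sum.empty add_0_right not_False_eq_True) auto
      finally show ?thesis .
    qed auto
  qed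
  also have "\<dots> = (\<Sum>n. (\<integral>\<^sup>+x. ennreal (a n) * indicator (B n) x \<partial>lborel))"
    by (intro nn_integral_suminf borel_measurable_times_ennreal borel_measurable_indicator)
      (auto simp: B_def)
  also have "\<dots> = (\<Sum>n. ennreal (2 * pi * r * (1 / 2) ^ n))"
  proof (intro suminf_cong)
    fix n
    have "(\<integral>\<^sup>+x. ennreal (a n) * indicator (B n) x \<partial>lborel) = ennreal (a n) * emeasure lborel (B n)"
      by (intro nn_integral_cmult_indicator) (auto simp: B_def)
    also have "emeasure lborel (B n) = ennreal (pi * (r / 2 ^ n)\<^sup>2)"
      using r by (simp add: B_def emeasure_ball unit_ball_vol_2 power2_eq_square)
    also have "ennreal (a n) * \<dots> = ennreal (a n * (pi * (r / 2 ^ n)\<^sup>2))"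
      using r by (intro ennreal_mult[symmetric]) (auto simp: a_def)
    also have "a n * (pi * (r / 2 ^ n)\<^sup>2) = 2 * pi * r * (1 / 2) ^ n"
      using r by (simp add: a_def power2_eq_square power_divide field_simps)
    finally show "(\<integral>\<^sup>+x. ennreal (a n) * indicator (B n) x \<partial>lborel) = ennreal (2 * pi * r * (1 / 2) ^ n)" .
  qed
  also have "\<dots> < \<infinity>"
  proof -
    have "summable (\<lambda>n. 2 * pi * r * (1 / 2) ^ n)"
      by (intro summable_mult summable_geometric) auto
    then have "(\<Sum>n. ennreal (2 * pi * r * (1 / 2) ^ n)) \<noteq> top"
      using r by (intro ennreal_suminf_neq_top) auto
    then show ?thesis by (simp add: less_top)
  qed
  finally show ?thesis .
qed

subsection \<open>Linear systems\<close>

text \<open>Injectivity gives surjectivity for a square matrix, by Gaussian elimination. The index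
  sets are arbitrary because the application numbers rows from 1 and columns from 0.\<close>

lemma square_system_solvable:
  fixes A :: "'i \<Rightarrow> 'j \<Rightarrow> real"
  assumes "finite J" "finite I" "card I = card J"
    and "\<And>x. (\<forall>i\<in>I. (\<Sum>j\<in>J. A i j * x j) = 0) \<Longrightarrow> (\<forall>j\<in>J. x j = 0)"
  shows "\<exists>x. \<forall>i\<in>I. (\<Sum>j\<in>J. A i j * x j) = b i"
  using assms
proof (induction J arbitrary: I A b rule: finite_induct)
  case empty
  then show ?case by simp
next
  case (insert q J)
  have "\<exists>p\<in>I. A p q \<noteq> 0"
  proof (rule ccontr)
    assume "\<not> ?thesis"
    then have "\<forall>i\<in>I. (\<Sum>j\<in>insert q J. A i j * (if j = q then 1 else 0)) = 0"
      using insert.hyps by (simp add: if_distrib cong: if_cong)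
    then show False using insert.prems(3)[of "\<lambda>j. if j = q then 1 else 0"] by auto
  qed
  then obtain p where p: "p \<in> I" "A p q \<noteq> 0" by blast
  define A' where "A' = (\<lambda>i j. A i j - A i q / A p q * A p j)"
  \<comment> \<open>\<open>y c x\<close> extends a vector on \<open>J\<close> by the value at
    \<open>q\<close> that solves row \<open>p\<close> with right-hand side \<open>c\<close>.\<close>
  define y where "y = (\<lambda>c x. x(q := (c - (\<Sum>j\<in>J. A p j * x j)) / A p q))"
  have yJ: "y c x j = x j" if "j \<in> J" for c x j using that insert.hyps by (auto simp: y_def)
  have y: "(\<Sum>j\<in>insert q J. A i j * y c x j) = (\<Sum>j\<in>J. A' i j * x j) + A i q / A p q * c" for i c x
  proof -
    have "(\<Sum>j\<in>insert q J. A i j * y c x j) = A i q * y c x q + (\<Sum>j\<in>J. A i j * x j)"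
      using insert.hyps yJ by (simp cong: sum.cong)
    also have "\<dots> = (\<Sum>j\<in>J. A i j * x j) - A i q / A p q * (\<Sum>j\<in>J. A p j * x j) + A i q / A p q * c"
      using p by (simp add: y_def field_simps)
    also have "(\<Sum>j\<in>J. A i j * x j) - A i q / A p q * (\<Sum>j\<in>J. A p j * x j) = (\<Sum>j\<in>J. A' i j * x j)"
      by (simp add: A'_def sum_distrib_left sum_subtractf algebra_simps)
    finally show ?thesis .
  qed
  have A'p: "A' p j = 0" for j using p by (simp add: A'_def)
  have "\<exists>x. \<forall>i\<in>I - {p}. (\<Sum>j\<in>J. A' i j * x j) = b i - A i q / A p q * b p"
  proof (rule insert.IH)
    show "card (I - {p}) = card J" "finite (I - {p})" using insert.hyps insert.prems p by auto
    fix x assume x: "\<forall>i\<in>I - {p}. (\<Sum>j\<in>J. A' i j * x j) = 0"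
    have "\<forall>i\<in>I. (\<Sum>j\<in>insert q J. A i j * y 0 x j) = 0"
      using x A'p unfolding y by (metis (no_types, lifting) Diff_iff add.right_neutral empty_iff insert_iff mult_zero_left mult_zero_right sum.neutral)
    then show "\<forall>j\<in>J. x j = 0" using insert.prems(3)[of "y 0 x"] yJ by auto
  qed
  then obtain x where x: "\<And>i. i \<in> I - {p} \<Longrightarrow> (\<Sum>j\<in>J. A' i j * x j) = b i - A i q / A p q * b p" by blast
  have "(\<Sum>j\<in>insert q J. A i j * y (b p) x j) = b i" if "i \<in> I" for i
    unfolding y using x[of i] that p A'p by (cases "i = p") auto
  then show ?case by blast
qed

text \<open>Modulo 2 the matrix is the identity, so its determinant is odd. The proof eliminates
  without fractions, because such a step preserves the parity pattern.\<close>

lemma odd_diagonal_system_trivial: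
  fixes x :: "'a \<Rightarrow> 'b :: field_char_0"
  assumes "finite I" "\<And>i. i \<in> I \<Longrightarrow> odd (B i i)" "\<And>i j. i \<in> I \<Longrightarrow> j \<in> I \<Longrightarrow> i \<noteq> j \<Longrightarrow> even (B i j)"
    and "\<And>i. i \<in> I \<Longrightarrow> (\<Sum>j\<in>I. of_int (B i j) * x j) = 0"
  shows "\<forall>i\<in>I. x i = 0"
  using assms
proof (induction I arbitrary: B rule: finite_induct)
  case (insert q I)
  define B' where "B' = (\<lambda>i j. B q q * B i j - B i q * B q j)"
  have row: "(\<Sum>j\<in>I. of_int (B i j) * x j) = - of_int (B i q) * x q" if "i \<in> insert q I" for i
  proof -
    have "of_int (B i q) * x q + (\<Sum>j\<in>I. of_int (B i j) * x j) = 0"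
      using insert.prems(3)[OF that] insert.hyps by simp
    then show ?thesis by (simp add: add_eq_0_iff)
  qed
  have "\<forall>i\<in>I. x i = 0"
  proof (rule insert.IH[of B'])
    show "odd (B' i i)" if "i \<in> I" for i
    proof -
      have "i \<noteq> q" using that insert.hyps by auto
      then show ?thesis using that insert.prems(1)[of i] insert.prems(1)[of q] insert.prems(2)[of i q]
        by (simp add: B'_def)
    qed
    show "even (B' i j)" if "i \<in> I" "j \<in> I" "i \<noteq> j" for i j
    proof -
      have "i \<noteq> q" using that insert.hyps by auto
      then show ?thesis using that insert.prems(2)[of i j] insert.prems(2)[of i q] by (simp add: B'_def)
    qed
    fix i assume i: "i \<in> I"
    have "(\<Sum>j\<in>I. of_int (B' i j) * x j)
        = of_int (B q q) * (\<Sum>j\<in>I. of_int (B i j) * x j) - of_int (B i q) * (\<Sum>j\<in>I. of_int (B q j) * x j)"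
      by (simp add: B'_def sum_distrib_left sum_subtractf algebra_simps)
    also have "\<dots> = 0" using row[of i] row[of q] i by simp
    finally show "(\<Sum>j\<in>I. of_int (B' i j) * x j) = 0" .
  qed
  moreover from this have "of_int (B q q) * x q = 0" using row[of q] by simp
  then have "x q = 0" using insert.prems(1)[of q] by auto
  ultimately show ?case by simp
qed simp

subsection \<open>Primitives on the two-sheeted cover\<close>

text \<open>Two square roots of one function differ by a sign, and a common nonzero limit fixes the
  sign nearby, since f + g tends to 2 l. This is how trivializations are compared.\<close>

lemma eventually_eq_of_power2_eq:
  fixes f g :: "'a \<Rightarrow> 'b :: real_normed_field"
  assumes "(f \<longlongrightarrow> l) F" "(g \<longlongrightarrow> l) F" "l \<noteq> 0" "\<forall>\<^sub>F x in F. (f x)\<^sup>2 = (g x)\<^sup>2"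
  shows "\<forall>\<^sub>F x in F. f x = g x"
proof -
  have "((\<lambda>x. f x + g x) \<longlongrightarrow> l + l) F" by (intro tendsto_add assms)
  then have "\<forall>\<^sub>F x in F. f x + g x \<noteq> 0"
    by (rule tendsto_imp_eventually_ne) (use assms(3) in \<open>simp flip: mult_2\<close>)
  with assms(4) show ?thesis
    by eventually_elim (metis add.right_inverse power2_eq_iff)
qed

lemma holomorphic_sqrt_on_starlike:
  assumes S: "open S" "starlike S" and f: "f holomorphic_on S" "\<And>x. x \<in> S \<Longrightarrow> f x \<noteq> 0"
  shows "\<exists>g. g holomorphic_on S \<and> (\<forall>x\<in>S. (g x)\<^sup>2 = f x)"
proof -
  have "connected S" "simply_connected S"
    using S starlike_imp_connected starlike_imp_simply_connected by auto
  then show ?thesis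
    using simply_connected_eq_holomorphic_sqrt[OF S(1)] f by metis
qed

lemma has_root_integral_unique:
  "has_root_integral u g s I \<Longrightarrow> has_root_integral u g s J \<Longrightarrow> I = J"
  unfolding has_root_integral_def by (rule has_integral_unique)

lemma has_root_integral_linear_combination:
  assumes "has_root_integral u g s I" "\<And>m. m \<in> M \<Longrightarrow> has_root_integral (b m) g s (J m)" "finite M"
  shows "has_root_integral (\<lambda>x. u x + (\<Sum>m\<in>M. of_real (v m) * b m x)) g s (I + (\<Sum>m\<in>M. of_real (v m) * J m))"
proof -
  define d where "d = (\<lambda>t. vector_derivative g (at t within {0..1}))"
  have "((\<lambda>t. u (g t) / s t * d t + (\<Sum>m\<in>M. of_real (v m) * (b m (g t) / s t * d t))) has_integral
      (I + (\<Sum>m\<in>M. of_real (v m) * J m))) {0..1}"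
    using assms unfolding has_root_integral_def d_def
    by (intro has_integral_add has_integral_sum has_integral_mult_right) auto
  moreover have "u (g t) / s t * d t + (\<Sum>m\<in>M. of_real (v m) * (b m (g t) / s t * d t))
      = (u (g t) + (\<Sum>m\<in>M. of_real (v m) * b m (g t))) / s t * d t" for t
    by (simp add: add_divide_distrib distrib_right sum_divide_distrib sum_distrib_right mult.assoc)
  ultimately show ?thesis unfolding has_root_integral_def d_def by simp
qed

locale branch_data =
  fixes z :: "nat \<Rightarrow> complex" and k :: nat
  assumes k: "k \<ge> 1" and inj: "inj_on z {1..2*k}"
begin

abbreviation "D \<equiv> branch_poly z k"
abbreviation "K \<equiv> branch_points z k"

definition cover :: "complex set \<Rightarrow> (complex \<times> complex) set" where
  "cover N = {(x, w). x \<in> N \<and> w\<^sup>2 = D x}"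

text \<open>\<open>cover N\<close> contains the points \<open>(z i, 0)\<close>, so \<open>G\<close> is continuous at the branch points in \<open>N\<close>.\<close>

definition is_primitive :: "(complex \<Rightarrow> complex) \<Rightarrow> complex set \<Rightarrow> (complex \<times> complex \<Rightarrow> complex) \<Rightarrow> bool" where
  "is_primitive u N G \<longleftrightarrow> open N \<and> continuous_on (cover N) G \<and>
     (\<forall>U s x. open U \<longrightarrow> U \<subseteq> N \<longrightarrow> trivialization z k U s \<longrightarrow> x \<in> U \<longrightarrow>
        ((\<lambda>y. G (y, s y)) has_field_derivative u x / s x) (at x))"

lemma is_primitiveD:
  assumes "is_primitive u N G"
  shows "open N" "continuous_on (cover N) G"
    "open U \<Longrightarrow> U \<subseteq> N \<Longrightarrow> trivialization z k U s \<Longrightarrow> x \<in> U \<Longrightarrow>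
        ((\<lambda>y. G (y, s y)) has_field_derivative u x / s x) (at x)"
  using assms unfolding is_primitive_def by blast+

lemma finite_K: "finite K" by (simp add: branch_points_def)

lemma open_Compl_K: "open (- K)" using finite_K by (simp add: finite_imp_closed open_Compl)

lemma z1_in_K: "z 1 \<in> K" using k by (auto simp: branch_points_def)

lemma D_holomorphic [holomorphic_intros]: "f holomorphic_on S \<Longrightarrow> (\<lambda>x. D (f x)) holomorphic_on S"
  unfolding branch_poly_def by (intro holomorphic_intros)

lemma is_primitive_subset:
  assumes "is_primitive u N G" "open N'" "N' \<subseteq> N"
  shows "is_primitive u N' G"
proof -
  have "cover N' \<subseteq> cover N" using assms(3) by (auto simp: cover_def)
  then show ?thesis
    using assms unfolding is_primitive_def by (blast intro: continuous_on_subset)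
qed

lemma is_primitive_diff:
  assumes "is_primitive u N G" "is_primitive u' N G'"
  shows "is_primitive (\<lambda>x. u x - u' x) N (\<lambda>p. G p - G' p)"
  unfolding is_primitive_def
proof (intro conjI allI impI)
  show "open N" "continuous_on (cover N) (\<lambda>p. G p - G' p)"
    using assms by (auto simp: is_primitive_def intro!: continuous_intros)
  fix U s x assume "open U" "U \<subseteq> N" "trivialization z k U s" "x \<in> U"
  from DERIV_diff[OF is_primitiveD(3)[OF assms(1) this] is_primitiveD(3)[OF assms(2) this]]
  show "((\<lambda>y. G (y, s y) - G' (y, s y)) has_field_derivative (u x - u' x) / s x) (at x)"
    by (simp add: diff_divide_distrib)
qed

lemma is_primitive_add_const:
  assumes "is_primitive u N G"
  shows "is_primitive u N (\<lambda>p. G p + c)"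
  unfolding is_primitive_def
proof (intro conjI allI impI)
  show "open N" "continuous_on (cover N) (\<lambda>p. G p + c)"
    using assms by (auto simp: is_primitive_def intro!: continuous_intros)
  fix U s x assume "open U" "U \<subseteq> N" "trivialization z k U s" "x \<in> U"
  from DERIV_add[OF is_primitiveD(3)[OF assms(1) this] DERIV_const[of c]]
  show "((\<lambda>y. G (y, s y) + c) has_field_derivative u x / s x) (at x)" by simp
qed

lemma trivializationD:
  assumes "trivialization z k U s" "x \<in> U"
  shows "x \<notin> K" "s x \<noteq> 0" "(s x)\<^sup>2 = D x" "(x, s x) \<in> root_cover z k"
proof -
  show "x \<notin> K" "(s x)\<^sup>2 = D x" using assms by (auto simp: trivialization_def)
  then show "s x \<noteq> 0" "(x, s x) \<in> root_cover z k"
    by (auto simp: root_cover_def branch_poly_eq_0_iff[symmetric])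
qed

lemma trivialization_subset: "trivialization z k U s \<Longrightarrow> V \<subseteq> U \<Longrightarrow> trivialization z k V s"
  by (auto simp: trivialization_def intro: continuous_on_subset)

lemma trivialization_uminus: "trivialization z k U s \<Longrightarrow> trivialization z k U (\<lambda>x. - s x)"
  by (auto simp: trivialization_def intro!: continuous_intros)

lemma trivialization_isCont:
  "trivialization z k U s \<Longrightarrow> open U \<Longrightarrow> x \<in> U \<Longrightarrow> isCont s x"
  by (auto simp: trivialization_def continuous_on_eq_continuous_at)

lemma exists_trivialization_through:
  assumes "x \<notin> K" "w\<^sup>2 = D x" "open N" "x \<in> N"
  shows "\<exists>U s. open U \<and> x \<in> U \<and> U \<subseteq> N \<and> trivialization z k U s \<and> s x = w"
proof -
  obtain U s where U: "open U" "x \<in> U" "trivialization z k U s"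
    using root_cover_local_trivialization[OF assms(1)] by blast
  have "(s x)\<^sup>2 = w\<^sup>2" using trivializationD(3)[OF U(3,2)] assms(2) by simp
  then have "s x = w \<or> - s x = w" by (auto simp: power2_eq_iff)
  moreover have "trivialization z k (U \<inter> N) s" "trivialization z k (U \<inter> N) (\<lambda>x. - s x)"
    using U(3) by (auto intro: trivialization_subset[OF _ Int_lower1] trivialization_uminus)
  ultimately show ?thesis using U assms by (metis IntI Int_lower2 open_Int)
qed

text \<open>A trivialization is by definition only continuous. It is differentiable because D(y) -
  D(x) = (s(y) - s(x)) (s(y) + s(x)), where the last factor tends to 2 s(x), which is
  nonzero.\<close>

lemma trivialization_has_field_derivative:
  assumes "trivialization z k U s" "open U" "x \<in> U"
  shows "(s has_field_derivative deriv D x / (2 * s x)) (at x)"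
proof -
  have s: "isCont s x" "s x \<noteq> 0" using assms trivialization_isCont trivializationD by blast+
  have "(D has_field_derivative deriv D x) (at x)"
    using D_holomorphic[of "\<lambda>x. x" UNIV] by (intro holomorphic_derivI[of _ UNIV]) auto
  then have D: "((\<lambda>y. (D y - D x) / (y - x)) \<longlongrightarrow> deriv D x) (at x)"
    by (simp add: has_field_derivative_iff)
  have sx: "(s \<longlongrightarrow> s x) (at x)" using s by (simp add: isCont_def)
  have lim: "((\<lambda>y. (D y - D x) / (y - x) / (s y + s x)) \<longlongrightarrow> deriv D x / (s x + s x)) (at x)"
    by (intro tendsto_intros D sx) (use s in \<open>simp flip: mult_2\<close>)
  have "((\<lambda>y. s y + s x) \<longlongrightarrow> s x + s x) (at x)" by (intro tendsto_intros sx)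
  then have "\<forall>\<^sub>F y in at x. s y + s x \<noteq> 0"
    by (rule tendsto_imp_eventually_ne) (use s in \<open>simp flip: mult_2\<close>)
  moreover have "\<forall>\<^sub>F y in at x. y \<in> U"
    using assms eventually_at_topological by blast
  ultimately have "\<forall>\<^sub>F y in at x. (D y - D x) / (y - x) / (s y + s x) = (s y - s x) / (y - x)"
  proof eventually_elim
    case (elim y)
    have "D y - D x = (s y - s x) * (s y + s x)"
      using trivializationD(3)[OF assms(1)] elim assms(3)
      by (simp add: power2_eq_square algebra_simps flip: trivializationD(3)[OF assms(1)])
    then show ?case using elim by simp
  qed
  then have "((\<lambda>y. (s y - s x) / (y - x)) \<longlongrightarrow> deriv D x / (s x + s x)) (at x)"
    by (rule Lim_transform_eventually[OF lim])
  then show ?thesis by (simp add: has_field_derivative_iff flip: mult_2)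
qed

lemma trivialization_holomorphic:
  "trivialization z k U s \<Longrightarrow> open U \<Longrightarrow> s holomorphic_on U"
  using trivialization_has_field_derivative by (auto simp: holomorphic_on_open)

text \<open>On the cover w / r(x) is 1 or -1, so the formula is the odd extension of \<Phi> to the
  second sheet.\<close>

lemma is_primitive_regular:
  assumes U: "open U" "trivialization z k U r"
    and \<Phi>: "\<And>x. x \<in> U \<Longrightarrow> (\<Phi> has_field_derivative u x / r x) (at x)"
  shows "is_primitive u U (\<lambda>(x, w). w / r x * \<Phi> x)"
  unfolding is_primitive_def
proof (intro conjI allI impI)
  have r: "continuous_on U r" using U by (simp add: trivialization_def)
  have "continuous_on U \<Phi>"
    using \<Phi> by (meson DERIV_isCont continuous_at_imp_continuous_on)
  moreover have "continuous_on (cover U) fst" "fst ` cover U \<subseteq> U"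
    by (auto intro!: continuous_intros simp: cover_def)
  ultimately have "continuous_on (cover U) (\<lambda>p. \<Phi> (fst p))" "continuous_on (cover U) (\<lambda>p. r (fst p))"
    using r by (blast intro: continuous_on_compose2)+
  then have "continuous_on (cover U) (\<lambda>p. snd p / r (fst p) * \<Phi> (fst p))"
    by (intro continuous_intros) (use trivializationD(2)[OF U(2)] in \<open>auto simp: cover_def\<close>)
  then show "continuous_on (cover U) (\<lambda>(x, w). w / r x * \<Phi> x)"
    by (simp add: case_prod_unfold)
  fix V s x assume V: "open V" "V \<subseteq> U" "trivialization z k V s" "x \<in> V"
  have nz: "r x \<noteq> 0" "s x \<noteq> 0" using trivializationD(2) U V by blast+
  \<comment> \<open>The sign by which \<open>s\<close> and \<open>r\<close> differ at
    \<open>x\<close>, and hence in a neighbourhood of \<open>x\<close>.\<close>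
  define e where "e = s x / r x"
  have "(s x)\<^sup>2 = (r x)\<^sup>2" using trivializationD(3) U V by (metis subsetD)
  then have e: "e = 1 \<or> e = -1" using nz by (auto simp: e_def power2_eq_iff)
  have "\<forall>\<^sub>F y in nhds x. s y = e * r y"
  proof (rule eventually_eq_of_power2_eq)
    have "isCont s x" "isCont r x" using trivialization_isCont U V by blast+
    then have s: "(s \<longlongrightarrow> s x) (nhds x)" and r: "(r \<longlongrightarrow> r x) (nhds x)"
      by (simp_all only: isCont_def tendsto_at_iff_tendsto_nhds)
    show "(s \<longlongrightarrow> s x) (nhds x)" by (rule s)
    have "((\<lambda>y. e * r y) \<longlongrightarrow> e * r x) (nhds x)" by (intro tendsto_mult_left r)
    then show "((\<lambda>y. e * r y) \<longlongrightarrow> s x) (nhds x)" using nz by (simp add: e_def)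
    show "\<forall>\<^sub>F y in nhds x. (s y)\<^sup>2 = (e * r y)\<^sup>2"
      using eventually_nhds_in_open[OF V(1,4)]
    proof eventually_elim
      case (elim y)
      then have "(s y)\<^sup>2 = (r y)\<^sup>2" using trivializationD(3) U V by (metis subsetD)
      then show ?case using e by auto
    qed
  qed fact
  moreover have "\<forall>\<^sub>F y in nhds x. y \<in> U"
    using V(2,4) by (intro eventually_nhds_in_open[OF U(1)]) blast
  ultimately have ev: "\<forall>\<^sub>F y in nhds x. e * \<Phi> y = s y / r y * \<Phi> y"
    by eventually_elim (use trivializationD(2)[OF U(2)] in auto)
  have "((\<lambda>y. e * \<Phi> y) has_field_derivative e * (u x / r x)) (at x)"
    using \<Phi> V by (intro DERIV_cmult) auto
  then have "((\<lambda>y. s y / r y * \<Phi> y) has_field_derivative e * (u x / r x)) (at x)"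
    by (rule DERIV_cong_ev[OF refl ev refl, THEN iffD1])
  moreover have "e * (u x / r x) = u x / s x"
  proof -
    have "e * e = 1" using e by auto
    moreover have "s x = e * r x" using nz by (simp add: e_def)
    ultimately show ?thesis using nz e by auto
  qed
  ultimately show "((\<lambda>y. case (y, s y) of (x, w) \<Rightarrow> w / r x * \<Phi> x) has_field_derivative u x / s x) (at x)"
    by simp
qed fact

text \<open>Near a branch point \<open>z i\<close> the local coordinate of the cover is
  \<open>\<mu> = \<surd>(x - z i)\<close>, in which \<open>u / \<surd>D\<close> is the even holomorphic form \<open>v d\<mu>\<close>; its odd
  primitive is \<open>H\<close>.\<close>

lemma is_primitive_branch_point:
  assumes i: "i \<in> {1..2*k}" and N: "open N" "convex N" "N \<inter> K = {z i}" and u: "u holomorphic_on UNIV"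
  shows "\<exists>G. is_primitive u N G \<and> (\<forall>x w. G (x, - w) = - G (x, w)) \<and> G (z i, 0) = 0"
proof -
  define q where "q = (\<lambda>x. \<Prod>j\<in>{1..2*k} - {i}. x - z j)"
  have D: "D x = (x - z i) * q x" for x
    unfolding branch_poly_def q_def using i by (simp add: prod.remove)
  have zN: "z i \<in> N" using N by auto
  have starN: "starlike N" using N zN convex_imp_starlike by blast
  have "q x \<noteq> 0" if "x \<in> N" for x
  proof
    assume "q x = 0"
    then have "\<exists>j\<in>{1..2*k} - {i}. x = z j"
      unfolding q_def by (subst (asm) prod_zero_iff) simp_all
    then obtain j where j: "j \<in> {1..2*k}" "j \<noteq> i" "x = z j" by blast
    then have "x \<in> N \<inter> K" using that unfolding branch_points_def by blast
    then have "z j = z i" using N(3) j(3) by blast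
    then show False using inj i j(1,2) by (meson inj_onD)
  qed
  moreover have "q holomorphic_on N" unfolding q_def by (intro holomorphic_intros)
  ultimately obtain p where p: "p holomorphic_on N" "\<And>x. x \<in> N \<Longrightarrow> (p x)\<^sup>2 = q x"
      and q0: "\<And>x. x \<in> N \<Longrightarrow> q x \<noteq> 0"
    using holomorphic_sqrt_on_starlike[OF N(1) starN] by metis
  have p0: "p x \<noteq> 0" if "x \<in> N" for x using p(2)[OF that] q0[OF that] by auto
  define T where "T = (\<lambda>\<mu>. z i + \<mu>\<^sup>2) -` N"
  have "open T" unfolding T_def by (intro open_vimage N continuous_intros)
  have T0: "0 \<in> T" using zN by (simp add: T_def)
  have "starlike T"
    unfolding starlike_def
  proof (intro bexI ballI subsetI)
    \<comment> \<open>Scaling \<mu> by t scales \<mu>^2 by t^2, so segments from 0 are mapped into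
      segments from \<open>z i\<close>, which stay in the convex \<open>N\<close>.\<close>
    fix \<mu> x assume "\<mu> \<in> T" "x \<in> closed_segment 0 \<mu>"
    then obtain t where t: "0 \<le> t" "t \<le> 1" "x = t *\<^sub>R \<mu>" by (auto simp: in_segment)
    have "(1 - t\<^sup>2) *\<^sub>R z i + t\<^sup>2 *\<^sub>R (z i + \<mu>\<^sup>2) \<in> N"
      using t \<open>\<mu> \<in> T\<close> zN by (intro convexD[OF N(2)]) (auto simp: T_def power_le_one)
    moreover have "(1 - t\<^sup>2) *\<^sub>R z i + t\<^sup>2 *\<^sub>R (z i + \<mu>\<^sup>2) = z i + x\<^sup>2"
      by (simp add: t scaleR_conv_of_real algebra_simps power_mult_distrib)
    ultimately show "x \<in> T" by (simp add: T_def)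
  qed (rule T0)
  \<comment> \<open>With x = z i + \<mu>^2 one has dx = 2 \<mu> d\<mu> and \<surd>D = \<mu> p(x):
    the factor 2 remains and \<mu> cancels.\<close>
  define v where "v = (\<lambda>\<mu>. 2 * u (z i + \<mu>\<^sup>2) / p (z i + \<mu>\<^sup>2))"
  have v: "v holomorphic_on T"
  proof -
    have sq: "(\<lambda>\<mu>. z i + \<mu>\<^sup>2) holomorphic_on T" "(\<lambda>\<mu>. z i + \<mu>\<^sup>2) ` T \<subseteq> N"
      by (auto simp: T_def intro!: holomorphic_intros)
    have "(\<lambda>\<mu>. u (z i + \<mu>\<^sup>2)) holomorphic_on T" "(\<lambda>\<mu>. p (z i + \<mu>\<^sup>2)) holomorphic_on T"
      using holomorphic_on_compose_gen[OF sq(1) u] holomorphic_on_compose_gen[OF sq(1) p(1) sq(2)]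
      by (auto simp: o_def)
    then show ?thesis
      unfolding v_def using p0 sq(2) by (intro holomorphic_intros) auto
  qed
  obtain H0 where H0: "\<And>\<mu>. \<mu> \<in> T \<Longrightarrow> (H0 has_field_derivative v \<mu>) (at \<mu>)"
    using holomorphic_starlike_primitive[OF holomorphic_on_imp_continuous_on[OF v] \<open>starlike T\<close> \<open>open T\<close>, of "{}"]
      holomorphic_on_imp_differentiable_at[OF v \<open>open T\<close>] by auto
  \<comment> \<open>\<open>v\<close> is even, so the odd part of a primitive is again a primitive;
    it vanishes at 0 and changes sign with the sheet.\<close>
  define H where "H = (\<lambda>\<mu>. (H0 \<mu> - H0 (- \<mu>)) / 2)"
  have H: "(H has_field_derivative v \<mu>) (at \<mu>)" if "\<mu> \<in> T" for \<mu>
  proof -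
    have "- \<mu> \<in> T" "v (- \<mu>) = v \<mu>" using that by (auto simp: T_def v_def)
    moreover have "((\<lambda>\<mu>. H0 (- \<mu>)) has_field_derivative v (- \<mu>) * (- 1)) (at \<mu>)"
      by (rule DERIV_chain2[where f = H0 and g = uminus, OF H0])
        (use \<open>- \<mu> \<in> T\<close> in \<open>auto intro!: derivative_eq_intros\<close>)
    ultimately have "((\<lambda>\<mu>. H0 (- \<mu>)) has_field_derivative v \<mu> * (- 1)) (at \<mu>)" by simp
    from DERIV_cdivide[OF DERIV_diff[OF H0[OF that] this], of 2] show ?thesis
      unfolding H_def by simp
  qed
  define G where "G = (\<lambda>(x, w). H (w / p x))"
  have inT: "w / p x \<in> T" if "x \<in> N" "w\<^sup>2 = D x" for x w
    using that p0[OF that(1)] by (simp add: T_def power_divide p(2) D q0)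
  have "is_primitive u N G"
    unfolding is_primitive_def
  proof (intro conjI allI impI)
    have "continuous_on (cover N) (\<lambda>pt. p (fst pt))"
      by (rule continuous_on_compose2[OF holomorphic_on_imp_continuous_on[OF p(1)]])
        (auto intro!: continuous_intros simp: cover_def)
    then have c: "continuous_on (cover N) (\<lambda>pt. snd pt / p (fst pt))"
      by (intro continuous_intros) (use p0 in \<open>auto simp: cover_def\<close>)
    have "continuous_on T H"
      using H by (meson DERIV_isCont continuous_at_imp_continuous_on)
    then have "continuous_on (cover N) (\<lambda>pt. H (snd pt / p (fst pt)))"
      by (rule continuous_on_compose2[OF _ c]) (use inT in \<open>auto simp: cover_def\<close>)
    then show "continuous_on (cover N) G" by (simp add: G_def case_prod_unfold)
    fix U s x assume U: "open U" "U \<subseteq> N" "trivialization z k U s" "x \<in> U"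
    have x: "x \<in> N" using U by auto
    \<comment> \<open>The coordinate \<mu> along the sheet \<open>s\<close>: m^2 = y - z i, hence 2
      m m' = 1.\<close>
    define m where "m = (\<lambda>y. s y / p y)"
    have "m holomorphic_on U"
      unfolding m_def using U p0
      by (intro holomorphic_intros trivialization_holomorphic holomorphic_on_subset[OF p(1)]) auto
    then obtain m' where m': "(m has_field_derivative m') (at x)"
      using U by (auto simp: holomorphic_on_open)
    have m2: "m y * m y = y - z i" if "y \<in> U" for y
    proof -
      have "y \<in> N" using that U by auto
      then show ?thesis
        using trivializationD(3)[OF U(3) that] p0[of y] q0[of y]
        by (simp add: m_def power2_eq_square[symmetric] power_divide p(2) D)
    qed
    have mx: "m x \<noteq> 0" "s x \<noteq> 0" using trivializationD(2)[OF U(3,4)] p0[OF x] by (auto simp: m_def)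
    have "((\<lambda>y. m y * m y) has_field_derivative m' * m x + m' * m x) (at x)"
      using DERIV_mult[OF m' m'] by simp
    moreover have "((\<lambda>y. m y * m y) has_field_derivative 1) (at x)"
    proof (rule has_field_derivative_transform_within_open)
      show "((\<lambda>y. y - z i) has_field_derivative 1) (at x)" by (auto intro!: derivative_eq_intros)
    qed (use U m2 in auto)
    ultimately have "m' * m x + m' * m x = 1" by (rule DERIV_unique)
    moreover have "m' * (2 * m x) = m' * m x + m' * m x" by (simp add: algebra_simps)
    ultimately have m'x: "m' * (2 * m x) = 1" by simp
    have "((\<lambda>y. H (m y)) has_field_derivative v (m x) * m') (at x)"
      using inT[OF x trivializationD(3)[OF U(3,4)]]
      by (intro DERIV_chain2[OF H m']) (simp add: m_def)
    moreover have "v (m x) * m' = u x / s x"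
    proof -
      have "m' = 1 / (2 * m x)" using m'x mx by (simp add: field_simps)
      moreover have "v (m x) = 2 * u x / p x"
        using m2[OF U(4)] by (simp add: v_def power2_eq_square)
      ultimately show ?thesis using mx p0[OF x] by (simp add: m_def)
    qed
    ultimately show "((\<lambda>y. G (y, s y)) has_field_derivative u x / s x) (at x)"
      by (simp add: G_def m_def)
  qed fact
  moreover have "H (- \<mu>) = - H \<mu>" "H 0 = 0" for \<mu>
    unfolding H_def by (metis minus_diff_eq minus_divide_left minus_minus, simp)
  ultimately show ?thesis
    by (intro exI[of _ G]) (simp add: G_def)
qed

lemma exists_branch_neighbourhood:
  assumes "i \<in> {1..2*k}"
  shows "\<exists>r>0. ball (z i) r \<inter> K = {z i} \<and> cball (z i) r \<inter> K = {z i}"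
proof -
  have zi: "z i \<in> K" using assms by (auto simp: branch_points_def)
  have "open (- (K - {z i}))" by (intro open_Compl finite_imp_closed finite_Diff finite_K)
  then obtain r where r: "r > 0" "cball (z i) r \<subseteq> - (K - {z i})"
    using open_contains_cball by (metis ComplI Diff_iff insertI1)
  then have "cball (z i) r \<inter> K = {z i}" using zi by auto
  moreover have "ball (z i) r \<subseteq> cball (z i) r" "z i \<in> ball (z i) r" using r by auto
  ultimately show ?thesis using r by (intro exI[of _ r]) blast
qed

lemma exists_is_primitive:
  assumes u: "u holomorphic_on UNIV"
  shows "\<exists>N G. x0 \<in> N \<and> is_primitive u N G"
proof (cases "x0 \<in> K")
  case True
  then obtain i where i: "i \<in> {1..2*k}" "x0 = z i" by (auto simp: branch_points_def)
  then obtain r where "r > 0" "ball (z i) r \<inter> K = {z i}" using exists_branch_neighbourhood by blast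
  then show ?thesis
    using is_primitive_branch_point[OF i(1) open_ball convex_ball _ u] i by (metis centre_in_ball)
next
  case False
  then obtain U s where U: "open U" "x0 \<in> U" "trivialization z k U s"
    using root_cover_local_trivialization by blast
  then obtain r where r: "r > 0" "ball x0 r \<subseteq> U" using openE by blast
  have t: "trivialization z k (ball x0 r) s" by (rule trivialization_subset[OF U(3) r(2)])
  have hol: "(\<lambda>x. u x / s x) holomorphic_on ball x0 r"
    using trivialization_holomorphic[OF t] trivializationD(2)[OF t]
    by (intro holomorphic_intros holomorphic_on_subset[OF u]) auto
  then obtain \<Phi> where "\<And>x. x \<in> ball x0 r \<Longrightarrow> (\<Phi> has_field_derivative u x / s x) (at x)"
    using holomorphic_convex_primitive'[OF convex_ball open_ball hol] at_within_open[OF _ open_ball]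
    by (metis (no_types, lifting))
  then have "is_primitive u (ball x0 r) (\<lambda>(x, w). w / s x * \<Phi> x)"
    by (rule is_primitive_regular[OF open_ball t])
  then show ?thesis using r centre_in_ball by blast
qed


subsection \<open>Integrals along root paths\<close>

text \<open>The root \<open>s\<close> is a function of the parameter only; near \<open>t\<close> it
  is a trivialization composed with \<open>g\<close>, so the chain rule applies.\<close>

lemma is_primitive_along_path:
  assumes G: "is_primitive u N G" and t: "g t \<in> N" "g t \<notin> K"
    and g: "(g has_vector_derivative d) (at t)" and s: "isCont s t"
    and sq: "\<forall>\<^sub>F t' in nhds t. (s t')\<^sup>2 = D (g t')"
  shows "((\<lambda>t. G (g t, s t)) has_vector_derivative (u (g t) / s t * d)) (at t)"
proof -
  have st: "(s t)\<^sup>2 = D (g t)" using sq by (rule eventually_nhds_x_imp_x)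
  obtain U r where U: "open U" "g t \<in> U" "U \<subseteq> N" "trivialization z k U r" "r (g t) = s t"
    using exists_trivialization_through[OF t(2) st is_primitiveD(1)[OF G] t(1)] by blast
  have "isCont g t" using g has_vector_derivative_continuous by blast
  then have gt: "(g \<longlongrightarrow> g t) (nhds t)" by (simp only: isCont_def tendsto_at_iff_tendsto_nhds)
  have "isCont r (g t)" using trivialization_isCont U by blast
  then have rt: "((\<lambda>t'. r (g t')) \<longlongrightarrow> s t) (nhds t)"
    using isCont_tendsto_compose[OF _ gt] U(5) by metis
  have "(s \<longlongrightarrow> s t) (nhds t)" using s by (simp only: isCont_def tendsto_at_iff_tendsto_nhds)
  moreover have gU: "\<forall>\<^sub>F t' in nhds t. g t' \<in> U" by (rule topological_tendstoD[OF gt U(1,2)])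
  have "\<forall>\<^sub>F t' in nhds t. (r (g t'))\<^sup>2 = (s t')\<^sup>2"
    using gU sq by eventually_elim (use trivializationD(3)[OF U(4)] in auto)
  moreover have "s t \<noteq> 0" using trivializationD(2)[OF U(4,2)] U(5) by simp
  ultimately have ev: "\<forall>\<^sub>F t' in nhds t. r (g t') = s t'"
    by (intro eventually_eq_of_power2_eq[OF rt])
  have "((\<lambda>y. G (y, r y)) has_field_derivative u (g t) / r (g t)) (at (g t))"
    by (rule is_primitiveD(3)[OF G U(1,3,4,2)])
  from field_vector_diff_chain_at[OF g this]
  have "((\<lambda>t. G (g t, r (g t))) has_vector_derivative (d * (u (g t) / s t))) (at t)"
    by (simp add: o_def U(5))
  moreover have "\<forall>\<^sub>F t' in nhds t. t' \<in> UNIV \<longrightarrow> G (g t', r (g t')) = G (g t', s t')"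
    using ev by eventually_elim simp
  ultimately show ?thesis
    using has_vector_derivative_cong_ev[where f = "\<lambda>t. G (g t, r (g t))" and g = "\<lambda>t. G (g t, s t)"
        and x = t and S = UNIV]
      eventually_nhds_x_imp_x[OF ev] by (simp add: mult.commute)
qed

text \<open>\<open>M\<close> is a subgroup of the complex numbers and \<open>F\<close> a primitive
  only modulo \<open>M\<close>. The integral up to time t minus F(g t, s t) is locally constant
  modulo \<open>M\<close>, hence constant by connectedness. \<open>M\<close> is everything when only
  existence of the integral is wanted, the even periods for admissible functions, and the imaginary
  axis for real primitives.\<close>

lemma root_path_integral:
  assumes M: "0 \<in> M" "\<And>a b. a \<in> M \<Longrightarrow> b \<in> M \<Longrightarrow> a - b \<in> M"
    and F: "\<And>x. \<exists>N G. x \<in> N \<and> is_primitive u N G \<and> (\<forall>p\<in>cover N. F p - G p \<in> M)"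
    and path: "root_path z k g s"
  shows "\<exists>I. has_root_integral u g s I \<and> I - (F (g 1, s 1) - F (g 0, s 0)) \<in> M"
proof -
  have M': "- a \<in> M" if "a \<in> M" for a using M(2)[OF M(1) that] by simp
  have Mp: "a + b \<in> M" if "a \<in> M" "b \<in> M" for a b using M(2)[OF that(1) M'[OF that(2)]] by simp
  have g: "valid_path g" "g ` {0<..<1} \<subseteq> - K" and s: "continuous_on {0..1} s"
    and sq: "\<And>t. t \<in> {0..1} \<Longrightarrow> (s t)\<^sup>2 = D (g t)"
    using path by (auto simp: root_path_def)
  have gc: "continuous_on {0..1} g"
    using valid_path_imp_path[OF g(1)] by (simp add: path_def)
  obtain S where S: "finite S" "g C1_differentiable_on {0..1} - S"
    using g(1) by (auto simp: valid_path_def piecewise_C1_differentiable_on_def)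
  define h where "h = (\<lambda>t. u (g t) / s t * vector_derivative g (at t within {0..1}))"
  have gd: "(g has_vector_derivative vector_derivative g (at t within {0..1})) (at t)"
    if "t \<in> {0<..<1} - S" for t
  proof -
    have "at t within {0..1} = at t" using that by (intro at_within_Icc_at) auto
    moreover have "g differentiable at t"
      using S(2) that unfolding C1_differentiable_on_def by (auto intro: differentiableI_vector)
    ultimately show ?thesis by (simp add: vector_derivative_works)
  qed
  have local: "\<exists>d>0. \<exists>N G. g t0 \<in> N \<and> is_primitive u N G \<and> (\<forall>p\<in>cover N. F p - G p \<in> M) \<and>
      (\<forall>t\<in>{0..1}. dist t t0 < d \<longrightarrow> g t \<in> N) \<and>
      (\<forall>a b. a \<le> b \<longrightarrow> {a..b} \<subseteq> {0..1} \<longrightarrow> {a..b} \<subseteq> ball t0 d \<longrightarrow>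
        (h has_integral (G (g b, s b) - G (g a, s a))) {a..b})" if t0: "t0 \<in> {0..1}" for t0
  proof -
    obtain N G where N: "g t0 \<in> N" "is_primitive u N G" "\<forall>p\<in>cover N. F p - G p \<in> M" using F by blast
    obtain e where e: "e > 0" "ball (g t0) e \<subseteq> N"
      using openE[OF is_primitiveD(1)[OF N(2)] N(1)] by blast
    obtain d where d: "d > 0" "\<And>t. t \<in> {0..1} \<Longrightarrow> dist t t0 < d \<Longrightarrow> dist (g t) (g t0) < e"
      using gc t0 e(1) unfolding continuous_on_iff by metis
    have dN: "g t \<in> N" if "t \<in> {0..1}" "dist t t0 < d" for t
      using d(2)[OF that] e(2) by (auto simp: dist_commute)
    have "(h has_integral (G (g b, s b) - G (g a, s a))) {a..b}"
      if ab: "a \<le> b" "{a..b} \<subseteq> {0..1}" "{a..b} \<subseteq> ball t0 d" for a b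
    \<comment> \<open>This version asks for continuity on the closed interval but for derivatives
      only at interior points off \<open>S\<close>; that admits corners of the path and ends at
      branch points.\<close>
    proof (rule fundamental_theorem_of_calculus_interior_strong[OF S(1) ab(1)])
      have inN: "g t \<in> N" if "t \<in> {a..b}" for t
        using that ab by (intro dN) (auto simp: subset_iff dist_commute)
      show "continuous_on {a..b} (\<lambda>t. G (g t, s t))"
      proof (rule continuous_on_compose2[OF is_primitiveD(2)[OF N(2)]])
        show "continuous_on {a..b} (\<lambda>t. (g t, s t))"
          using continuous_on_subset[OF gc ab(2)] continuous_on_subset[OF s ab(2)] by (intro continuous_intros)
        show "(\<lambda>t. (g t, s t)) ` {a..b} \<subseteq> cover N"
          using inN sq ab(2) by (auto simp: cover_def)
      qed
      fix t assume t: "t \<in> {a<..<b} - S"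
      have "a \<in> {0..1}" "b \<in> {0..1}" using ab by auto
      then have t01: "t \<in> {0<..<1}" using t by auto
      have ev: "\<forall>\<^sub>F t' in nhds t. t' \<in> {0<..<1}" using t01 by (intro eventually_nhds_in_open) auto
      have "((\<lambda>t. G (g t, s t)) has_vector_derivative (u (g t) / s t * vector_derivative g (at t within {0..1}))) (at t)"
      proof (rule is_primitive_along_path[OF N(2)])
        show "g t \<in> N" using inN[of t] t by auto
        show "g t \<notin> K" using t01 g(2) by blast
        show "(g has_vector_derivative vector_derivative g (at t within {0..1})) (at t)"
          using gd t t01 by blast
        show "isCont s t" using s t01 continuous_on_interior[of "{0..1}" s t] by simp
        show "\<forall>\<^sub>F t' in nhds t. (s t')\<^sup>2 = D (g t')" using ev by eventually_elim (use sq in auto)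
      qed
      then show "((\<lambda>t. G (g t, s t)) has_vector_derivative h t) (at t)" by (simp add: h_def)
    qed
    then show ?thesis using d(1) N dN by blast
  qed
  have int: "h integrable_on {0..1}"
  proof -
    have "h integrable_on cbox 0 1"
    proof (rule integrable_on_little_subintervals, intro ballI)
      fix t0 :: real assume "t0 \<in> cbox 0 1"
      then have "t0 \<in> {0..1}" by simp
      from local[OF this] obtain d G where d: "d > 0"
        "\<And>a b. a \<le> b \<Longrightarrow> {a..b} \<subseteq> {0..1} \<Longrightarrow> {a..b} \<subseteq> ball t0 d \<Longrightarrow>
          (h has_integral (G (g b, s b) - G (g a, s a))) {a..b}" by blast
      have "h integrable_on cbox a b"
        if "t0 \<in> cbox a b" "cbox a b \<subseteq> ball t0 d" "cbox a b \<subseteq> cbox 0 1" for a b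
        using d(2)[of a b] that by (auto simp: has_integral_integrable)
      then show "\<exists>d>0. \<forall>a b. t0 \<in> cbox a b \<and> cbox a b \<subseteq> ball t0 d \<and> cbox a b \<subseteq> cbox 0 1 \<longrightarrow>
          h integrable_on cbox a b"
        using d(1) by blast
    qed
    then show ?thesis by simp
  qed
  define J where "J = (\<lambda>t. integral {0..t} h)"
  have J: "J b - J a = integral {a..b} h" if "0 \<le> a" "a \<le> b" "b \<le> 1" for a b
  proof -
    have "h integrable_on {0..b}" using that by (intro integrable_subinterval_real[OF int]) auto
    from Henstock_Kurzweil_Integration.integral_combine[OF that(1,2) this]
    show ?thesis by (simp add: J_def algebra_simps)
  qed
  define c where "c = (\<lambda>t. J t - F (g t, s t))"
  have "c 1 - c 0 \<in> M"
  proof (rule connected_equivalence_relation[of "{0..1::real}" 0 1 "\<lambda>t t'. c t' - c t \<in> M"])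
    show "c x - c y \<in> M" if "c y - c x \<in> M" for x y using M'[OF that] by simp
    show "c r - c x \<in> M" if "c y - c x \<in> M" "c r - c y \<in> M" for x y r using Mp[OF that] by simp
    fix t0 :: real assume t0: "t0 \<in> {0..1}"
    obtain d N G where d: "d > 0" "\<forall>p\<in>cover N. F p - G p \<in> M" "\<And>t. t \<in> {0..1} \<Longrightarrow> dist t t0 < d \<Longrightarrow> g t \<in> N"
        "\<And>a b. a \<le> b \<Longrightarrow> {a..b} \<subseteq> {0..1} \<Longrightarrow> {a..b} \<subseteq> ball t0 d \<Longrightarrow>
          (h has_integral (G (g b, s b) - G (g a, s a))) {a..b}"
      using local[OF t0] by blast
    have FG: "F (g t, s t) - G (g t, s t) \<in> M" if "t \<in> {0..1}" "dist t t0 < d" for t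
      using d(2,3) that sq by (auto simp: cover_def)
    have step: "c b - c a \<in> M" if "a \<le> b" "{a..b} \<subseteq> {0..1}" "{a..b} \<subseteq> ball t0 d" for a b
    proof -
      have ab: "a \<in> {a..b}" "b \<in> {a..b}" using that by auto
      then have "0 \<le> a" "b \<le> 1" using that by auto
      then have "J b - J a = G (g b, s b) - G (g a, s a)"
        using J[of a b] that integral_unique[OF d(4)[OF that]] by simp
      then have "c b - c a = (F (g a, s a) - G (g a, s a)) - (F (g b, s b) - G (g b, s b))"
        by (simp add: c_def)
      moreover have "dist a t0 < d" "dist b t0 < d" "a \<in> {0..1}" "b \<in> {0..1}"
        using ab that by (auto simp: subset_iff dist_commute)
      ultimately show ?thesis using M(2) FG by metis
    qed
    have "c t - c t0 \<in> M" if t: "t \<in> {0..1} \<inter> ball t0 d" for t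
    proof (cases "t0 \<le> t")
      case True
      then show ?thesis using t t0 by (intro step) (auto simp: dist_real_def)
    next
      case False
      then have "c t0 - c t \<in> M" using t t0 by (intro step) (auto simp: dist_real_def)
      then show ?thesis using M' by fastforce
    qed
    then show "\<exists>T. openin (top_of_set {0..1}) T \<and> t0 \<in> T \<and> (\<forall>t\<in>T. c t - c t0 \<in> M)"
      using t0 d(1) by (intro exI[of _ "{0..1} \<inter> ball t0 d"]) (auto simp: openin_open)
  qed auto
  moreover have "c 1 - c 0 = J 1 - (F (g 1, s 1) - F (g 0, s 0))" by (simp add: c_def J_def)
  moreover have "has_root_integral u g s (J 1)"
    using int unfolding has_root_integral_def J_def h_def by (rule integrable_integral)
  ultimately show ?thesis by auto
qed

lemma has_root_integral_exists:
  assumes "u holomorphic_on UNIV" "root_path z k g s"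
  shows "\<exists>I. has_root_integral u g s I"
  using root_path_integral[of UNIV u "\<lambda>_. 0" g s] exists_is_primitive[OF assms(1)] assms(2) by auto

text \<open>Only the ends of \<open>g\<close> can be branch points, so D(g t) is nonzero on an
  interval of parameters. A root exists there, and extended by 0 it stays continuous because |s|^2 =
  |D(g)|.\<close>

lemma exists_root_along_path:
  fixes g :: "real \<Rightarrow> complex"
  assumes g: "continuous_on {0..1} g" "g ` {0<..<1} \<subseteq> - K" and w: "w\<^sup>2 = D (g 1)"
  shows "\<exists>s. continuous_on {0..1} s \<and> (\<forall>t\<in>{0..1}. (s t)\<^sup>2 = D (g t)) \<and> s 1 = w"
proof -
  define T where "T = {t \<in> {0..1}. D (g t) \<noteq> 0}"
  have T: "{0<..<1} \<subseteq> T" "T \<subseteq> {0..1}"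
    using g(2) by (auto simp: T_def branch_poly_eq_0_iff subset_iff)
  have "convex T"
    unfolding is_interval_convex_1[symmetric] is_interval_1
  proof (intro ballI allI impI)
    fix a b x assume "a \<in> T" "b \<in> T" "a \<le> x \<and> x \<le> b"
    moreover from this have "0 \<le> a" "b \<le> 1" using T(2) by auto
    ultimately show "x \<in> T"
      using T(1) by (cases "x = a \<or> x = b") (auto simp: subset_iff)
  qed
  have Dg: "continuous_on {0..1} (\<lambda>t. D (g t))" by (intro continuous_on_branch_poly g)
  obtain s0 where s0: "continuous_on T s0" "\<And>t. t \<in> T \<Longrightarrow> D (g t) = (s0 t)\<^sup>2"
  proof (rule continuous_sqrt_on_contractible[OF continuous_on_subset[OF Dg T(2)] convex_imp_contractible[OF \<open>convex T\<close>]])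
    show "D (g t) \<noteq> 0" if "t \<in> T" for t using that by (simp add: T_def)
  qed blast
  define s where "s = (\<lambda>t. if t \<in> T then s0 t else 0)"
  have s2: "(s t)\<^sup>2 = D (g t)" if "t \<in> {0..1}" for t
    using that s0(2) by (auto simp: s_def T_def)
  have "continuous_on {0..1} s"
    unfolding continuous_on
  proof
    fix t :: real assume t: "t \<in> {0..1}"
    show "(s \<longlongrightarrow> s t) (at t within {0..1})"
    proof (cases "t \<in> T")
      case True
      have "openin (top_of_set {0..1}) ({0..1} \<inter> (\<lambda>t. D (g t)) -` (- {0}))"
        by (rule continuous_openin_preimage_gen[OF Dg]) auto
      moreover have "{0..1} \<inter> (\<lambda>t. D (g t)) -` (- {0}) = T" by (auto simp: T_def)
      ultimately have "openin (top_of_set {0..1}) T" by simp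
      then obtain O' where O': "open O'" "T = {0..1} \<inter> O'" by (auto simp: openin_open)
      have "at t within {0..1} = at t within T"
        by (rule at_within_nhd[of t O']) (use O' True in auto)
      moreover have "(s0 \<longlongrightarrow> s0 t) (at t within T)" using s0(1) True by (simp add: continuous_on)
      moreover have "\<forall>\<^sub>F t' in at t within T. s0 t' = s t'" by (auto simp: eventually_at_filter s_def)
      ultimately show ?thesis using True by (auto simp: s_def intro: Lim_transform_eventually)
    next
      case False
      then have "D (g t) = 0" "s t = 0" using t by (auto simp: T_def s_def)
      moreover have "((\<lambda>t. D (g t)) \<longlongrightarrow> D (g t)) (at t within {0..1})"
        using Dg t by (auto simp: continuous_on)
      ultimately have "((\<lambda>t. D (g t)) \<longlongrightarrow> 0) (at t within {0..1})" by simp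
      then have "((\<lambda>t. sqrt (norm (D (g t)))) \<longlongrightarrow> sqrt (norm (0::complex))) (at t within {0..1})"
        by (intro tendsto_intros)
      moreover have "\<forall>\<^sub>F t' in at t within {0..1}. sqrt (norm (D (g t'))) = norm (s t')"
        by (auto simp: eventually_at_filter norm_power simp flip: s2)
      ultimately have "((\<lambda>t. norm (s t)) \<longlongrightarrow> 0) (at t within {0..1})"
        by (auto intro: Lim_transform_eventually)
      then show ?thesis using \<open>s t = 0\<close> tendsto_norm_zero_iff by auto
    qed
  qed
  \<comment> \<open>If the root ends on the wrong sheet, its negative is used.\<close>
  moreover have "s 1 = w \<or> - s 1 = w"
  proof -
    have "(s 1)\<^sup>2 = w\<^sup>2" using s2[of 1] w by simp
    then have "s 1 = w \<or> s 1 = - w" by (rule power2_eq_iff[THEN iffD1])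
    then show ?thesis by auto
  qed
  ultimately show ?thesis
    using s2 by (metis (no_types, lifting) continuous_on_minus power2_minus)
qed

text \<open>The path starts at a branch point and \<open>y\<close> may be another one, so short
  segments leave \<open>z 1\<close> and enter \<open>y\<close>, and a polynomial path in the
  complement of \<open>K\<close> joins them.\<close>

lemma exists_root_path:
  assumes y: "y \<noteq> z 1" and w: "w\<^sup>2 = D y"
  shows "\<exists>g s. root_path z k g s \<and> pathstart g = z 1 \<and> pathfinish g = y \<and> s 1 = w"
proof -
  have seg: "\<exists>r>0. \<forall>x. x \<noteq> c \<longrightarrow> dist x c < r \<longrightarrow> closed_segment c x - {c} \<subseteq> - K" for c
  proof -
    have "open (- (K - {c}))" by (intro open_Compl finite_imp_closed finite_Diff finite_K)
    then obtain r where r: "r > 0" "ball c r \<subseteq> - (K - {c})" using openE by blast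
    have "closed_segment c x - {c} \<subseteq> - K" if "dist x c < r" for x
    proof -
      have "closed_segment c x \<subseteq> ball c r"
        using that r(1) by (intro closed_segment_subset) (auto simp: dist_commute)
      then show ?thesis using r(2) by blast
    qed
    then show ?thesis using r(1) by blast
  qed
  obtain r1 where r1: "r1 > 0" "\<And>x. x \<noteq> z 1 \<Longrightarrow> dist x (z 1) < r1 \<Longrightarrow> closed_segment (z 1) x - {z 1} \<subseteq> - K"
    using seg by blast
  obtain r2 where r2: "r2 > 0" "\<And>x. x \<noteq> y \<Longrightarrow> dist x y < r2 \<Longrightarrow> closed_segment y x - {y} \<subseteq> - K"
    using seg by blast
  define a where "a = z 1 + of_real (r1 / 2)"
  define b where "b = y + of_real (r2 / 2)"
  have a: "a \<noteq> z 1" "dist a (z 1) < r1" and b: "b \<noteq> y" "dist b y < r2"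
    using r1(1) r2(1) by (auto simp: a_def b_def dist_norm)
  have ab: "a \<in> - K" "b \<in> - K" using r1(2)[OF a] r2(2)[OF b] a b by auto
  have "connected (- K)"
    using connected_open_delete_finite[of "UNIV :: complex set" K] finite_K connected_UNIV by (simp add: Compl_eq_Diff_UNIV)
  then obtain q where q: "polynomial_function q" "path_image q \<subseteq> - K" "pathstart q = a" "pathfinish q = b"
    using connected_open_polynomial_connected[OF open_Compl_K _ ab] by blast
  define g where "g = linepath (z 1) a +++ (q +++ linepath b y)"
  have vg: "valid_path g" unfolding g_def
    using q by (intro valid_path_join valid_path_linepath valid_path_polynomial_function) auto
  have g01: "pathstart g = z 1" "pathfinish g = y" by (simp_all add: g_def)
  have gK: "g ` {0<..<1} \<subseteq> - K"
  proof
    fix x assume "x \<in> g ` {0<..<1}"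
    then obtain t where t: "0 < t" "t < 1" "x = g t" by auto
    consider "t \<le> 1 / 2" | "t > 1 / 2" "2 * t - 1 \<le> 1 / 2" | "2 * t - 1 > 1 / 2" by linarith
    then show "x \<in> - K"
    proof cases
      case 1
      then have x: "x = linepath (z 1) a (2 * t)" using t by (simp add: g_def joinpaths_def)
      then have "x \<in> closed_segment (z 1) a" using 1 t by (auto simp: linepath_in_path)
      moreover have "x - z 1 = (2 * t) *\<^sub>R (a - z 1)" by (simp add: x linepath_def algebra_simps)
      then have "x \<noteq> z 1" using a t by auto
      ultimately show ?thesis using r1(2)[OF a] by blast
    next
      case 2
      then have x: "x = q (2 * (2 * t - 1))" using t by (simp add: g_def joinpaths_def)
      have "2 * (2 * t - 1) \<in> {0..1}" using 2 by auto
      then have "x \<in> path_image q" unfolding x path_image_def by (rule imageI)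
      then show ?thesis using q by blast
    next
      case 3
      then have x: "x = linepath b y (2 * (2 * t - 1) - 1)" using t by (simp add: g_def joinpaths_def)
      then have "x \<in> closed_segment b y" using 3 t by (auto simp: linepath_in_path)
      moreover have "linepath b y \<tau> - y = (1 - \<tau>) *\<^sub>R (b - y)" for \<tau>
        by (simp add: linepath_def algebra_simps)
      then have "x - y = (1 - (2 * (2 * t - 1) - 1)) *\<^sub>R (b - y)" unfolding x .
      then have "x \<noteq> y" using b t by auto
      ultimately show ?thesis using r2(2)[OF b] by (auto simp: closed_segment_commute)
    qed
  qed
  have "continuous_on {0..1} g" using valid_path_imp_path[OF vg] by (simp add: path_def)
  moreover have "g 1 = y" using g01 by (simp add: pathfinish_def)
  ultimately obtain s where "continuous_on {0..1} s" "\<forall>t\<in>{0..1}. (s t)\<^sup>2 = D (g t)" "s 1 = w"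
    using exists_root_along_path[OF _ gK, of w] w by auto
  then show ?thesis using vg gK g01 by (intro exI[of _ g] exI[of _ s]) (auto simp: root_path_def)
qed


subsection \<open>The slit plane\<close>

text \<open>The coordinate (x - p) / (z i - p) sends \<open>p\<close> to 0 and \<open>z i\<close> to
  1; the slit is the ray from \<open>z i\<close> that points away from \<open>p\<close>.\<close>

definition slit :: "complex \<Rightarrow> nat \<Rightarrow> complex set" where
  "slit p i = {x. Im ((x - p) / (z i - p)) = 0 \<and> Re ((x - p) / (z i - p)) \<ge> 1}"

text \<open>The points \<open>p\<close> to be avoided lie in \<open>K\<close> or on a line through
  two branch points, a null set. For the others, no line through \<open>p\<close> contains two
  branch points, which keeps the slits disjoint.\<close>

lemma exists_generic_point:
  "\<exists>p. \<forall>i\<in>{1..2*k}. z i \<noteq> p \<and> (\<forall>j\<in>{1..2*k}. j \<noteq> i \<longrightarrow> Im ((z j - p) / (z i - p)) \<noteq> 0)"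
proof -
  define P where "P = {(i, j). i \<in> {1..2*k} \<and> j \<in> {1..2*k} \<and> i \<noteq> j}"
  define L where "L = (\<lambda>(i, j). {p. (\<i> * (z j - z i)) \<bullet> p = (\<i> * (z j - z i)) \<bullet> z i})"
  have "finite P"
    by (rule finite_subset[of _ "{1..2*k} \<times> {1..2*k}"]) (auto simp: P_def)
  moreover have "negligible (L q)" if "q \<in> P" for q
  proof -
    obtain i j where q: "q = (i, j)" by (cases q)
    then have "i \<in> {1..2*k}" "j \<in> {1..2*k}" "i \<noteq> j" using that by (auto simp: P_def)
    then have "z i \<noteq> z j" using inj by (auto dest: inj_onD)
    then show ?thesis unfolding L_def q by (auto intro!: negligible_hyperplane)
  qed
  ultimately have "negligible (K \<union> (\<Union>q\<in>P. L q))"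
    using negligible_finite[OF finite_K] by (intro negligible_Un negligible_Union) auto
  then have "K \<union> (\<Union>q\<in>P. L q) \<noteq> UNIV"
    using non_negligible_UNIV by metis
  then obtain p where p: "p \<notin> K" "\<And>q. q \<in> P \<Longrightarrow> p \<notin> L q" by blast
  show ?thesis
  proof (intro exI ballI conjI impI notI)
    fix i assume i: "i \<in> {1..2*k}"
    show zp: False if "z i = p" using that p(1) i by (auto simp: branch_points_def)
    fix j assume j: "j \<in> {1..2*k}" "j \<noteq> i" and im: "Im ((z j - p) / (z i - p)) = 0"
    define t where "t = Re ((z j - p) / (z i - p))"
    have "(z j - p) / (z i - p) = of_real t" using im by (simp add: t_def complex_eq_iff)
    moreover have "z i - p \<noteq> 0" using zp by auto
    ultimately have "z j - p = of_real t * (z i - p)" by (simp add: field_simps)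
    then have "z j - z i = of_real (t - 1) * (z i - p)" by (simp add: algebra_simps)
    moreover have "(\<i> * (of_real s * v)) \<bullet> (- v) = 0" for s v
      by (simp add: inner_complex_def)
    ultimately have "(\<i> * (z j - z i)) \<bullet> (p - z i) = 0"
      by (metis minus_diff_eq)
    then have "p \<in> L (i, j)" by (simp add: L_def inner_diff_right)
    then show False using p(2)[of "(i, j)"] i j by (auto simp: P_def)
  qed
qed

text \<open>The slit plane is starlike about \<open>p\<close>. \<open>N i\<close> is an open sector
  with apex \<open>p\<close> around the slit of \<open>z i\<close>, narrow enough to miss the other
  slits; without its slit it is starlike about the midpoint of \<open>p\<close> and
  \<open>z i\<close>.\<close>

lemma exists_slits:
  "\<exists>p N. open (- (\<Union>i\<in>{1..2*k}. slit p i)) \<and> starlike (- (\<Union>i\<in>{1..2*k}. slit p i)) \<and>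
    (\<forall>i\<in>{1..2*k}. open (N i) \<and> convex (N i) \<and> z i \<in> slit p i \<and> slit p i \<subseteq> N i \<and>
      (\<forall>j\<in>{1..2*k}. j \<noteq> i \<longrightarrow> N i \<inter> slit p j = {}) \<and> connected (N i - slit p i))"
proof -
  obtain p where p: "\<And>i. i \<in> {1..2*k} \<Longrightarrow> z i \<noteq> p"
    "\<And>i j. i \<in> {1..2*k} \<Longrightarrow> j \<in> {1..2*k} \<Longrightarrow> j \<noteq> i \<Longrightarrow> Im ((z j - p) / (z i - p)) \<noteq> 0"
    using exists_generic_point by blast
  define c where "c = (\<lambda>i x. (x - p) / (z i - p))"
  define Q where "Q = {(i, j). i \<in> {1..2*k} \<and> j \<in> {1..2*k} \<and> j \<noteq> i}"
  \<comment> \<open>A sector of slope at most this ratio leaves out \<open>z j\<close>; the 1 in the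
    denominator avoids division by 0.\<close>
  define A where "A = (\<lambda>(i, j). \<bar>Im (c i (z j))\<bar> / (1 + \<bar>Re (c i (z j))\<bar>)) ` Q"
  have finA: "finite A"
    unfolding A_def by (intro finite_imageI finite_subset[of Q "{1..2*k} \<times> {1..2*k}"]) (auto simp: Q_def)
  have posA: "a > 0" if "a \<in> A" for a
    using that p by (auto simp: A_def Q_def c_def)
  define d where "d = Min (insert 1 A)"
  have d0: "d > 0" using finA posA by (simp add: d_def)
  have dle: "d * Re (c i (z j)) \<le> \<bar>Im (c i (z j))\<bar>" if "i \<in> {1..2*k}" "j \<in> {1..2*k}" "j \<noteq> i" for i j
  proof -
    have "\<bar>Im (c i (z j))\<bar> / (1 + \<bar>Re (c i (z j))\<bar>) \<in> A" using that by (auto simp: A_def Q_def)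
    then have "d \<le> \<bar>Im (c i (z j))\<bar> / (1 + \<bar>Re (c i (z j))\<bar>)" using finA by (simp add: d_def)
    then have "d * (1 + \<bar>Re (c i (z j))\<bar>) \<le> \<bar>Im (c i (z j))\<bar>"
      by (simp add: pos_le_divide_eq add_pos_nonneg)
    moreover have "d * Re (c i (z j)) \<le> d * (1 + \<bar>Re (c i (z j))\<bar>)"
      using d0 by (intro mult_left_mono) auto
    ultimately show ?thesis by linarith
  qed
  define N where "N = (\<lambda>i. {x. \<bar>Im (c i x)\<bar> < d * Re (c i x)})"
  have slit: "slit p i = {x. Im (c i x) = 0 \<and> Re (c i x) \<ge> 1}" for i by (simp add: slit_def c_def)
  have cc: "continuous_on UNIV (c i)" if "i \<in> {1..2*k}" for i
    unfolding c_def using p(1)[OF that] by (intro continuous_intros) auto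
  have aff: "c i ((1 - t) *\<^sub>R x + t *\<^sub>R y) = (1 - t) *\<^sub>R c i x + t *\<^sub>R c i y" for i t x y
  proof -
    have "(1 - t) *\<^sub>R x + t *\<^sub>R y - p = (1 - t) *\<^sub>R (x - p) + t *\<^sub>R (y - p)"
      by (simp add: algebra_simps)
    then show ?thesis by (simp add: c_def scaleR_conv_of_real add_divide_distrib)
  qed
  have scale: "c i x = c i y * c j x" if "j \<in> {1..2*k}" "y = z j" for i j x y
    using p(1)[OF that(1)] by (simp add: c_def that(2))
  have cp: "c i p = 0" for i by (simp add: c_def)
  have cz: "c i (z i) = 1" if "i \<in> {1..2*k}" for i using p(1)[OF that] by (simp add: c_def)
  have closed_slit: "closed (slit p i)" if "i \<in> {1..2*k}" for i
    unfolding slit using cc[OF that] by (intro closed_Collect_conj closed_Collect_eq closed_Collect_le continuous_intros)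
  have "open (- (\<Union>i\<in>{1..2*k}. slit p i))"
    using closed_slit by (intro open_Compl closed_UN) auto
  moreover have "starlike (- (\<Union>i\<in>{1..2*k}. slit p i))"
    unfolding starlike_def
  proof (intro bexI ballI subsetI)
    show "p \<in> - (\<Union>i\<in>{1..2*k}. slit p i)" by (auto simp: slit cp)
    fix x y assume x: "x \<in> - (\<Union>i\<in>{1..2*k}. slit p i)" and "y \<in> closed_segment p x"
    then obtain t where t: "0 \<le> t" "t \<le> 1" "y = (1 - t) *\<^sub>R p + t *\<^sub>R x" by (auto simp: in_segment)
    show "y \<in> - (\<Union>i\<in>{1..2*k}. slit p i)"
    proof (clarsimp)
      fix i assume i: "Suc 0 \<le> i" "i \<le> 2 * k" "y \<in> slit p i"
      have "c i y = t *\<^sub>R c i x" unfolding t(3) aff by (simp add: cp)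
      then have "t * Im (c i x) = 0" "t * Re (c i x) \<ge> 1" using i(3) by (auto simp: slit)
      moreover from this have "t \<noteq> 0" by auto
      moreover from calculation have "Re (c i x) > 0"
        using t(1) zero_less_mult_pos[of t "Re (c i x)"] by linarith
      then have "t * Re (c i x) \<le> Re (c i x)" using t mult_right_mono[of t 1 "Re (c i x)"] by auto
      ultimately have "x \<in> slit p i" by (simp add: slit)
      then show False using x i by auto
    qed
  qed
  moreover have "open (N i) \<and> convex (N i) \<and> z i \<in> slit p i \<and> slit p i \<subseteq> N i \<and>
      (\<forall>j\<in>{1..2*k}. j \<noteq> i \<longrightarrow> N i \<inter> slit p j = {}) \<and> connected (N i - slit p i)" if i: "i \<in> {1..2*k}" for i
  proof (intro conjI ballI impI)
    show "open (N i)"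
      unfolding N_def using cc[OF i] by (intro open_Collect_less continuous_intros)
    show conv: "convex (N i)"
      unfolding convex_alt
    proof (intro ballI allI impI)
      fix x y and t :: real assume xy: "x \<in> N i" "y \<in> N i" and t: "0 \<le> t \<and> t \<le> 1"
      have "\<bar>Im (c i ((1 - t) *\<^sub>R x + t *\<^sub>R y))\<bar> \<le> \<bar>(1 - t) * Im (c i x)\<bar> + \<bar>t * Im (c i y)\<bar>"
        by (simp add: aff)
      also have "\<dots> = (1 - t) * \<bar>Im (c i x)\<bar> + t * \<bar>Im (c i y)\<bar>" using t by (simp add: abs_mult)
      also have "\<dots> < (1 - t) * (d * Re (c i x)) + t * (d * Re (c i y))"
        using xy t by (cases "t = 0") (auto simp: N_def intro!: add_le_less_mono mult_left_mono)
      also have "\<dots> = d * ((1 - t) * Re (c i x) + t * Re (c i y))" by (simp add: algebra_simps)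
      also have "(1 - t) * Re (c i x) + t * Re (c i y) = Re (c i ((1 - t) *\<^sub>R x + t *\<^sub>R y))" by (simp add: aff)
      finally show "(1 - t) *\<^sub>R x + t *\<^sub>R y \<in> N i" by (simp add: N_def)
    qed
    show "z i \<in> slit p i" by (simp add: slit cz[OF i])
    show "slit p i \<subseteq> N i" using d0 by (auto simp: slit N_def)
    show "N i \<inter> slit p j = {}" if j: "j \<in> {1..2*k}" "j \<noteq> i" for j
    proof (rule ccontr)
      assume "N i \<inter> slit p j \<noteq> {}"
      then obtain x where x: "x \<in> N i" "x \<in> slit p j" by blast
      define t where "t = Re (c j x)"
      have t: "t \<ge> 1" "c j x = of_real t" using x(2) by (auto simp: slit t_def complex_eq_iff)
      have "c i x = of_real t * c i (z j)" using scale[OF j(1) refl, of i x] t by simp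
      then have "t * \<bar>Im (c i (z j))\<bar> < t * (d * Re (c i (z j)))"
        using x(1) t by (simp add: N_def abs_mult mult_ac)
      then show False using dle[OF i j] t by simp
    qed
    \<comment> \<open>The apex \<open>p\<close> is not in the open sector, so the midpoint, whose
      coordinate 1/2 lies before the slit, serves as the centre.\<close>
    define m where "m = (1 - 1 / 2) *\<^sub>R p + (1 / 2) *\<^sub>R z i"
    have cm: "c i m = 1 / 2" unfolding m_def aff by (simp add: cp cz[OF i] scaleR_conv_of_real)
    have "starlike (N i - slit p i)"
      unfolding starlike_def
    proof (intro bexI ballI subsetI)
      show mN: "m \<in> N i - slit p i" using d0 by (simp add: N_def slit cm)
      fix x y assume x: "x \<in> N i - slit p i" and y: "y \<in> closed_segment m x"
      then have yN: "y \<in> N i" using mN conv by (auto simp: convex_contains_segment)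
      obtain t where t: "0 \<le> t" "t \<le> 1" "y = (1 - t) *\<^sub>R m + t *\<^sub>R x" using y by (auto simp: in_segment)
      have "c i y = (1 - t) *\<^sub>R (1 / 2) + t *\<^sub>R c i x" unfolding t(3) aff cm by simp
      then have im: "Im (c i y) = t * Im (c i x)" and re: "Re (c i y) = (1 - t) / 2 + t * Re (c i x)"
        by (simp_all add: scaleR_conv_of_real)
      have "y \<notin> slit p i"
      proof
        assume "y \<in> slit p i"
        then have y1: "t * Im (c i x) = 0" "(1 - t) / 2 + t * Re (c i x) \<ge> 1" by (auto simp: slit im re)
        then have "t \<noteq> 0" by auto
        then have "Im (c i x) = 0" using y1 by auto
        then have "Re (c i x) < 1" using x by (auto simp: slit)
        then have "t * Re (c i x) \<le> t * 1" using t by (intro mult_left_mono) auto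
        then have "t \<ge> 1" using y1 by argo
        then show False using y1 t \<open>Re (c i x) < 1\<close> by auto
      qed
      then show "y \<in> N i - slit p i" using yN by blast
    qed
    then show "connected (N i - slit p i)" by (rule starlike_imp_connected)
  qed
  ultimately show ?thesis by blast
qed

section \<open>Multivalued primitives modulo even periods\<close>

definition even_span :: "(nat \<Rightarrow> complex) \<Rightarrow> complex set" where
  "even_span \<alpha> = {s. \<exists>n::nat \<Rightarrow> int. s = (\<Sum>i\<in>{1..2*k}. of_int (2 * n i) * \<alpha> i)}"

lemma even_span_0: "0 \<in> even_span \<alpha>"
  unfolding even_span_def by (auto intro!: exI[of _ "\<lambda>_. 0"])

lemma even_span_diff: "a \<in> even_span \<alpha> \<Longrightarrow> b \<in> even_span \<alpha> \<Longrightarrow> a - b \<in> even_span \<alpha>"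
proof -
  assume "a \<in> even_span \<alpha>" "b \<in> even_span \<alpha>"
  then obtain m n :: "nat \<Rightarrow> int" where "a = (\<Sum>i\<in>{1..2*k}. of_int (2 * m i) * \<alpha> i)"
      "b = (\<Sum>i\<in>{1..2*k}. of_int (2 * n i) * \<alpha> i)"
    unfolding even_span_def by blast
  then have "a - b = (\<Sum>i\<in>{1..2*k}. of_int (2 * (m i - n i)) * \<alpha> i)"
    by (simp add: sum_subtractf algebra_simps)
  then show ?thesis unfolding even_span_def by (auto intro!: exI[of _ "\<lambda>i. m i - n i"])
qed

lemma even_span_double: "i \<in> {1..2*k} \<Longrightarrow> 2 * \<alpha> i \<in> even_span \<alpha>"
proof -
  assume "i \<in> {1..2*k}"
  then have "2 * \<alpha> i = (\<Sum>j\<in>{1..2*k}. of_int (2 * (if j = i then 1 else 0)) * \<alpha> j)"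
    by (simp add: if_distrib[of of_int] if_distrib[of "\<lambda>x. x * _"] if_distrib[of "(*) 2"] cong: if_cong)
  then show ?thesis unfolding even_span_def by (auto intro!: exI[of _ "\<lambda>j. if j = i then 1 else 0"])
qed

text \<open>On the slit plane \<open>u / \<surd>D\<close> has a primitive \<open>\<Phi>\<close>.  As \<open>\<surd>D\<close> changes sign across the slit
  that starts at \<open>z i\<close>, continuation across it turns \<open>\<Phi>\<close> into \<open>2 \<Phi> (z i) - \<Phi>\<close>.  Hence, with
  \<open>\<alpha> i = \<Phi> (z i) - \<Phi> (z 1)\<close>, the function \<open>\<Phi> - \<Phi> (z 1)\<close> is well defined on the cover modulo the
  group generated by the \<open>2 \<alpha> i\<close>.\<close>

lemma exists_multivalued_primitive:
  assumes u: "u holomorphic_on UNIV"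
  shows "\<exists>F \<alpha>. \<alpha> 1 = 0 \<and> (\<forall>i\<in>{1..2*k}. F (z i, 0) = \<alpha> i) \<and>
    (\<forall>x w. w\<^sup>2 = D x \<longrightarrow> F (x, w) + F (x, - w) \<in> even_span \<alpha>) \<and>
    (\<forall>x. \<exists>N G. x \<in> N \<and> is_primitive u N G \<and> (\<forall>q\<in>cover N. F q - G q \<in> even_span \<alpha>))"
proof -
  define I where "I = {1..2*k}"
  obtain p N where om: "open (- (\<Union>i\<in>I. slit p i))" "starlike (- (\<Union>i\<in>I. slit p i))"
    and N: "\<And>i. i \<in> I \<Longrightarrow> open (N i)" "\<And>i. i \<in> I \<Longrightarrow> convex (N i)" "\<And>i. i \<in> I \<Longrightarrow> z i \<in> slit p i"
      "\<And>i. i \<in> I \<Longrightarrow> slit p i \<subseteq> N i" "\<And>i j. i \<in> I \<Longrightarrow> j \<in> I \<Longrightarrow> j \<noteq> i \<Longrightarrow> N i \<inter> slit p j = {}"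
      "\<And>i. i \<in> I \<Longrightarrow> connected (N i - slit p i)"
    using exists_slits unfolding I_def by blast
  define \<Omega> where "\<Omega> = - (\<Union>i\<in>I. slit p i)"
  have K: "K = z ` I" by (simp add: branch_points_def I_def)
  have zI: "z i \<in> N j \<longleftrightarrow> i = j" if "i \<in> I" "j \<in> I" for i j
    using N(3-5) that by blast
  have NK: "N i \<inter> K = {z i}" if "i \<in> I" for i
    using zI that by (auto simp: K)
  have "\<Omega> \<inter> K = {}" using N(3) by (auto simp: \<Omega>_def K)
  then have "D x \<noteq> 0" if "x \<in> \<Omega>" for x using that by (auto simp: branch_poly_eq_0_iff)
  then have "\<exists>g. g holomorphic_on \<Omega> \<and> (\<forall>x\<in>\<Omega>. (g x)\<^sup>2 = D x)"
    by (intro holomorphic_sqrt_on_starlike om[folded \<Omega>_def] D_holomorphic holomorphic_on_ident)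
  then obtain r where r: "r holomorphic_on \<Omega>" "\<And>x. x \<in> \<Omega> \<Longrightarrow> (r x)\<^sup>2 = D x" by blast
  have triv: "trivialization z k \<Omega> r"
    using r holomorphic_on_imp_continuous_on[OF r(1)] \<open>\<Omega> \<inter> K = {}\<close> by (auto simp: trivialization_def)
  have r0: "r x \<noteq> 0" if "x \<in> \<Omega>" for x using trivializationD(2)[OF triv that] .
  have ur: "(\<lambda>x. u x / r x) holomorphic_on \<Omega>"
    using r0 by (intro holomorphic_intros r holomorphic_on_subset[OF u]) auto
  obtain \<Phi> where \<Phi>: "\<And>x. x \<in> \<Omega> \<Longrightarrow> (\<Phi> has_field_derivative u x / r x) (at x)"
    using holomorphic_starlike_primitive[OF holomorphic_on_imp_continuous_on[OF ur] om(2,1)[folded \<Omega>_def], of "{}"]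
      holomorphic_on_imp_differentiable_at[OF ur om(1)[folded \<Omega>_def]] by auto
  have "\<exists>G. is_primitive u (N i) G \<and> (\<forall>x w. G (x, - w) = - G (x, w)) \<and> G (z i, 0) = 0" if "i \<in> I" for i
    using is_primitive_branch_point[OF _ N(1,2) NK u] that by (auto simp: I_def)
  then obtain G where G: "\<And>i. i \<in> I \<Longrightarrow> is_primitive u (N i) (G i)"
      "\<And>i x w. i \<in> I \<Longrightarrow> G i (x, - w) = - G i (x, w)" "\<And>i. i \<in> I \<Longrightarrow> G i (z i, 0) = 0"
    by metis
  have overlap: "N i - slit p i \<subseteq> \<Omega>" if "i \<in> I" for i
    using N(5)[OF that] by (auto simp: \<Omega>_def)
  \<comment> \<open>As \<open>G i\<close> vanishes at the branch point, this constant is the limit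
    of \<Phi> at \<open>z i\<close>.\<close>
  have "\<exists>c. \<forall>x\<in>N i - slit p i. \<Phi> x = G i (x, r x) + c" if i: "i \<in> I" for i
  proof -
    have op: "open (N i - slit p i)"
    proof -
      have "N i - slit p i = N i \<inter> \<Omega>" using overlap[OF i] i by (auto simp: \<Omega>_def)
      then show ?thesis using N(1)[OF i] om by (auto simp: \<Omega>_def)
    qed
    have der: "((\<lambda>x. \<Phi> x - G i (x, r x)) has_field_derivative 0) (at x)" if "x \<in> N i - slit p i" for x
    proof -
      have "((\<lambda>x. G i (x, r x)) has_field_derivative u x / r x) (at x)"
        using that trivialization_subset[OF triv overlap[OF i]]
        by (intro is_primitiveD(3)[OF G(1)[OF i] op]) auto
      from DERIV_diff[OF \<Phi> this] show ?thesis using overlap[OF i] that by auto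
    qed
    then have "(\<lambda>x. \<Phi> x - G i (x, r x)) constant_on (N i - slit p i)"
      using has_field_derivative_0_imp_constant_on[OF _ N(6)[OF i] op] by blast
    then obtain c where "\<And>x. x \<in> N i - slit p i \<Longrightarrow> \<Phi> x - G i (x, r x) = c"
      by (auto simp: constant_on_def)
    then show ?thesis by (intro exI[of _ c]) (auto simp: algebra_simps)
  qed
  then obtain c where c: "\<And>i x. i \<in> I \<Longrightarrow> x \<in> N i - slit p i \<Longrightarrow> \<Phi> x = G i (x, r x) + c i" by metis
  define \<alpha> where "\<alpha> = (\<lambda>i. c i - c 1)"
  define F0 where "F0 = (\<lambda>(x, w). w / r x * (\<Phi> x - c 1))"
  \<comment> \<open>On a slit the primitive around its branch point stands in, shifted by
    \<open>\<alpha> i\<close> so that it matches \<open>F0\<close> on the sheet of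
    \<open>r\<close>.\<close>
  define F where "F = (\<lambda>(x, w). if x \<in> \<Omega> then F0 (x, w)
     else let i = (SOME i. i \<in> I \<and> x \<in> slit p i) in G i (x, w) + \<alpha> i)"
  have F1: "F (x, w) = F0 (x, w)" if "x \<in> \<Omega>" for x w using that by (simp add: F_def)
  have F2: "F (x, w) = G i (x, w) + \<alpha> i" if "i \<in> I" "x \<in> slit p i" for x w i
  proof -
    have "(SOME i. i \<in> I \<and> x \<in> slit p i) = i"
    proof (rule some_equality)
      fix j assume "j \<in> I \<and> x \<in> slit p j"
      then show "j = i" using N(4,5) that by blast
    qed (use that in auto)
    moreover have "x \<notin> \<Omega>" using that by (auto simp: \<Omega>_def)
    ultimately show ?thesis by (simp add: F_def)
  qed
  have FG: "F (x, w) - (G i (x, w) + \<alpha> i) \<in> even_span \<alpha>" if i: "i \<in> I" "x \<in> N i" "w\<^sup>2 = D x" for x w i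
  proof (cases "x \<in> slit p i")
    case True
    then show ?thesis using F2[OF i(1)] even_span_0 by simp
  next
    case False
    then have x: "x \<in> \<Omega>" "x \<in> N i - slit p i" using overlap[OF i(1)] i(2) by auto
    have "w\<^sup>2 = (r x)\<^sup>2" using r(2)[OF x(1)] i(3) by simp
    then consider "w = r x" | "w = - r x" by (auto simp: power2_eq_iff)
    then show ?thesis
    proof cases
      case 1
      then show ?thesis
        using F1[OF x(1)] c[OF i(1) x(2)] r0[OF x(1)] even_span_0 by (simp add: F0_def \<alpha>_def)
    next
      case 2
      \<comment> \<open>On the sheet of - r, oddness of \<open>F0\<close> and \<open>G i\<close>
        leaves G i - \<alpha> i in place of G i + \<alpha> i.\<close>
      then have "F (x, w) - (G i (x, w) + \<alpha> i) = 0 - 2 * \<alpha> i"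
        using F1[OF x(1)] c[OF i(1) x(2)] r0[OF x(1)] G(2)[OF i(1)] by (simp add: F0_def \<alpha>_def)
      then show ?thesis using even_span_diff[OF even_span_0 even_span_double] i(1) I_def by metis
    qed
  qed
  show ?thesis
  proof (rule exI[of _ F], rule exI[of _ \<alpha>], intro conjI allI ballI impI)
    show "\<alpha> 1 = 0" by (simp add: \<alpha>_def)
    show "F (z i, 0) = \<alpha> i" if "i \<in> {1..2*k}" for i
      using that F2[of i "z i" 0] N(3)[of i] G(3)[of i] by (simp add: I_def)
    show "F (x, w) + F (x, - w) \<in> even_span \<alpha>" for x w
    proof (cases "x \<in> \<Omega>")
      case True
      then show ?thesis using even_span_0 by (simp add: F1 F0_def)
    next
      case False
      then obtain i where i: "i \<in> I" "x \<in> slit p i" by (auto simp: \<Omega>_def)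
      then have "F (x, w) + F (x, - w) = 2 * \<alpha> i" using F2[OF i] G(2)[OF i(1)] by simp
      then show ?thesis using even_span_double i(1) by (simp add: I_def)
    qed
    fix x
    show "\<exists>N G. x \<in> N \<and> is_primitive u N G \<and> (\<forall>q\<in>cover N. F q - G q \<in> even_span \<alpha>)"
    proof (cases "x \<in> \<Omega>")
      case True
      have "is_primitive u \<Omega> F0"
        unfolding F0_def
        by (rule is_primitive_regular[OF _ triv]) (use om \<Phi> in \<open>auto simp: \<Omega>_def intro!: derivative_eq_intros\<close>)
      moreover have "\<forall>q\<in>cover \<Omega>. F q - F0 q \<in> even_span \<alpha>"
        using F1 even_span_0 by (auto simp: cover_def)
      ultimately show ?thesis using True by blast
    next
      case False
      then obtain i where i: "i \<in> I" "x \<in> N i" using N(4) by (auto simp: \<Omega>_def)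
      have "is_primitive u (N i) (\<lambda>q. G i q + \<alpha> i)" by (rule is_primitive_add_const[OF G(1)[OF i(1)]])
      moreover have "\<forall>q\<in>cover (N i). F q - (G i q + \<alpha> i) \<in> even_span \<alpha>"
        using FG[OF i(1)] by (auto simp: cover_def)
      ultimately show ?thesis using i(2) by blast
    qed
  qed
qed


subsection \<open>Real primitives\<close>

text \<open>Oddness is required over branch points too, where it forces the value 0 and so fixes the
  additive constant. Values at pairs with w^2 \<noteq> D(x) are left open, hence the restrictions to
  \<open>root_cover\<close> later on.\<close>

definition re_primitive :: "(complex \<Rightarrow> complex) \<Rightarrow> (complex \<times> complex \<Rightarrow> real) \<Rightarrow> bool" where
  "re_primitive u f \<longleftrightarrow>
     (\<forall>x. \<exists>N G. x \<in> N \<and> is_primitive u N G \<and> (\<forall>q\<in>cover N. f q = Re (G q))) \<and>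
     (\<forall>x w. w\<^sup>2 = D x \<longrightarrow> f (x, - w) = - f (x, w))"

lemma re_primitive_branch_point:
  assumes "re_primitive u f" "i \<in> {1..2*k}"
  shows "f (z i, 0) = 0"
proof -
  have "D (z i) = 0" using assms(2) by (simp add: branch_poly_eq_0_iff branch_points_def)
  then have "f (z i, - 0) = - f (z i, 0)"
    using assms(1) unfolding re_primitive_def by (metis power_zero_numeral)
  then show ?thesis by simp
qed

lemma branch_root_0: "w\<^sup>2 = D (z i) \<Longrightarrow> i \<in> {1..2*k} \<Longrightarrow> w = 0"
  using branch_poly_eq_0_iff[of z k "z i"] by (auto simp: branch_points_def)

text \<open>The conditions \<open>Re I = 0\<close> only say that \<open>a i = Re (\<alpha> i)\<close> satisfies
  \<open>a j \<in> 2 (\<int> a 1 + \<dots> + \<int> a (2 k))\<close>, as the given paths may cross the slits.  The matrix of this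
  homogeneous system is the identity modulo 2, hence invertible.\<close>

lemma admissible_imp_re_primitive:
  assumes u: "u \<in> admissible z k"
  shows "\<exists>f. re_primitive u f"
proof -
  have uh: "u holomorphic_on UNIV" using u by (simp add: admissible_def)
  obtain F \<alpha> where a1: "\<alpha> 1 = 0" and Fz: "\<And>i. i \<in> {1..2*k} \<Longrightarrow> F (z i, 0) = \<alpha> i"
    and Fodd: "\<And>x w. w\<^sup>2 = D x \<Longrightarrow> F (x, w) + F (x, - w) \<in> even_span \<alpha>"
    and F: "\<And>x. \<exists>N G. x \<in> N \<and> is_primitive u N G \<and> (\<forall>q\<in>cover N. F q - G q \<in> even_span \<alpha>)"
    using exists_multivalued_primitive[OF uh] by blast
  have "\<exists>n::nat \<Rightarrow> int. Re (\<alpha> j) + (\<Sum>i\<in>{1..2*k}. of_int (2 * n i) * Re (\<alpha> i)) = 0" if j: "j \<in> {1..2*k}" for j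
  proof (cases "j = 1")
    case True
    then show ?thesis using a1 by (intro exI[of _ "\<lambda>_. 0"]) simp
  next
    case False
    then obtain g s I where g: "root_path z k g s" "pathstart g = z 1" "pathfinish g = z j"
        "has_root_integral u g s I" "Re I = 0"
      using u j unfolding admissible_def by fastforce
    \<comment> \<open>The only root over a branch point is 0, so the ends of the lifted path are
      determined.\<close>
    have ends: "s 0 = 0" "s 1 = 0" "g 0 = z 1" "g 1 = z j"
      using g(1-3) branch_root_0[of "s 0" 1] branch_root_0[of "s 1" j] j
      by (auto simp: root_path_def pathstart_def pathfinish_def)
    obtain I' where "has_root_integral u g s I'" "I' - (F (g 1, s 1) - F (g 0, s 0)) \<in> even_span \<alpha>"
      using root_path_integral[OF even_span_0 even_span_diff F g(1)] by blast
    moreover from this have "I' = I" using has_root_integral_unique g(4) by blast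
    ultimately have "I - \<alpha> j \<in> even_span \<alpha>" using Fz[of 1] Fz[OF j] a1 k by (simp add: ends)
    then obtain n :: "nat \<Rightarrow> int" where "I - \<alpha> j = (\<Sum>i\<in>{1..2*k}. of_int (2 * n i) * \<alpha> i)"
      unfolding even_span_def by blast
    then have "Re (I - \<alpha> j) = Re (\<Sum>i\<in>{1..2*k}. of_int (2 * n i) * \<alpha> i)" by simp
    moreover have "Re (of_int (2 * n i) * \<alpha> i) = of_int (2 * n i) * Re (\<alpha> i)" for i by simp
    ultimately have "- Re (\<alpha> j) = (\<Sum>i\<in>{1..2*k}. of_int (2 * n i) * Re (\<alpha> i))"
      by (simp only: Re_sum minus_complex.sel g(5) diff_0)
    then show ?thesis by (intro exI[of _ n]) simp
  qed
  then obtain n :: "nat \<Rightarrow> nat \<Rightarrow> int" where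
    n: "\<And>j. j \<in> {1..2*k} \<Longrightarrow> Re (\<alpha> j) + (\<Sum>i\<in>{1..2*k}. of_int (2 * n j i) * Re (\<alpha> i)) = 0"
    by metis
  define B where "B = (\<lambda>j i. (if i = j then 1 else 0) + 2 * n j i)"
  have "\<forall>i\<in>{1..2*k}. Re (\<alpha> i) = 0"
  proof (rule odd_diagonal_system_trivial[of _ B])
    fix j assume j: "j \<in> {1..2*k}"
    have "(\<Sum>i\<in>{1..2*k}. of_int (B j i) * Re (\<alpha> i))
        = (\<Sum>i\<in>{1..2*k}. (if i = j then Re (\<alpha> i) else 0) + of_int (2 * n j i) * Re (\<alpha> i))"
      by (intro sum.cong) (auto simp: B_def algebra_simps)
    also have "\<dots> = Re (\<alpha> j) + (\<Sum>i\<in>{1..2*k}. of_int (2 * n j i) * Re (\<alpha> i))"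
      using j by (simp add: sum.distrib)
    finally show "(\<Sum>i\<in>{1..2*k}. of_int (B j i) * Re (\<alpha> i)) = 0" using n[OF j] by simp
  qed (auto simp: B_def)
  \<comment> \<open>All even periods are purely imaginary now, so Re F is a real primitive although
    \<open>F\<close> itself is one only modulo periods.\<close>
  then have span: "Re c = 0" if "c \<in> even_span \<alpha>" for c
    using that by (auto simp: even_span_def intro!: sum.neutral)
  have "re_primitive u (\<lambda>q. Re (F q))"
    unfolding re_primitive_def
  proof (intro conjI allI impI)
    show "\<exists>N G. x \<in> N \<and> is_primitive u N G \<and> (\<forall>q\<in>cover N. Re (F q) = Re (G q))" for x
    proof -
      from F[of x] obtain N G where N: "x \<in> N" "is_primitive u N G" "\<forall>q\<in>cover N. F q - G q \<in> even_span \<alpha>"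
        by (elim exE conjE)
      have "\<forall>q\<in>cover N. Re (F q) = Re (G q)"
        using span N(3) by fastforce
      then show ?thesis using N(1,2) by (intro exI conjI)
    qed
    show "Re (F (x, - w)) = - Re (F (x, w))" if "w\<^sup>2 = D x" for x w
      using span[OF Fodd[OF that]] by simp
  qed
  then show ?thesis by blast
qed

lemma re_primitive_integral:
  assumes f: "re_primitive u f" and path: "root_path z k g s"
  shows "\<exists>I. has_root_integral u g s I \<and> Re I = f (g 1, s 1) - f (g 0, s 0)"
proof -
  have F: "\<exists>N G. x \<in> N \<and> is_primitive u N G \<and> (\<forall>q\<in>cover N. of_real (f q) - G q \<in> {c. Re c = 0})" for x
    using f unfolding re_primitive_def by fastforce
  have "\<exists>I. has_root_integral u g s I \<and> I - (of_real (f (g 1, s 1)) - of_real (f (g 0, s 0))) \<in> {c. Re c = 0}"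
    by (rule root_path_integral[OF _ _ F path]) auto
  then show ?thesis by auto
qed

lemma re_primitive_integral_rel:
  assumes f: "re_primitive u f"
  shows "integral_rel z k (restrict f (root_cover z k)) u"
  unfolding integral_rel_def
proof (clarify)
  fix x w g s assume x: "(pathfinish g, s 1) \<in> root_cover z k" and g: "root_path z k g s" "pathstart g = z 1"
  have "s 0 = 0" "g 0 = z 1" "g 1 = pathfinish g"
    using g branch_root_0[of "s 0" 1] k by (auto simp: root_path_def pathstart_def pathfinish_def)
  then show "\<exists>I. has_root_integral u g s I \<and> restrict f (root_cover z k) (pathfinish g, s 1) = Re I"
    using re_primitive_integral[OF f g(1)] re_primitive_branch_point[OF f, of 1] x k by auto
qed

text \<open>A path from \<open>z 1\<close> to \<open>z j\<close> joins two zeros of the real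
  primitive, so its integral is purely imaginary.\<close>

lemma re_primitive_imp_admissible:
  assumes u: "u holomorphic_on UNIV" and f: "re_primitive u f"
  shows "u \<in> admissible z k"
  unfolding admissible_def
proof (intro CollectI conjI ballI u)
  fix j assume j: "j \<in> {2..2*k}"
  then have "z j \<noteq> z 1" using inj k by (auto dest!: inj_onD)
  moreover have "0\<^sup>2 = D (z j)"
    using j branch_poly_eq_0_iff[of z k "z j"] by (auto simp: branch_points_def)
  ultimately obtain g s where g: "root_path z k g s" "pathstart g = z 1" "pathfinish g = z j" "s 1 = 0"
    using exists_root_path by blast
  have "s 0 = 0" "g 0 = z 1" "g 1 = z j"
    using g branch_root_0[of "s 0" 1] k by (auto simp: root_path_def pathstart_def pathfinish_def)
  then obtain I where "has_root_integral u g s I" "Re I = 0"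
    using re_primitive_integral[OF f g(1)] re_primitive_branch_point[OF f, of 1]
      re_primitive_branch_point[OF f, of j] j g(4) k by auto
  then show "\<exists>g s I. root_path z k g s \<and> pathstart g = z 1 \<and> pathfinish g = z j \<and>
      has_root_integral u g s I \<and> Re I = 0" using g by blast
qed

text \<open>The paths over which \<open>integral_rel\<close> quantifies reach every point of the
  cover with the prescribed root, and the integral along a given path is unique.\<close>

lemma integral_rel_unique:
  assumes "integral_rel z k f u" "integral_rel z k f' u" "q \<in> root_cover z k"
  shows "f q = f' q"
proof -
  obtain x w where q: "q = (x, w)" by (cases q)
  have "x \<notin> K" "w\<^sup>2 = D x" using assms(3) by (auto simp: root_cover_def q)
  moreover from this have "x \<noteq> z 1" using z1_in_K by auto
  ultimately obtain g s where g: "root_path z k g s" "pathstart g = z 1" "pathfinish g = x" "s 1 = w"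
    using exists_root_path by blast
  from assms(1) obtain I where I: "has_root_integral u g s I" "f q = Re I"
    using g assms(3) unfolding integral_rel_def q by blast
  from assms(2) obtain I' where "has_root_integral u g s I'" "f' q = Re I'"
    using g assms(3) unfolding integral_rel_def q by blast
  then show ?thesis using I has_root_integral_unique by metis
qed

lemma re_primitive_local:
  assumes f: "re_primitive u f" and s: "trivialization z k U s" "open U" "x \<in> U"
  shows "\<exists>V P. open V \<and> x \<in> V \<and> V \<subseteq> U \<and> (\<forall>y\<in>V. (P has_field_derivative u y / s y) (at y) \<and> f (y, s y) = Re (P y))"
proof -
  obtain N G where N: "x \<in> N" "is_primitive u N G" "\<And>q. q \<in> cover N \<Longrightarrow> f q = Re (G q)"
    using f unfolding re_primitive_def by blast
  have t: "trivialization z k (U \<inter> N) s" by (rule trivialization_subset[OF s(1)]) auto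
  have o: "open (U \<inter> N)" using s(2) is_primitiveD(1)[OF N(2)] by auto
  have "((\<lambda>y. G (y, s y)) has_field_derivative u y / s y) (at y) \<and> f (y, s y) = Re (G (y, s y))"
    if "y \<in> U \<inter> N" for y
    using is_primitiveD(3)[OF N(2) o _ t that] N(3)[of "(y, s y)"] that trivializationD(3)[OF t that]
    by (auto simp: cover_def)
  then show ?thesis using N(1) s(3) o by (intro exI[of _ "U \<inter> N"] exI[of _ "\<lambda>y. G (y, s y)"]) auto
qed

lemma re_primitive_has_derivative:
  assumes f: "re_primitive u f" and s: "trivialization z k U s" "open U" "x \<in> U"
  shows "((\<lambda>y. f (y, s y)) has_derivative (\<lambda>d. Re (u x / s x * d))) (at x)"
proof -
  obtain V P where V: "open V" "x \<in> V" "\<And>y. y \<in> V \<Longrightarrow> (P has_field_derivative u y / s y) (at y)"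
      "\<And>y. y \<in> V \<Longrightarrow> f (y, s y) = Re (P y)"
    using re_primitive_local[OF assms] by blast
  show ?thesis
    using has_derivative_transform_within_open[OF has_derivative_Re_holomorphic[OF V(3)[OF V(2)]] V(1,2)] V(4)
    by simp
qed

text \<open>The derivative of \<open>f\<close> in a trivialization determines \<open>u\<close> off
  the branch points; the identity theorem does the rest.\<close>

lemma re_primitive_unique:
  assumes u: "u holomorphic_on UNIV" "u' holomorphic_on UNIV" and f: "re_primitive u f" "re_primitive u' f'"
    and eq: "\<And>q. q \<in> root_cover z k \<Longrightarrow> f q = f' q"
  shows "u = u'"
proof
  fix x
  have "u x = u' x" if x: "x \<in> - K" for x
  proof -
    obtain U s where U: "open U" "x \<in> U" "trivialization z k U s"
      using root_cover_local_trivialization[of x z k] x by auto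
    have "((\<lambda>y. f (y, s y)) has_derivative (\<lambda>d. Re (u' x / s x * d))) (at x)"
      using has_derivative_transform_within_open[OF re_primitive_has_derivative[OF f(2) U(3,1,2)] U(1,2)]
        eq trivializationD(4)[OF U(3)] by simp
    then have "(\<lambda>d. Re (u x / s x * d)) = (\<lambda>d. Re (u' x / s x * d))"
      using has_derivative_unique[OF re_primitive_has_derivative[OF f(1) U(3,1,2)]] by blast
    then have "u x / s x = u' x / s x" by (intro Re_mult_cancel) metis
    then show ?thesis using trivializationD(2)[OF U(3,2)] by simp
  qed
  moreover have "- K \<noteq> {}" using finite_K infinite_UNIV_char_0[where 'a = complex]
    by (metis Compl_empty_eq double_complement)
  ultimately show "u x = u' x"
    using analytic_continuation_open[OF open_Compl_K open_UNIV _ connected_UNIV _ u] by blast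
qed

section \<open>Finite energy of real primitives\<close>

text \<open>Whichever trivialization the choice operator selects, only |s(x)|^2 = |D(x)|
  enters.\<close>

lemma z2_grad_norm_eq:
  assumes f: "\<And>U s. open U \<Longrightarrow> x \<in> U \<Longrightarrow> trivialization z k U s \<Longrightarrow>
      ((\<lambda>y. f (y, s y)) has_derivative (\<lambda>d. Re (v / s x * d))) (at x)" and x: "x \<notin> K"
  shows "(z2_grad_norm z k f x)\<^sup>2 = (norm v)\<^sup>2 / norm (D x)"
proof -
  define s where "s = (SOME s. \<exists>U. open U \<and> x \<in> U \<and> trivialization z k U s)"
  have "\<exists>U. open U \<and> x \<in> U \<and> trivialization z k U s"
    unfolding s_def
  proof (rule someI_ex[of "\<lambda>s. \<exists>U. open U \<and> x \<in> U \<and> trivialization z k U s"])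
    show "\<exists>s U. open U \<and> x \<in> U \<and> trivialization z k U s"
      using root_cover_local_trivialization[OF x] by blast
  qed
  then obtain U where U: "open U" "x \<in> U" "trivialization z k U s" by blast
  have "(z2_grad_norm z k f x)\<^sup>2 = (pdx (\<lambda>y. f (y, s y)) x)\<^sup>2 + (pdy (\<lambda>y. f (y, s y)) x)\<^sup>2"
    by (simp add: z2_grad_norm_def grad_norm_def flip: s_def)
  also have "\<dots> = (Re (v / s x))\<^sup>2 + (Im (v / s x))\<^sup>2"
    using pdx_eqI[OF f[OF U]] pdy_eqI[OF f[OF U]] by (simp only: mult_1_right mult.commute[of _ "\<i>"] Re_i_times power2_minus)
  also have "\<dots> = (norm (v / s x))\<^sup>2" by (simp add: cmod_power2)
  also have "\<dots> = (norm v)\<^sup>2 / norm (D x)"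
    using trivializationD(3)[OF U(3,2)] by (simp add: norm_divide power_divide flip: norm_power)
  finally show ?thesis .
qed

text \<open>Only the factor of the branch point nearest to \<open>x\<close> can be small; each of
  the other 2k - 1 factors is at least \<open>d / 2\<close>, where \<open>d\<close> bounds the
  mutual distances from below. Summing over \<open>i\<close> makes the bound independent of which
  point is nearest.\<close>

lemma inverse_norm_branch_poly_le:
  "\<exists>C>0. \<forall>x. 1 / norm (D x) \<le> C * (\<Sum>i\<in>{1..2*k}. 1 / norm (x - z i))"
proof -
  define I where "I = {1..2*k}"
  have I: "finite I" "I \<noteq> {}" using k by (auto simp: I_def)
  define A where "A = (\<lambda>(i, j). norm (z i - z j)) ` {(i, j). i \<in> I \<and> j \<in> I \<and> i \<noteq> j}"
  have "finite {(i, j). i \<in> I \<and> j \<in> I \<and> i \<noteq> j}"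
    by (rule finite_subset[of _ "I \<times> I"]) (auto simp: I_def)
  then have finA: "finite A" unfolding A_def by (rule finite_imageI)
  have posA: "a > 0" if a: "a \<in> A" for a
  proof -
    obtain i j where "a = norm (z i - z j)" "i \<in> I" "j \<in> I" "i \<noteq> j" using a by (auto simp: A_def)
    moreover from this have "z i \<noteq> z j" using inj by (metis I_def inj_onD)
    ultimately show ?thesis by simp
  qed
  define d where "d = Min (insert 1 A)"
  have d0: "d > 0" using finA posA by (simp add: d_def)
  have dle: "d \<le> norm (z i - z j)" if "i \<in> I" "j \<in> I" "i \<noteq> j" for i j
  proof -
    have "norm (z i - z j) \<in> A" using that by (auto simp: A_def)
    then show ?thesis using finA by (simp add: d_def)
  qed
  define C where "C = (2 / d) ^ (2 * k - 1)"
  have "1 / norm (D x) \<le> C * (\<Sum>i\<in>I. 1 / norm (x - z i))" for x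
  proof -
    obtain i where i: "i \<in> I" "\<And>j. j \<in> I \<Longrightarrow> norm (x - z i) \<le> norm (x - z j)"
      using arg_min_if_finite[OF I, of "\<lambda>i. norm (x - z i)"] by (metis not_le)
    have half: "d / 2 \<le> norm (x - z j)" if "j \<in> I - {i}" for j
    proof -
      have "d \<le> norm (z i - z j)" using dle i(1) that by auto
      also have "\<dots> \<le> norm (x - z j) + norm (x - z i)"
        using norm_triangle_ineq4[of "x - z j" "x - z i"] by simp
      also have "\<dots> \<le> norm (x - z j) + norm (x - z j)" using i(2) that by auto
      finally show ?thesis by simp
    qed
    have "(d / 2) ^ (2 * k - 1) = (\<Prod>j\<in>I - {i}. d / 2)" using i(1) by (simp add: I_def)
    also have "\<dots> \<le> (\<Prod>j\<in>I - {i}. norm (x - z j))" using half d0 by (intro prod_mono) auto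
    finally have "norm (x - z i) * (d / 2) ^ (2 * k - 1) \<le> norm (x - z i) * (\<Prod>j\<in>I - {i}. norm (x - z j))"
      by (intro mult_left_mono) auto
    also have "\<dots> = (\<Prod>j\<in>I. norm (x - z j))" using I(1) i(1) by (simp add: prod.remove)
    also have "\<dots> = norm (D x)" by (simp add: branch_poly_def prod_norm I_def)
    finally have le: "norm (x - z i) * (d / 2) ^ (2 * k - 1) \<le> norm (D x)" .
    have "1 / norm (D x) \<le> C * (1 / norm (x - z i))"
    proof (cases "x = z i")
      case True
      then have "D x = 0" using i(1) by (auto simp: branch_poly_eq_0_iff branch_points_def I_def)
      then show ?thesis using True by simp
    next
      case False
      then have pos: "0 < norm (x - z i) * (d / 2) ^ (2 * k - 1)" using d0 by simp
      have "1 / norm (D x) \<le> 1 / (norm (x - z i) * (d / 2) ^ (2 * k - 1))"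
        by (rule frac_le[OF _ order_refl pos le]) simp
      also have "\<dots> = C * (1 / norm (x - z i))" using d0 by (simp add: C_def power_divide field_simps)
      finally show ?thesis .
    qed
    also have "\<dots> \<le> C * (\<Sum>i\<in>I. 1 / norm (x - z i))"
      using i(1) I d0 by (intro mult_left_mono member_le_sum) (auto simp: C_def)
    finally show ?thesis .
  qed
  then show ?thesis using d0 unfolding I_def by (intro exI[of _ C]) (simp add: C_def)
qed

text \<open>For the energy, |u|^2 / |D| is dominated on a bounded set by a multiple of the sum of
  the 1 / |x - z i|, each locally integrable in the plane.\<close>

lemma re_primitive_z2_harmonic:
  assumes u: "u holomorphic_on UNIV" and f: "re_primitive u f"
  shows "restrict f (root_cover z k) \<in> z2_harmonic z k"
proof -
  define f' where "f' = restrict f (root_cover z k)"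
  have f': "f' (x, s x) = f (x, s x)" if "trivialization z k U s" "x \<in> U" for U s x
    using trivializationD(4)[OF that] by (simp add: f'_def)
  have "z2_function z k f'"
    using f by (auto simp: z2_function_def f'_def re_primitive_def root_cover_def)
  moreover have "harmonic_on (\<lambda>x. f' (x, s x)) U" if U: "open U" "trivialization z k U s" for U s
  proof (rule harmonic_on_local)
    fix x assume x: "x \<in> U"
    obtain V P where V: "open V" "x \<in> V" "V \<subseteq> U" "\<And>y. y \<in> V \<Longrightarrow> (P has_field_derivative u y / s y) (at y)"
        "\<And>y. y \<in> V \<Longrightarrow> f (y, s y) = Re (P y)"
      using re_primitive_local[OF f U(2,1) x] by blast
    have "P holomorphic_on V" using V(1,4) by (auto simp: holomorphic_on_open)
    moreover have "f' (y, s y) = Re (P y)" if "y \<in> V" for y using V(3,5) that f'[OF U(2)] by auto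
    ultimately show "\<exists>V P. open V \<and> x \<in> V \<and> P holomorphic_on V \<and> (\<forall>y\<in>V. f' (y, s y) = Re (P y))"
      using V(1,2) by blast
  qed
  moreover have "set_integrable lborel U (\<lambda>x. (z2_grad_norm z k f' x)\<^sup>2)"
    if U: "open U" "bounded U" "U \<subseteq> - K" for U
  proof -
    have gn: "(z2_grad_norm z k f' x)\<^sup>2 = (norm (u x))\<^sup>2 / norm (D x)" if "x \<in> U" for x
    proof (rule z2_grad_norm_eq)
      show "x \<notin> K" using that U by auto
      fix V s assume V: "open V" "x \<in> V" "trivialization z k V s"
      show "((\<lambda>y. f' (y, s y)) has_derivative (\<lambda>d. Re (u x / s x * d))) (at x)"
        using has_derivative_transform_within_open[OF re_primitive_has_derivative[OF f V(3,1,2)] V(1,2)]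
          f'[OF V(3)] by simp
    qed
    define \<psi> where "\<psi> = (\<lambda>x. indicator U x *\<^sub>R ((norm (u x))\<^sup>2 / norm (D x)))"
    have cu: "continuous_on UNIV u" using u by (rule holomorphic_on_imp_continuous_on)
    have "continuous_on U (\<lambda>x. (norm (u x))\<^sup>2 / norm (D x))"
      using U(3) by (intro continuous_intros continuous_on_subset[OF cu])
        (auto simp: branch_poly_eq_0_iff)
    then have "\<psi> \<in> borel_measurable borel"
      unfolding \<psi>_def by (rule borel_measurable_continuous_on_indicator[rotated]) (use U(1) in simp)
    then have meas: "\<psi> \<in> borel_measurable lborel" by simp
    obtain B where B: "B > 0" "\<And>x. x \<in> U \<Longrightarrow> norm x \<le> B" using U(2) bounded_pos by metis
    have "compact (u ` cball 0 B)"
      by (intro compact_continuous_image continuous_on_subset[OF cu]) auto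
    then obtain M where M: "M > 0" "\<And>x. norm x \<le> B \<Longrightarrow> norm (u x) \<le> M"
      using compact_imp_bounded bounded_pos by (metis imageI mem_cball_0)
    obtain C where C: "C > 0" "\<And>x. 1 / norm (D x) \<le> C * (\<Sum>i\<in>{1..2*k}. 1 / norm (x - z i))"
      using inverse_norm_branch_poly_le by blast
    define r where "r = (\<lambda>i. B + norm (z i) + 1)"
    have r: "r i > 0" for i using B by (simp add: r_def add_pos_nonneg)
    have inb: "x \<in> ball (z i) (r i)" if "x \<in> U" for x i
      using B(2)[OF that] norm_triangle_ineq4[of "z i" x] by (simp add: r_def dist_norm)
    define h where "h = (\<lambda>i x. ennreal (1 / norm (x - z i)) * indicator (ball (z i) (r i)) x)"
    have hm: "h i \<in> borel_measurable lborel" for i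
      unfolding h_def by (intro borel_measurable_times_ennreal measurable_compose[OF _ measurable_ennreal]
          borel_measurable_divide borel_measurable_norm borel_measurable_indicator) auto
    have bound: "ennreal (norm (\<psi> x)) \<le> (\<Sum>i\<in>{1..2*k}. ennreal (M\<^sup>2 * C) * h i x)" for x
    proof (cases "x \<in> U")
      case True
      have "norm (\<psi> x) = (norm (u x))\<^sup>2 * (1 / norm (D x))" using True by (simp add: \<psi>_def)
      also have "\<dots> \<le> M\<^sup>2 * (C * (\<Sum>i\<in>{1..2*k}. 1 / norm (x - z i)))"
        using M(2)[OF B(2)[OF True]] C by (intro mult_mono power_mono) auto
      also have "\<dots> = (\<Sum>i\<in>{1..2*k}. M\<^sup>2 * C * (1 / norm (x - z i)))"
        by (simp add: sum_distrib_left mult.assoc)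
      finally have "ennreal (norm (\<psi> x)) \<le> ennreal (\<Sum>i\<in>{1..2*k}. M\<^sup>2 * C * (1 / norm (x - z i)))"
        by (rule ennreal_leI)
      also have "\<dots> = (\<Sum>i\<in>{1..2*k}. ennreal (M\<^sup>2 * C * (1 / norm (x - z i))))"
        using C by (intro sum_ennreal[symmetric]) auto
      also have "\<dots> = (\<Sum>i\<in>{1..2*k}. ennreal (M\<^sup>2 * C) * h i x)"
        using inb[OF True] C by (intro sum.cong refl) (simp add: h_def ennreal_mult[symmetric])
      finally show ?thesis .
    qed (simp add: \<psi>_def)
    have "(\<integral>\<^sup>+x. ennreal (norm (\<psi> x)) \<partial>lborel) \<le> (\<integral>\<^sup>+x. (\<Sum>i\<in>{1..2*k}. ennreal (M\<^sup>2 * C) * h i x) \<partial>lborel)"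
      by (intro nn_integral_mono bound)
    also have "\<dots> = (\<Sum>i\<in>{1..2*k}. ennreal (M\<^sup>2 * C) * (\<integral>\<^sup>+x. h i x \<partial>lborel))"
      using hm by (simp add: nn_integral_sum nn_integral_cmult)
    also have "\<dots> < \<infinity>"
      using nn_integral_inverse_norm_finite[OF r]
      by (simp add: h_def ennreal_mult_less_top)
    finally have "integrable lborel \<psi>" using meas by (intro integrableI_bounded)
    moreover have "\<psi> = (\<lambda>x. indicator U x *\<^sub>R (z2_grad_norm z k f' x)\<^sup>2)"
      using gn by (auto simp: \<psi>_def fun_eq_iff split: split_indicator)
    ultimately show ?thesis by (simp add: set_integrable_def)
  qed
  ultimately show ?thesis unfolding z2_harmonic_def f'_def by blast
qed


subsection \<open>\<open>\<int>\<^sub>2\<close> harmonic functions are real primitives\<close>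

text \<open>The path lives on the cover because the one of interest is a lifted circle around a
  branch point, which ends on the other sheet.\<close>

lemma constant_along_lifted_path:
  fixes f :: "complex \<times> complex \<Rightarrow> real"
  assumes f: "\<And>U s x. open U \<Longrightarrow> U \<subseteq> N \<Longrightarrow> trivialization z k U s \<Longrightarrow> x \<in> U \<Longrightarrow>
      ((\<lambda>y. f (y, s y)) has_derivative (\<lambda>_. 0)) (at x)"
    and N: "open N" and g: "continuous_on {0..1} g" "g ` {0..1} \<subseteq> N - K"
    and s: "continuous_on {0..1} s" "\<And>t. t \<in> {0..1} \<Longrightarrow> (s t)\<^sup>2 = D (g t)"
    and t: "t \<in> {0..1::real}" "t' \<in> {0..1}"
  shows "f (g t, s t) = f (g t', s t')"
proof (rule connected_local_const[of "{0..1}" t t' "\<lambda>t. f (g t, s t)"])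
  show "\<forall>a\<in>{0..1}. \<forall>\<^sub>F b in at a within {0..1}. f (g a, s a) = f (g b, s b)"
  proof
    fix a :: real assume a: "a \<in> {0..1}"
    have ga: "g a \<in> N" "g a \<notin> K" using g(2) imageI[OF a, of g] by blast+
    obtain U r where U: "open U" "g a \<in> U" "U \<subseteq> N" "trivialization z k U r" "r (g a) = s a"
      using exists_trivialization_through[OF ga(2) s(2)[OF a] N ga(1)] by blast
    obtain e where e: "e > 0" "ball (g a) e \<subseteq> U" using openE[OF U(1,2)] by blast
    have const: "f (y, r y) = f (g a, r (g a))" if "y \<in> ball (g a) e" for y
    proof (rule has_derivative_zero_unique_connected[of "ball (g a) e" "\<lambda>y. f (y, r y)"])
      show "((\<lambda>y. f (y, r y)) has_derivative (\<lambda>_. 0)) (at x)" if "x \<in> ball (g a) e" for x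
        using U e that by (intro f[of U r]) auto
    qed (use that e in auto)
    have gt: "(g \<longlongrightarrow> g a) (at a within {0..1})" and st: "(s \<longlongrightarrow> s a) (at a within {0..1})"
      using g(1) s(1) a by (auto simp: continuous_on)
    have ev1: "\<forall>\<^sub>F b in at a within {0..1}. g b \<in> ball (g a) e"
      by (rule topological_tendstoD[OF gt]) (use e in auto)
    have "isCont r (g a)" using trivialization_isCont U by blast
    then have rt: "((\<lambda>b. r (g b)) \<longlongrightarrow> s a) (at a within {0..1})"
      using isCont_tendsto_compose[OF _ gt] U(5) by metis
    have ev0: "\<forall>\<^sub>F b in at a within {0..1}. b \<in> {0..1}" by (simp add: eventually_at_filter)
    have "\<forall>\<^sub>F b in at a within {0..1}. (r (g b))\<^sup>2 = (s b)\<^sup>2"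
      using ev0 ev1
    proof eventually_elim
      case (elim b)
      then have "g b \<in> U" using e by auto
      then show ?case using trivializationD(3)[OF U(4)] s(2)[OF elim(1)] by simp
    qed
    moreover have "s a \<noteq> 0" using trivializationD(2)[OF U(4,2)] U(5) by simp
    ultimately have "\<forall>\<^sub>F b in at a within {0..1}. r (g b) = s b"
      by (intro eventually_eq_of_power2_eq[OF rt st])
    with ev1 show "\<forall>\<^sub>F b in at a within {0..1}. f (g a, s a) = f (g b, s b)"
      by eventually_elim (use const U(5) in metis)
  qed
qed (use t in auto)

lemma z2_harmonic_gradient:
  assumes f: "f \<in> z2_harmonic z k"
  shows "\<exists>v. v holomorphic_on - K \<and> (\<forall>U s x. open U \<longrightarrow> x \<in> U \<longrightarrow> trivialization z k U s \<longrightarrow>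
      ((\<lambda>y. f (y, s y)) has_derivative (\<lambda>d. Re (v x / s x * d))) (at x))"
proof -
  define c where "c = (\<lambda>s x. Complex (pdx (\<lambda>y. f (y, s y)) x) (- pdy (\<lambda>y. f (y, s y)) x))"
  have odd: "f (x, - w) = - f (x, w)" if "(x, w) \<in> root_cover z k" for x w
    using f that by (auto simp: z2_harmonic_def z2_function_def)
  have harm: "harmonic_on (\<lambda>x. f (x, s x)) U" if "open U" "trivialization z k U s" for U s
    using f that by (auto simp: z2_harmonic_def)
  have der: "((\<lambda>y. f (y, s y)) has_derivative (\<lambda>d. Re (c s x * d))) (at x)"
    if "open U" "trivialization z k U s" "x \<in> U" for U s x
    unfolding c_def by (rule harmonic_on_has_derivative[OF that(1) harm[OF that(1,2)] that(3)])
  have hol: "c s holomorphic_on U" if "open U" "trivialization z k U s" for U s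
    unfolding c_def by (rule harmonic_on_gradient_holomorphic[OF that(1) harm[OF that]])
  have indep: "s x * c s x = s' x * c s' x"
    if U: "open U" "x \<in> U" "trivialization z k U s" and V: "open V" "x \<in> V" "trivialization z k V s'" for U V s s' x
  proof -
    have "(s x)\<^sup>2 = (s' x)\<^sup>2" using trivializationD(3) U V by metis
    then have "s x = s' x \<or> s x = - s' x" by (rule power2_eq_iff[THEN iffD1])
    then obtain e :: real where e: "e = 1 \<or> e = -1" "s x = of_real e * s' x"
      by (metis mult_1 mult_minus1 of_real_1 of_real_minus)
    have lim: "(s \<longlongrightarrow> s x) (nhds x)" "(s' \<longlongrightarrow> s' x) (nhds x)"
      using trivialization_isCont U V unfolding isCont_def tendsto_at_iff_tendsto_nhds by blast+
    have "\<forall>\<^sub>F y in nhds x. s y = of_real e * s' y"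
    proof (rule eventually_eq_of_power2_eq[OF lim(1)])
      show "((\<lambda>y. of_real e * s' y) \<longlongrightarrow> s x) (nhds x)"
        unfolding e(2) by (intro tendsto_mult_left lim(2))
      show "s x \<noteq> 0" using trivializationD(2)[OF U(3,2)] .
      show "\<forall>\<^sub>F y in nhds x. (s y)\<^sup>2 = (of_real e * s' y)\<^sup>2"
        using eventually_nhds_in_open[OF U(1,2)] eventually_nhds_in_open[OF V(1,2)]
        by eventually_elim (use e(1) trivializationD(3)[OF U(3)] trivializationD(3)[OF V(3)] in \<open>auto simp: power_mult_distrib\<close>)
    qed
    then have "\<forall>\<^sub>F y in nhds x. y \<in> V \<and> s y = of_real e * s' y"
      using eventually_nhds_in_open[OF V(1,2)] by eventually_elim simp
    then obtain W where W: "open W" "x \<in> W" "\<And>y. y \<in> W \<Longrightarrow> y \<in> V \<and> s y = of_real e * s' y"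
      unfolding eventually_nhds by blast
    have eq: "e * f (y, s' y) = f (y, s y)" if "y \<in> W" for y
      using W(3)[OF that] e(1) odd trivializationD(4)[OF V(3)] by auto
    have "((\<lambda>y. e * f (y, s' y)) has_derivative (\<lambda>d. e * Re (c s' x * d))) (at x)"
      by (rule has_derivative_mult_right[OF der[OF V(1,3,2)]])
    then have "((\<lambda>y. f (y, s y)) has_derivative (\<lambda>d. e * Re (c s' x * d))) (at x)"
      by (rule has_derivative_transform_within_open[OF _ W(1,2) eq])
    then have "(\<lambda>d. Re (c s x * d)) = (\<lambda>d. e * Re (c s' x * d))"
      by (rule has_derivative_unique[OF der[OF U(1,3,2)]])
    then have "Re (c s x * d) = e * Re (c s' x * d)" for d by (rule fun_cong)
    then have "Re (c s x * d) = Re (of_real e * c s' x * d)" for d using e(1) by auto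
    then have "c s x = of_real e * c s' x" by (rule Re_mult_cancel)
    then show ?thesis using e by auto
  qed
  define v where "v = (\<lambda>x. let s = (SOME s. \<exists>U. open U \<and> x \<in> U \<and> trivialization z k U s) in s x * c s x)"
  have v: "v x = s x * c s x" if U: "open U" "x \<in> U" "trivialization z k U s" for U s x
  proof -
    define s' where "s' = (SOME s. \<exists>U. open U \<and> x \<in> U \<and> trivialization z k U s)"
    have "\<exists>V. open V \<and> x \<in> V \<and> trivialization z k V s'"
      unfolding s'_def
      by (rule someI_ex[of "\<lambda>s. \<exists>V. open V \<and> x \<in> V \<and> trivialization z k V s"], rule exI[of _ s], rule exI[of _ U])
        (simp add: U)
    then obtain V where V: "open V" "x \<in> V" "trivialization z k V s'" by blast
    have "v x = s' x * c s' x" by (simp add: v_def Let_def flip: s'_def)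
    then show ?thesis using indep[OF V U] by simp
  qed
  have "v holomorphic_on - K"
    unfolding holomorphic_on_open[OF open_Compl_K]
  proof
    fix x assume "x \<in> - K"
    then obtain U s where U: "open U" "x \<in> U" "trivialization z k U s"
      using root_cover_local_trivialization[of x z k] by auto
    have "(\<lambda>x. s x * c s x) holomorphic_on U"
      by (intro holomorphic_intros hol trivialization_holomorphic U)
    then have "v holomorphic_on U"
      by (rule holomorphic_transform) (use v[OF U(1) _ U(3)] in simp)
    then show "\<exists>f'. (v has_field_derivative f') (at x)" using U by (auto simp: holomorphic_on_open)
  qed
  moreover have "((\<lambda>y. f (y, s y)) has_derivative (\<lambda>d. Re (v x / s x * d))) (at x)"
    if U: "open U" "x \<in> U" "trivialization z k U s" for U s x
    using der[OF U(1,3,2)] v[OF U] trivializationD(2)[OF U(3,2)] by simp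
  ultimately show ?thesis by blast
qed

text \<open>Near \<open>z i\<close> the product of the other factors of \<open>D\<close> is bounded
  by \<open>Q\<close>, so 1 / |x - z i| is at most Q / |D|.\<close>

lemma weighted_L2_branch_point:
  assumes v: "v holomorphic_on - K" and i: "i \<in> {1..2*k}" and r: "r > 0" "cball (z i) r \<inter> K = {z i}"
    and int: "set_integrable lborel (ball (z i) r - {z i}) (\<lambda>x. (norm (v x))\<^sup>2 / norm (D x))"
  shows "\<exists>g. g holomorphic_on ball (z i) r \<and> (\<forall>x\<in>ball (z i) r - {z i}. g x = v x)"
proof (rule removable_singularity_weighted_L2[OF _ r(1)])
  define S where "S = ball (z i) r - {z i}"
  have "ball (z i) r \<subseteq> cball (z i) r" by auto
  then have S: "S \<subseteq> - K" unfolding S_def using r(2) by blast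
  show "v holomorphic_on ball (z i) r - {z i}" using holomorphic_on_subset[OF v S] by (simp add: S_def)
  define q where "q = (\<lambda>x. \<Prod>j\<in>{1..2*k} - {i}. x - z j)"
  have D: "D x = (x - z i) * q x" for x
    unfolding branch_poly_def q_def using i by (simp add: prod.remove)
  have "continuous_on (cball (z i) r) q" unfolding q_def by (intro continuous_intros)
  then have "compact (q ` cball (z i) r)" by (intro compact_continuous_image) auto
  then obtain Q where Q: "Q > 0" "\<And>x. x \<in> cball (z i) r \<Longrightarrow> norm (q x) \<le> Q"
    using compact_imp_bounded bounded_pos by (metis imageI)
  define F where "F = (\<lambda>x. indicator S x *\<^sub>R ((norm (v x))\<^sup>2 / norm (D x)))"
  have "integrable lborel F" using int by (simp add: set_integrable_def F_def S_def)
  then have F: "(\<lambda>x. ennreal (norm (F x))) \<in> borel_measurable lborel" "(\<integral>\<^sup>+x. ennreal (norm (F x)) \<partial>lborel) < \<infinity>"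
    by (auto simp: integrable_iff_bounded)
  have "(\<integral>\<^sup>+x. ennreal ((norm (v x))\<^sup>2 / norm (x - z i)) * indicator S x \<partial>lborel)
      \<le> (\<integral>\<^sup>+x. ennreal Q * ennreal (norm (F x)) \<partial>lborel)"
  proof (rule nn_integral_mono)
    fix x
    show "ennreal ((norm (v x))\<^sup>2 / norm (x - z i)) * indicator S x \<le> ennreal Q * ennreal (norm (F x))"
    proof (cases "x \<in> S")
      case True
      then have x: "x \<noteq> z i" "norm (q x) \<le> Q" "D x \<noteq> 0"
        using Q(2)[of x] S by (auto simp: S_def branch_poly_eq_0_iff)
      then have "q x \<noteq> 0" by (auto simp: D)
      have "(norm (v x))\<^sup>2 / norm (x - z i) = norm (q x) * ((norm (v x))\<^sup>2 / norm (D x))"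
        using \<open>q x \<noteq> 0\<close> by (simp add: D norm_mult)
      also have "\<dots> \<le> Q * ((norm (v x))\<^sup>2 / norm (D x))"
        using x(2) by (intro mult_right_mono) auto
      also have "\<dots> = Q * norm (F x)" using True by (simp add: F_def)
      finally have "ennreal ((norm (v x))\<^sup>2 / norm (x - z i)) \<le> ennreal (Q * norm (F x))"
        by (rule ennreal_leI)
      then show ?thesis using True Q(1) by (simp add: ennreal_mult)
    qed simp
  qed
  also have "\<dots> = ennreal Q * (\<integral>\<^sup>+x. ennreal (norm (F x)) \<partial>lborel)"
    by (rule nn_integral_cmult[OF F(1)])
  also have "\<dots> < \<infinity>" using F(2) by (simp add: ennreal_mult_less_top)
  finally show "(\<integral>\<^sup>+x. ennreal ((norm (v x))\<^sup>2 / norm (x - z i)) * indicator (ball (z i) r - {z i}) x \<partial>lborel) < \<infinity>"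
    by (simp add: S_def)
qed

lemma z2_harmonic_imp_re_primitive:
  assumes f: "f \<in> z2_harmonic z k"
  shows "\<exists>u f'. u holomorphic_on UNIV \<and> re_primitive u f' \<and> f = restrict f' (root_cover z k)"
proof -
  obtain v where v: "v holomorphic_on - K"
    and der: "\<And>U s x. open U \<Longrightarrow> x \<in> U \<Longrightarrow> trivialization z k U s \<Longrightarrow>
      ((\<lambda>y. f (y, s y)) has_derivative (\<lambda>d. Re (v x / s x * d))) (at x)"
    using z2_harmonic_gradient[OF f] by blast
  have odd: "f (x, - w) = - f (x, w)" if "(x, w) \<in> root_cover z k" for x w
    using f that by (auto simp: z2_harmonic_def z2_function_def)
  have ext: "f \<in> extensional (root_cover z k)" using f by (auto simp: z2_harmonic_def z2_function_def)
  have "\<exists>r g. r > 0 \<and> ball c r \<inter> K = {c} \<and> g holomorphic_on ball c r \<and> (\<forall>x\<in>ball c r - {c}. g x = v x)"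
    if c: "c \<in> K" for c
  proof -
    obtain i where i: "i \<in> {1..2*k}" "c = z i" using c by (auto simp: branch_points_def)
    obtain r where r: "r > 0" "ball (z i) r \<inter> K = {z i}" "cball (z i) r \<inter> K = {z i}"
      using exists_branch_neighbourhood[OF i(1)] by blast
    define S where "S = ball (z i) r - {z i}"
    have S: "open S" "bounded S" "S \<subseteq> - K" using r(2) by (auto simp: S_def bounded_diff)
    then have "set_integrable lborel S (\<lambda>x. (z2_grad_norm z k f x)\<^sup>2)"
      using f by (auto simp: z2_harmonic_def)
    moreover have "(z2_grad_norm z k f x)\<^sup>2 = (norm (v x))\<^sup>2 / norm (D x)" if "x \<in> S" for x
      by (rule z2_grad_norm_eq[OF der]) (use that S in auto)
    ultimately have "set_integrable lborel S (\<lambda>x. (norm (v x))\<^sup>2 / norm (D x))"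
      using set_integrable_cong[of lborel lborel S S "\<lambda>x. (z2_grad_norm z k f x)\<^sup>2"] by simp
    then show ?thesis
      using weighted_L2_branch_point[OF v i(1) r(1,3)] r i(2) unfolding S_def by blast
  qed
  then obtain r g where rg: "\<And>c. c \<in> K \<Longrightarrow> r c > 0" "\<And>c. c \<in> K \<Longrightarrow> ball c (r c) \<inter> K = {c}"
      "\<And>c. c \<in> K \<Longrightarrow> g c holomorphic_on ball c (r c)"
      "\<And>c x. c \<in> K \<Longrightarrow> x \<in> ball c (r c) - {c} \<Longrightarrow> g c x = v x"
    by metis
  define u where "u = (\<lambda>x. if x \<in> K then g x x else v x)"
  have uv: "u x = v x" if "x \<notin> K" for x using that by (simp add: u_def)
  have u: "u holomorphic_on UNIV"
    unfolding holomorphic_on_open[OF open_UNIV]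
  proof
    fix x :: complex
    show "\<exists>f'. (u has_field_derivative f') (at x)"
    proof (cases "x \<in> K")
      case True
      have "u holomorphic_on ball x (r x)"
      proof (rule holomorphic_transform[OF rg(3)[OF True]])
        fix y assume "y \<in> ball x (r x)"
        then show "g x y = u y"
          using rg(2,4)[OF True] True by (cases "y = x") (auto simp: u_def)
      qed
      then show ?thesis using rg(1)[OF True] by (auto simp: holomorphic_on_open)
    next
      case False
      have "u holomorphic_on - K" by (rule holomorphic_transform[OF v]) (simp add: u_def)
      then show ?thesis using False open_Compl_K by (auto simp: holomorphic_on_open)
    qed
  qed
  have der': "((\<lambda>y. f (y, s y)) has_derivative (\<lambda>d. Re (u x / s x * d))) (at x)"
    if "open U" "x \<in> U" "trivialization z k U s" for U s x
    using der[OF that] uv trivializationD(1)[OF that(3,2)] by simp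
  \<comment> \<open>On the cover w = 0 occurs only over branch points; there \<open>f\<close> is
    extended by 0.\<close>
  define f' where "f' = (\<lambda>(x, w). if w = 0 then 0 else f (x, w))"
  have f': "f' (x, w) = f (x, w)" if "w\<^sup>2 = D x" "x \<notin> K" for x w
    using that branch_poly_eq_0_iff[of z k x] by (auto simp: f'_def)
  have "re_primitive u f'"
    unfolding re_primitive_def
  proof (intro conjI allI impI)
    show "f' (x, - w) = - f' (x, w)" if "w\<^sup>2 = D x" for x w
      using that odd[of x w] branch_poly_eq_0_iff[of z k x] by (auto simp: f'_def root_cover_def)
    fix x
    show "\<exists>N G. x \<in> N \<and> is_primitive u N G \<and> (\<forall>q\<in>cover N. f' q = Re (G q))"
    proof (cases "x \<in> K")
      case False
      obtain U s where U: "open U" "x \<in> U" "trivialization z k U s"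
        using root_cover_local_trivialization[OF False] by blast
      obtain e where e: "e > 0" "ball x e \<subseteq> U" using openE[OF U(1,2)] by blast
      have t: "trivialization z k (ball x e) s" by (rule trivialization_subset[OF U(3) e(2)])
      have hol: "(\<lambda>x. u x / s x) holomorphic_on ball x e"
        using trivialization_holomorphic[OF t] trivializationD(2)[OF t]
        by (intro holomorphic_intros holomorphic_on_subset[OF u]) auto
      then obtain \<Phi> where \<Phi>: "\<And>y. y \<in> ball x e \<Longrightarrow> (\<Phi> has_field_derivative u y / s y) (at y)"
        using holomorphic_convex_primitive'[OF convex_ball open_ball hol] at_within_open[OF _ open_ball]
        by (metis (no_types, lifting))
      define c where "c = f (x, s x) - Re (\<Phi> x)"
      have fc: "f (y, s y) = Re (\<Phi> y + of_real c)" if y: "y \<in> ball x e" for y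
      proof -
        have "f (y, s y) - Re (\<Phi> y) = f (x, s x) - Re (\<Phi> x)"
        proof (rule has_derivative_zero_unique_connected[of "ball x e" "\<lambda>y. f (y, s y) - Re (\<Phi> y)"])
          show "((\<lambda>y. f (y, s y) - Re (\<Phi> y)) has_derivative (\<lambda>_. 0)) (at y)" if "y \<in> ball x e" for y
            using has_derivative_diff[OF der'[OF open_ball that t] has_derivative_Re_holomorphic[OF \<Phi>[OF that]]]
            by simp
        qed (use y e in auto)
        then show ?thesis by (simp add: c_def)
      qed
      have "is_primitive u (ball x e) (\<lambda>(y, w). w / s y * (\<Phi> y + of_real c))"
        by (rule is_primitive_regular[OF open_ball t]) (use \<Phi> in \<open>auto intro!: derivative_eq_intros\<close>)
      moreover have "\<forall>q\<in>cover (ball x e). f' q = Re (case q of (y, w) \<Rightarrow> w / s y * (\<Phi> y + of_real c))"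
      proof
        fix q assume "q \<in> cover (ball x e)"
        then obtain y w where q: "q = (y, w)" "y \<in> ball x e" "w\<^sup>2 = D y" by (auto simp: cover_def)
        note y = trivializationD[OF t q(2)]
        have "w\<^sup>2 = (s y)\<^sup>2" using q(3) y(3) by simp
        then have "w = s y \<or> w = - s y" by (rule power2_eq_iff[THEN iffD1])
        then show "f' q = Re (case q of (y, w) \<Rightarrow> w / s y * (\<Phi> y + of_real c))"
          using f'[OF q(3) y(1)] fc[OF q(2)] odd[OF y(4)] y(2) by (auto simp: q(1))
      qed
      ultimately show ?thesis using e(1) centre_in_ball by blast
    next
      case True
      then obtain i where i: "i \<in> {1..2*k}" "x = z i" by (auto simp: branch_points_def)
      obtain r where r: "r > 0" "ball (z i) r \<inter> K = {z i}" "cball (z i) r \<inter> K = {z i}"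
        using exists_branch_neighbourhood[OF i(1)] by blast
      obtain G where G: "is_primitive u (ball (z i) r) G" "\<And>x w. G (x, - w) = - G (x, w)" "G (z i, 0) = 0"
        using is_primitive_branch_point[OF i(1) open_ball convex_ball r(2) u] by blast
      have "f' (y, w) = Re (G (y, w))" if y: "y \<in> ball (z i) r" "w\<^sup>2 = D y" for y w
      proof (cases "y = z i")
        case True
        then show ?thesis using branch_root_0[of w i] i(1) y G(3) by (simp add: f'_def)
      next
        case False
        \<comment> \<open>On the circle around \<open>z i\<close> through \<open>y\<close>, the
          difference \<open>h\<close> of \<open>f\<close> and Re G is constant along a lift, whose
          ends are the two points over one point of the circle. Oddness makes the values at the ends
          opposite, so \<open>h\<close> is 0.\<close>
        define \<rho> where "\<rho> = norm (y - z i)"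
        have \<rho>: "\<rho> > 0" "\<rho> < r" using False y(1) by (auto simp: \<rho>_def dist_norm norm_minus_commute)
        define g where "g = circlepath (z i) \<rho>"
        have gN: "g ` {0..1} \<subseteq> ball (z i) r - K"
        proof -
          have "g ` {0..1} \<subseteq> sphere (z i) \<rho>"
            using \<rho> path_image_circlepath_nonneg[of \<rho> "z i"] by (simp add: g_def path_image_def)
          moreover have "sphere (z i) \<rho> \<subseteq> ball (z i) r - {z i}" using \<rho> by auto
          ultimately show ?thesis using r(2) by blast
        qed
        have gc: "continuous_on {0..1} g"
          using valid_path_imp_path[OF valid_path_circlepath] by (simp add: g_def path_def)
        have g01: "g 1 = g 0" by (simp add: g_def circlepath)
        obtain s where s: "continuous_on {0..1} s" "\<forall>t\<in>{0..1}. (s t)\<^sup>2 = D (g t)"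
        proof -
          have "g ` {0<..<1} \<subseteq> g ` {0..1}" by (intro image_mono) auto
          then have "g ` {0<..<1} \<subseteq> - K" using gN by blast
          from exists_root_along_path[OF gc this power2_csqrt] show ?thesis using that by blast
        qed
        have mono: "s 1 = - s 0"
        proof (rule root_cover_monodromy[OF inj i(1) \<rho>(1)])
          have "cball (z i) \<rho> \<subseteq> cball (z i) r" "z i \<in> cball (z i) \<rho>" using \<rho> by auto
          then show "cball (z i) \<rho> \<inter> K = {z i}" using r(3) by blast
        qed (use s in \<open>auto simp: g_def\<close>)
        define h where "h = (\<lambda>q. f q - Re (G q))"
        have hc: "h (g t, s t) = h (g t', s t')" if "t \<in> {0..1}" "t' \<in> {0..1}" for t t'
        proof (rule constant_along_lifted_path[OF _ open_ball gc gN s(1) _ that])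
          fix U s x assume U: "open U" "U \<subseteq> ball (z i) r" "trivialization z k U s" "x \<in> U"
          show "((\<lambda>y. h (y, s y)) has_derivative (\<lambda>_. 0)) (at x)"
            using has_derivative_diff[OF der'[OF U(1,4,3)] has_derivative_Re_holomorphic[OF is_primitiveD(3)[OF G(1) U]]]
            by (simp add: h_def)
        qed (use s(2) in auto)
        have rc: "(g t, s t) \<in> root_cover z k" if "t \<in> {0..1}" for t
        proof -
          have "g t \<notin> K" using gN imageI[OF that, of g] by blast
          then show ?thesis using s(2) that by (simp add: root_cover_def)
        qed
        have hodd: "h (a, - b) = - h (a, b)" if "(a, b) \<in> root_cover z k" for a b
          using odd[OF that] G(2) by (simp add: h_def)
        have "h (g 1, s 1) = - h (g 0, s 0)" using hodd[OF rc[of 0]] by (simp add: g01 mono)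
        then have h0: "h (g t, s t) = 0" if "t \<in> {0..1}" for t
          using hc[of 0 1] hc[OF that, of 0] by auto
        have "y \<in> path_image g"
          using \<rho> by (simp add: g_def path_image_circlepath_nonneg \<rho>_def dist_norm norm_minus_commute)
        then obtain t where t: "t \<in> {0..1}" "y = g t" by (auto simp: path_image_def)
        have "w\<^sup>2 = (s t)\<^sup>2" using y(2) s(2) t by simp
        then have "w = s t \<or> w = - s t" by (rule power2_eq_iff[THEN iffD1])
        then have "h (y, w) = 0" using h0[OF t(1)] hodd[OF rc[OF t(1)]] t(2) by auto
        moreover have "y \<notin> K" using False r(2) y(1) by blast
        ultimately show ?thesis using f'[OF y(2)] by (simp add: h_def)
      qed
      then have "\<forall>q\<in>cover (ball (z i) r). f' q = Re (G q)" by (auto simp: cover_def)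
      then show ?thesis using G(1) r(1) i(2) centre_in_ball by blast
    qed
  qed
  moreover have "f = restrict f' (root_cover z k)"
  proof
    fix q
    show "f q = restrict f' (root_cover z k) q"
      using ext f' by (cases q; cases "q \<in> root_cover z k") (auto simp: extensional_def root_cover_def)
  qed
  ultimately show ?thesis using u by blast
qed


subsection \<open>Bounded real primitives vanish\<close>

text \<open>The absolute value descends to the plane. \<open>csqrt\<close> serves as an arbitrary
  root, whose jump disappears in the absolute value.\<close>

lemma abs_re_primitive:
  assumes "re_primitive u f" "w\<^sup>2 = D x"
  shows "\<bar>f (x, w)\<bar> = \<bar>f (x, csqrt (D x))\<bar>"
proof -
  have "w\<^sup>2 = (csqrt (D x))\<^sup>2" using assms(2) by simp
  then have "w = csqrt (D x) \<or> w = - csqrt (D x)" by (rule power2_eq_iff[THEN iffD1])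
  moreover have "f (x, - csqrt (D x)) = - f (x, csqrt (D x))"
    using assms(1) power2_csqrt unfolding re_primitive_def by blast
  ultimately show ?thesis by auto
qed

text \<open>At a branch point both roots tend to 0, and continuity of the primitive on the cover
  takes over from the trivializations.\<close>

lemma continuous_abs_re_primitive:
  assumes f: "re_primitive u f"
  shows "isCont (\<lambda>x. \<bar>f (x, csqrt (D x))\<bar>) x"
proof (cases "x \<in> K")
  case False
  then obtain U s where U: "open U" "x \<in> U" "trivialization z k U s"
    using root_cover_local_trivialization by blast
  have "isCont (\<lambda>y. f (y, s y)) x"
    using re_primitive_has_derivative[OF f U(3,1,2)] has_derivative_continuous by blast
  then have "isCont (\<lambda>y. \<bar>f (y, s y)\<bar>) x" by (rule isCont_rabs)
  moreover have "\<forall>\<^sub>F y in nhds x. \<bar>f (y, s y)\<bar> = \<bar>f (y, csqrt (D y))\<bar>"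
    using eventually_nhds_in_open[OF U(1,2)]
    by eventually_elim (rule abs_re_primitive[OF f trivializationD(3)[OF U(3)]])
  ultimately show ?thesis by (subst (asm) isCont_cong)
next
  case True
  obtain N G where N: "x \<in> N" "is_primitive u N G" "\<And>q. q \<in> cover N \<Longrightarrow> f q = Re (G q)"
    using f unfolding re_primitive_def by blast
  have D0: "D x = 0" using True by (simp add: branch_poly_eq_0_iff)
  have "isCont D x" using continuous_on_branch_poly[of UNIV "\<lambda>x. x" z k] by (simp add: continuous_on_eq_continuous_at)
  then have "(D \<longlongrightarrow> 0) (at x)" by (simp add: isCont_def D0)
  then have "((\<lambda>y. sqrt (norm (D y))) \<longlongrightarrow> sqrt (norm (0::complex))) (at x)" by (intro tendsto_intros)
  then have "((\<lambda>y. csqrt (D y)) \<longlongrightarrow> 0) (at x)"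
    by (subst tendsto_norm_zero_iff[symmetric]) simp
  then have p: "((\<lambda>y. (y, csqrt (D y))) \<longlongrightarrow> (x, 0)) (at x)" by (intro tendsto_intros)
  have "\<forall>\<^sub>F y in at x. y \<in> N"
    using is_primitiveD(1)[OF N(2)] N(1) eventually_at_topological by blast
  then have ev: "\<forall>\<^sub>F y in at x. (y, csqrt (D y)) \<in> cover N"
    by eventually_elim (simp add: cover_def)
  have x0: "(x, 0) \<in> cover N" using N(1) D0 by (simp add: cover_def)
  have "((\<lambda>y. G (y, csqrt (D y))) \<longlongrightarrow> G (x, 0)) (at x)"
    by (rule continuous_on_tendsto_compose[OF is_primitiveD(2)[OF N(2)] p x0 ev])
  then have "((\<lambda>y. \<bar>Re (G (y, csqrt (D y)))\<bar>) \<longlongrightarrow> \<bar>Re (G (x, 0))\<bar>) (at x)" by (intro tendsto_intros)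
  moreover have "\<forall>\<^sub>F y in at x. \<bar>Re (G (y, csqrt (D y)))\<bar> = \<bar>f (y, csqrt (D y))\<bar>"
    using ev by eventually_elim (simp add: N(3))
  ultimately have "((\<lambda>y. \<bar>f (y, csqrt (D y))\<bar>) \<longlongrightarrow> \<bar>Re (G (x, 0))\<bar>) (at x)"
    by (rule Lim_transform_eventually)
  then show ?thesis using N(3)[OF x0] by (simp add: isCont_def D0)
qed

text \<open>Maximum principle on \<open>\<bar>x - z 1\<bar> \<ge> \<delta>\<close> for the subharmonic function
  \<open>n \<bar>f\<bar> - ln (\<bar>x - z 1\<bar> / \<delta>)\<close>, which is locally \<open>ln \<bar>exp (n P) \<delta> / (x - z 1)\<bar>\<close> with \<open>P\<close>
  holomorphic where \<open>f \<noteq> 0\<close>, and tends to \<open>-\<infinity>\<close> at infinity since \<open>f\<close> is bounded.  As \<open>f\<close>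
  vanishes at \<open>z 1\<close>, letting \<open>n \<rightarrow> \<infinity>\<close> and \<open>\<delta> \<rightarrow> 0\<close> gives \<open>f = 0\<close>.\<close>

lemma bounded_re_primitive_eq_0:
  assumes f: "re_primitive u f" and B: "\<And>q. q \<in> root_cover z k \<Longrightarrow> \<bar>f q\<bar> \<le> B"
    and q: "q \<in> root_cover z k"
  shows "f q = 0"
proof -
  define A where "A = (\<lambda>x. \<bar>f (x, csqrt (D x))\<bar>)"
  have A0: "A x \<ge> 0" for x by (simp add: A_def)
  have Ac: "isCont A x" for x unfolding A_def by (rule continuous_abs_re_primitive[OF f])
  have AK: "A x = 0" if x: "x \<in> K" for x
  proof -
    obtain i where "i \<in> {1..2*k}" "x = z i" using x by (auto simp: branch_points_def)
    moreover have "D x = 0" using x by (simp add: branch_poly_eq_0_iff)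
    ultimately show ?thesis using re_primitive_branch_point[OF f, of i] by (simp add: A_def)
  qed
  have AB: "A x \<le> max B 0" for x
  proof (cases "x \<in> K")
    case False
    then show ?thesis using B[of "(x, csqrt (D x))"] by (simp add: A_def root_cover_def)
  qed (simp add: AK)
  define c where "c = z 1"
  have cK: "c \<in> K" using z1_in_K by (simp add: c_def)
  have le: "A y \<le> \<eta>" if \<eta>: "\<eta> > 0" and yc: "y \<noteq> c" for y \<eta>
  proof (rule ccontr)
    assume "\<not> A y \<le> \<eta>"
    then have gt: "A y > \<eta>" by simp
    obtain d0 where d0: "d0 > 0" "\<And>x. norm (x - c) < d0 \<Longrightarrow> A x < \<eta>"
      using Ac[of c] \<eta> AK[OF cK] A0 unfolding continuous_at_eps_delta by (fastforce simp: dist_norm)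
    define d where "d = min (d0 / 2) (norm (y - c))"
    have d: "d > 0" "d \<le> norm (y - c)" "d < d0" using d0(1) yc by (auto simp: d_def)
    define L where "L = ln (norm (y - c) / d)"
    \<comment> \<open>\<open>n\<close> is so large that b(y) > n \<eta>, while b \<le> n \<eta> on
      the circle |x - c| = d; so the maximum is not on the inner boundary.\<close>
    obtain n :: nat where n: "L / (A y - \<eta>) < real n" using reals_Archimedean2 by blast
    have L0: "L \<ge> 0" using d by (simp add: L_def)
    have npos: "real n > 0" using n L0 gt by (smt (verit) divide_nonneg_pos)
    have nL: "L < n * (A y - \<eta>)" using n gt by (simp add: pos_divide_less_eq)
    define b where "b = (\<lambda>x. n * A x - ln (norm (x - c) / d))"
    have bc: "isCont b x" if "x \<noteq> c" for x
      unfolding b_def using that d by (intro continuous_intros Ac) auto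
    have by_gt: "b y > n * \<eta>" using nL by (simp add: b_def L_def algebra_simps)
    \<comment> \<open>From this radius on, the logarithm outweighs the bound for n |f|, and b \<le>
      b(y).\<close>
    define R where "R = max (norm (y - c)) (d * exp (n * max B 0 - b y))"
    have far: "b x \<le> b y" if "norm (x - c) \<ge> R" for x
    proof -
      have "exp (n * max B 0 - b y) \<le> norm (x - c) / d" using that d by (simp add: R_def field_simps)
      then have "n * max B 0 - b y \<le> ln (norm (x - c) / d)"
        using d by (subst ln_ge_iff) (auto intro: less_le_trans[OF exp_gt_zero])
      moreover have "n * A x \<le> n * max B 0" using AB npos by (intro mult_left_mono) auto
      ultimately show ?thesis by (simp add: b_def)
    qed
    define W where "W = cball c R - ball c d"
    have "compact W" unfolding W_def by (intro compact_diff) auto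
    moreover have yW: "y \<in> W" using d by (auto simp: W_def R_def dist_norm norm_minus_commute)
    moreover have "continuous_on W b"
    proof (intro continuous_at_imp_continuous_on ballI bc notI)
      show False if "x \<in> W" "x = c" for x using that d by (simp add: W_def)
    qed
    ultimately obtain x1 where x1: "x1 \<in> W" "\<And>x. x \<in> W \<Longrightarrow> b x \<le> b x1"
      using continuous_attains_sup[of W b] by blast
    have max: "b x \<le> b x1" if "norm (x - c) \<ge> d" for x
    proof (cases "norm (x - c) \<le> R")
      case True
      then show ?thesis using that by (intro x1) (auto simp: W_def dist_norm norm_minus_commute)
    next
      case False
      then show ?thesis using far[of x] x1(2)[OF yW] by simp
    qed
    have b1: "b x1 > n * \<eta>" using by_gt x1(2)[OF yW] by simp
    define S where "S = {x. norm (x - c) > d \<and> b x = b x1}"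
    have sph: "b x < b x1" if "norm (x - c) = d" for x
    proof -
      have "b x = n * A x" using that d by (simp add: b_def)
      also have "\<dots> \<le> n * \<eta>" using d0(2)[of x] that d npos by (intro mult_left_mono) auto
      finally show ?thesis using b1 by simp
    qed
    \<comment> \<open>Since the maximum is not attained on |x - c| = d, the strict inequality in
      \<open>S\<close> may be replaced by the weak one. The weak form gives closedness, the strict
      form openness.\<close>
    have S_eq: "S = {x \<in> - ball c d. b x = b x1}"
      using sph by (auto simp: S_def dist_norm norm_minus_commute less_le not_less)
    have "closed S"
      unfolding S_eq
    proof (intro continuous_closed_preimage_constant continuous_at_imp_continuous_on ballI bc notI)
      show False if "x \<in> - ball c d" "x = c" for x using that d by simp
    qed auto
    moreover have "open S"
      unfolding open_contains_ball
    proof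
      fix x assume x: "x \<in> S"
      \<comment> \<open>A zero of f outside the disc would give b \<le> 0, below the maximum; so |f|
        is near \<open>x\<close> the real part of a holomorphic function.\<close>
      have "A x > 0"
      proof (rule ccontr)
        assume "\<not> A x > 0"
        then have "b x = - ln (norm (x - c) / d)" using A0[of x] by (simp add: b_def)
        also have "\<dots> \<le> 0" using x d by (simp add: S_def)
        finally have "b x1 \<le> 0" using x by (simp add: S_def)
        moreover have "n * \<eta> > 0" using npos \<eta> by (rule mult_pos_pos)
        ultimately show False using b1 by linarith
      qed
      then have xK: "x \<notin> K" using AK[of x] by auto
      obtain U s where U: "open U" "x \<in> U" "trivialization z k U s" "s x = csqrt (D x)"
        using exists_trivialization_through[OF xK power2_csqrt open_UNIV] by blast
      define e where "e = sgn (f (x, s x))"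
      have e: "e = 1 \<or> e = -1" "e * f (x, s x) = A x"
        using \<open>A x > 0\<close> by (auto simp: e_def A_def U(4) sgn_if)
      obtain V P where V: "open V" "x \<in> V" "V \<subseteq> U" "\<And>y. y \<in> V \<Longrightarrow> (P has_field_derivative u y / s y) (at y)"
          "\<And>y. y \<in> V \<Longrightarrow> f (y, s y) = Re (P y)"
        using re_primitive_local[OF f U(3,1,2)] by blast
      have "isCont P x" by (rule DERIV_isCont[OF V(4)[OF V(2)]])
      then have xV: "isCont (\<lambda>y. e * Re (P y)) x" by (intro continuous_intros isCont_Re)
      have "e * Re (P x) > 0" using e(2) V(5)[OF V(2)] \<open>A x > 0\<close> by simp
      then have "\<forall>\<^sub>F y in nhds x. e * Re (P y) > 0"
        using xV tendsto_at_iff_tendsto_nhds[of "\<lambda>y. e * Re (P y)" x]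
        by (intro order_tendstoD(1)[of _ "e * Re (P x)"]) (simp_all only: isCont_def)
      moreover have ev3: "\<forall>\<^sub>F y in nhds x. y \<in> - cball c d"
        by (rule eventually_nhds_in_open) (use x in \<open>auto simp: S_def dist_norm norm_minus_commute open_Compl\<close>)
      ultimately have "\<forall>\<^sub>F y in nhds x. e * Re (P y) > 0 \<and> y \<in> V \<and> y \<in> - cball c d"
        using eventually_nhds_in_open[OF V(1,2)] ev3 by eventually_elim simp
      then obtain r where r0: "r > 0"
          "\<forall>y. dist y x < r \<longrightarrow> e * Re (P y) > 0 \<and> y \<in> V \<and> y \<in> - cball c d"
        unfolding eventually_nhds_metric by blast
      have r: "r > 0" "\<And>y. y \<in> ball x r \<Longrightarrow> e * Re (P y) > 0"
          "\<And>y. y \<in> ball x r \<Longrightarrow> y \<in> V" "\<And>y. y \<in> ball x r \<Longrightarrow> norm (y - c) > d"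
        using r0 by (simp_all add: dist_commute not_le dist_norm norm_minus_commute)
      have AP: "A y = e * Re (P y)" if "y \<in> ball x r" for y
      proof -
        have "y \<in> V" using r(3) that by blast
        then have "A y = \<bar>Re (P y)\<bar>"
          using abs_re_primitive[OF f trivializationD(3)[OF U(3)], of y] V(3,5) by (auto simp: A_def)
        then show ?thesis using r(2)[OF that] e(1) by auto
      qed
      define Q where "Q = (\<lambda>y. exp (of_real (n * e) * P y) / (y - c))"
      have nQ: "norm (Q y) = exp (b y) / d" if "y \<in> ball x r" for y
      proof -
        have yc: "norm (y - c) > 0" using r(4)[OF that] d(1) by (rule order.strict_trans[rotated])
        have "norm (Q y) = exp (n * A y) / norm (y - c)" by (simp add: Q_def norm_divide AP[OF that] mult.assoc)
        also have "\<dots> = exp (b y) / d"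
          using yc d by (simp add: b_def exp_diff)
        finally show ?thesis .
      qed
      have "Q holomorphic_on ball x r"
      proof -
        have "P holomorphic_on ball x r"
          unfolding holomorphic_on_open[OF open_ball] using V(4) r(3) by blast
        moreover have "y \<noteq> c" if "y \<in> ball x r" for y using r(4)[OF that] d by auto
        ultimately show ?thesis unfolding Q_def by (intro holomorphic_intros) auto
      qed
      moreover have "norm (Q y) \<le> norm (Q x)" if "y \<in> ball x r" for y
        using max[of y] r(4)[OF that] nQ[OF that] nQ[of x] r(1) x d by (simp add: S_def divide_right_mono)
      ultimately have "Q constant_on ball x r"
        using r(1) by (intro maximum_modulus_principle[where U = "ball x r" and \<xi> = x]) auto
      then have "norm (Q y) = norm (Q x)" if "y \<in> ball x r" for y
        using that r(1) by (metis centre_in_ball constant_on_def)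
      then have "b y = b x" if "y \<in> ball x r" for y
        using nQ[OF that] nQ[of x] r(1) d that by simp
      then have "ball x r \<subseteq> S" using x r(4) by (auto simp: S_def)
      then show "\<exists>e>0. ball x e \<subseteq> S" using r(1) by blast
    qed
    ultimately have "S = {} \<or> S = UNIV" using clopen by blast
    moreover have "x1 \<in> S"
      using x1(1) by (auto simp: S_eq W_def)
    moreover have "c \<notin> S" using d by (simp add: S_def)
    ultimately show False by blast
  qed
  obtain x w where xw: "q = (x, w)" "x \<notin> K" "w\<^sup>2 = D x" using q by (auto simp: root_cover_def)
  have "x \<noteq> c" using xw cK by auto
  then have "A x \<le> 0 + \<eta>" if "\<eta> > 0" for \<eta> using le[OF that, of x] by simp
  then have "A x \<le> 0" by (rule field_le_epsilon)
  then show ?thesis using abs_re_primitive[OF f xw(3)] by (simp add: A_def xw(1))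
qed

lemma re_primitive_diff:
  assumes "re_primitive u f" "re_primitive u' f'"
  shows "re_primitive (\<lambda>x. u x - u' x) (\<lambda>q. f q - f' q)"
  unfolding re_primitive_def
proof (intro conjI allI impI)
  show "f (x, - w) - f' (x, - w) = - (f (x, w) - f' (x, w))" if "w\<^sup>2 = D x" for x w
    using assms that by (simp add: re_primitive_def)
  fix x
  obtain N G where N: "x \<in> N" "is_primitive u N G" "\<And>q. q \<in> cover N \<Longrightarrow> f q = Re (G q)"
    using assms(1) unfolding re_primitive_def by blast
  obtain N' G' where N': "x \<in> N'" "is_primitive u' N' G'" "\<And>q. q \<in> cover N' \<Longrightarrow> f' q = Re (G' q)"
    using assms(2) unfolding re_primitive_def by blast
  have o: "open (N \<inter> N')" using is_primitiveD(1) N(2) N'(2) by blast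
  have "is_primitive (\<lambda>x. u x - u' x) (N \<inter> N') (\<lambda>q. G q - G' q)"
    by (intro is_primitive_diff is_primitive_subset[OF N(2) o] is_primitive_subset[OF N'(2) o]) auto
  moreover have "\<forall>q\<in>cover (N \<inter> N'). f q - f' q = Re (G q - G' q)"
    using N(3) N'(3) by (auto simp: cover_def)
  ultimately show "\<exists>N G. x \<in> N \<and> is_primitive (\<lambda>x. u x - u' x) N G \<and> (\<forall>q\<in>cover N. f q - f' q = Re (G q))"
    using N(1) N'(1) by blast
qed

text \<open>The limit along \<sigma> bounds |f| near infinity on both sheets, and continuity of |f|
  bounds it on the remaining disc.\<close>

lemma re_primitive_convergent_eq_0:
  assumes f: "re_primitive u f" and \<sigma>: "trivialization z k (- cball a R) \<sigma>"
    and lim: "((\<lambda>x. f (x, \<sigma> x)) \<longlongrightarrow> C) at_infinity" and q: "q \<in> root_cover z k"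
  shows "f q = 0"
proof -
  define A where "A = (\<lambda>x. \<bar>f (x, csqrt (D x))\<bar>)"
  have Ac: "isCont A x" for x unfolding A_def by (rule continuous_abs_re_primitive[OF f])
  have "((\<lambda>x. \<bar>f (x, \<sigma> x)\<bar>) \<longlongrightarrow> \<bar>C\<bar>) at_infinity" by (intro tendsto_intros lim)
  then have "\<forall>\<^sub>F x in at_infinity. \<bar>f (x, \<sigma> x)\<bar> < \<bar>C\<bar> + 1" by (rule order_tendstoD) auto
  then obtain r where r: "\<And>x. norm x \<ge> r \<Longrightarrow> \<bar>f (x, \<sigma> x)\<bar> < \<bar>C\<bar> + 1" unfolding eventually_at_infinity by blast
  define r' where "r' = max r (norm a + \<bar>R\<bar> + 1)"
  have far: "A x \<le> \<bar>C\<bar> + 1" if "norm x \<ge> r'" for x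
  proof -
    have "norm x \<le> norm (x - a) + norm a" using norm_triangle_ineq[of "x - a" a] by simp
    then have "x \<in> - cball a R" using that by (auto simp: r'_def dist_norm norm_minus_commute)
    then show ?thesis
      using abs_re_primitive[OF f trivializationD(3)[OF \<sigma>]] r[of x] that by (auto simp: A_def r'_def)
  qed
  have "compact (A ` cball 0 r')"
    using Ac by (intro compact_continuous_image continuous_at_imp_continuous_on) auto
  then have "bounded (A ` cball 0 r')" by (rule compact_imp_bounded)
  then obtain B where B': "\<forall>x\<in>cball 0 r'. \<bar>A x\<bar> \<le> B"
    unfolding bounded_iff by auto
  have B: "\<bar>A x\<bar> \<le> B" if "norm x \<le> r'" for x using B' that by simp
  have "\<bar>f p\<bar> \<le> max B (\<bar>C\<bar> + 1)" if p: "p \<in> root_cover z k" for p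
  proof -
    obtain x w where xw: "p = (x, w)" "w\<^sup>2 = D x" using p by (auto simp: root_cover_def)
    then have "\<bar>f p\<bar> = A x" using abs_re_primitive[OF f xw(2)] by (simp add: A_def)
    then show ?thesis using far[of x] B[of x] by (cases "norm x \<le> r'") auto
  qed
  then show ?thesis using bounded_re_primitive_eq_0[OF f _ q] by blast
qed

end

subsection \<open>Prescribed behaviour at infinity\<close>

lemma entire_primitive:
  assumes "e holomorphic_on (UNIV :: complex set)"
  shows "\<exists>E. \<forall>x. (E has_field_derivative e x) (at x)"
  using holomorphic_convex_primitive'[OF convex_UNIV open_UNIV assms] by auto

lemma log_model_punctured_harmonic:
  assumes E: "\<And>x. (E has_field_derivative e x) (at x)"
  shows "restrict (\<lambda>x. Re (E x) + c * ln (norm x)) (- {0}) \<in> punctured_harmonic"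
proof -
  have "harmonic_on (restrict (\<lambda>x. Re (E x) + c * ln (norm x)) (- {0})) (- {0})"
  proof (rule harmonic_on_local)
    fix x :: complex assume "x \<in> - {0}"
    then have x: "x \<noteq> 0" by simp
    define V where "V = ball x (norm x)"
    \<comment> \<open>On the disc |y - x| < |x| the quotient y / x stays in the right half-plane, so
      Ln (y / x) + ln |x| is a branch of the logarithm up to an imaginary constant.\<close>
    define P where "P = (\<lambda>y. E y + of_real c * (Ln (y / x) + of_real (ln (norm x))))"
    have slit: "y / x \<notin> \<real>\<^sub>\<le>\<^sub>0" "y \<noteq> 0" if "y \<in> V" for y
    proof -
      have "(1 - y / x) * x = x - y" using x by (simp add: field_simps)
      then have "norm (1 - y / x) * norm x < 1 * norm x"
        using that by (simp add: V_def dist_norm flip: norm_mult)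
      then have "norm (1 - y / x) < 1" using x by (simp only: mult_less_cancel_right) auto
      then have "Re (1 - y / x) < 1" using complex_Re_le_cmod le_less_trans by blast
      then show "y / x \<notin> \<real>\<^sub>\<le>\<^sub>0" by (auto simp: complex_nonpos_Reals_iff)
      then show "y \<noteq> 0" by auto
    qed
    have "E holomorphic_on V" using E by (auto simp: holomorphic_on_open V_def)
    then have "P holomorphic_on V" unfolding P_def using slit x by (intro holomorphic_intros) auto
    moreover have "restrict (\<lambda>x. Re (E x) + c * ln (norm x)) (- {0}) y = Re (P y)" if "y \<in> V" for y
    proof -
      have "ln (norm y) = ln (norm (y / x)) + ln (norm x)"
        using slit(2)[OF that] x by (simp add: norm_divide ln_div)
      then show ?thesis using slit(2)[OF that] x by (simp add: P_def)
    qed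
    moreover have "open V" "x \<in> V" using x by (auto simp: V_def)
    ultimately show "\<exists>U P. open U \<and> x \<in> U \<and> P holomorphic_on U \<and>
        (\<forall>y\<in>U. restrict (\<lambda>x. Re (E x) + c * ln (norm x)) (- {0}) y = Re (P y))" by blast
  qed
  then show ?thesis by (simp add: punctured_harmonic_def)
qed

text \<open>The entire part is taken of h_x - i h_y, which is holomorphic and single valued, whereas
  \<open>h\<close> may have no harmonic conjugate on the punctured plane.\<close>

lemma punctured_harmonic_asymptotics:
  assumes "h \<in> punctured_harmonic"
  shows "\<exists>E e c C. (\<forall>x. (E has_field_derivative e x) (at x)) \<and>
    ((\<lambda>x. h x - (Re (E x) + c * ln (norm x))) \<longlongrightarrow> C) at_infinity"
proof -
  define f where "f = (\<lambda>x. Complex (pdx h x) (- pdy h x))"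
  have h: "harmonic_on h (- {0})" using assms by (simp add: punctured_harmonic_def)
  have o: "open (- {0::complex})" by (simp add: open_Compl)
  have sub: "- cball 0 1 \<subseteq> - {0::complex}" by auto
  have f: "f holomorphic_on - cball 0 1"
    unfolding f_def by (rule holomorphic_on_subset[OF harmonic_on_gradient_holomorphic[OF o h] sub])
  obtain e \<rho> where e: "e holomorphic_on UNIV" "((\<lambda>x. (f x - e x) * x) \<longlongrightarrow> \<rho>) at_infinity"
    using Laurent_entire_part[OF f] by blast
  obtain E where E: "\<And>x. (E has_field_derivative e x) (at x)" using entire_primitive[OF e(1)] by blast
  have "(h has_derivative (\<lambda>d. Re (f x * d))) (at x)" if "x \<in> - cball 0 1" for x
    unfolding f_def by (rule harmonic_on_has_derivative[OF o h]) (use that sub in blast)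
  then show ?thesis using harmonic_asymptotics[OF f _ E e(2)] E by blast
qed

context branch_data begin

section \<open>Growth of the root and polynomial corrections\<close>

text \<open>The square of the quotient tends to 1, so the quotient is bounded near infinity and
  converges; its limit is 1 or -1 according to the sheet of \<sigma>.\<close>

lemma root_ratio_limit:
  assumes \<sigma>: "trivialization z k (- cball 0 R) \<sigma>"
  shows "\<exists>l. l \<noteq> 0 \<and> ((\<lambda>x. x ^ k / \<sigma> x) \<longlongrightarrow> l) at_infinity"
proof -
  have o: "open (- cball (0::complex) R)" by (simp add: open_Compl)
  have hol: "(\<lambda>x. x ^ k / \<sigma> x) holomorphic_on - cball 0 R"
    using trivialization_holomorphic[OF \<sigma> o] trivializationD(2)[OF \<sigma>] by (intro holomorphic_intros) auto
  have "((\<lambda>x. \<Prod>i=1..2*k. 1 - z i * inverse x) \<longlongrightarrow> (\<Prod>i=1..2*k. 1 - z i * 0)) at_infinity"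
    by (intro tendsto_intros tendsto_inverse_0)
  then have "((\<lambda>x. 1 / (\<Prod>i=1..2*k. 1 - z i * inverse x)) \<longlongrightarrow> 1 / 1) at_infinity"
    by (intro tendsto_divide tendsto_const) auto
  moreover have "\<forall>\<^sub>F x in at_infinity. 1 / (\<Prod>i=1..2*k. 1 - z i * inverse x) = (x ^ k / \<sigma> x)\<^sup>2"
    unfolding eventually_at_infinity
  proof (intro exI allI impI)
    fix x :: complex assume x: "\<bar>R\<bar> + 1 \<le> norm x"
    then have "x \<in> - cball 0 R" "x \<noteq> 0" by auto
    then have "(\<sigma> x)\<^sup>2 = D x" "x \<noteq> 0" using trivializationD(3)[OF \<sigma>] by auto
    moreover have "D x = x ^ (2 * k) * (\<Prod>i=1..2*k. 1 - z i * inverse x)"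
    proof -
      have "x ^ (2 * k) * (\<Prod>i=1..2*k. 1 - z i * inverse x) = (\<Prod>i=1..2*k. x * (1 - z i * inverse x))"
        by (simp add: prod.distrib)
      also have "\<dots> = D x"
        unfolding branch_poly_def using \<open>x \<noteq> 0\<close> by (intro prod.cong refl) (simp add: field_simps)
      finally show ?thesis by simp
    qed
    ultimately show "1 / (\<Prod>i=1..2*k. 1 - z i * inverse x) = (x ^ k / \<sigma> x)\<^sup>2"
      by (simp add: power_divide power_even_eq)
  qed
  ultimately have sq: "((\<lambda>x. (x ^ k / \<sigma> x)\<^sup>2) \<longlongrightarrow> 1) at_infinity"
    using Lim_transform_eventually by fastforce
  then have "((\<lambda>x. norm ((x ^ k / \<sigma> x)\<^sup>2)) \<longlongrightarrow> norm (1::complex)) at_infinity" by (intro tendsto_intros)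
  then have "\<forall>\<^sub>F x in at_infinity. norm ((x ^ k / \<sigma> x)\<^sup>2) < 2\<^sup>2" by (rule order_tendstoD) auto
  then have "\<forall>\<^sub>F x in at_infinity. norm (x ^ k / \<sigma> x) \<le> 2"
    by eventually_elim (unfold norm_power, rule power2_le_imp_le, auto)
  from bounded_at_infinity_imp_convergent[OF hol this] obtain l
    where l: "((\<lambda>x. x ^ k / \<sigma> x) \<longlongrightarrow> l) at_infinity" by blast
  have "l\<^sup>2 = 1"
    by (rule tendsto_unique[OF _ tendsto_power[OF l] sq]) (simp add: trivial_limit_at_infinity)
  then show ?thesis using l by (intro exI[of _ l]) auto
qed

lemma re_primitive_asymptotics:
  assumes f: "re_primitive u f" and u: "u holomorphic_on UNIV" and \<sigma>: "trivialization z k (- cball 0 R) \<sigma>"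
    and E: "\<And>x. (E has_field_derivative e x) (at x)"
    and lim: "((\<lambda>x. (u x / \<sigma> x - e x) * x) \<longlongrightarrow> \<rho>) at_infinity"
  shows "Im \<rho> = 0 \<and> (\<exists>C. ((\<lambda>x. f (x, \<sigma> x) - (Re (E x) + Re \<rho> * ln (norm x))) \<longlongrightarrow> C) at_infinity)"
proof (rule harmonic_asymptotics[OF _ _ E lim])
  have o: "open (- cball (0::complex) R)" by (simp add: open_Compl)
  show "(\<lambda>x. u x / \<sigma> x) holomorphic_on - cball 0 R"
    using trivialization_holomorphic[OF \<sigma> o] trivializationD(2)[OF \<sigma>]
    by (intro holomorphic_intros holomorphic_on_subset[OF u]) auto
  show "((\<lambda>x. f (x, \<sigma> x)) has_derivative (\<lambda>d. Re (u x / \<sigma> x * d))) (at x)" if "x \<in> - cball 0 R" for x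
    by (rule re_primitive_has_derivative[OF f \<sigma> o that])
qed

lemma re_primitive_zero: "re_primitive u f \<Longrightarrow> re_primitive (\<lambda>_. 0) (\<lambda>_. 0)"
  using re_primitive_diff[of u f u f] by simp

text \<open>A real basis of the complex polynomials of degree less than \<open>k\<close>, the
  degrees for which x u / \<surd>D stays bounded at infinity.\<close>

definition monomial_basis :: "nat \<Rightarrow> complex \<Rightarrow> complex" where
  "monomial_basis m x = (if m < k then x ^ m else \<i> * x ^ (m - k))"

lemma monomial_basis_holomorphic: "monomial_basis m holomorphic_on UNIV"
  unfolding monomial_basis_def by (cases "m < k") (auto intro!: holomorphic_intros)

text \<open>The coefficients with numbers m and m + k are the real and the imaginary part of the
  coefficient of x^m.\<close>

lemma monomial_basis_independent:
  assumes "\<And>x. (\<Sum>m<2*k. of_real (v m) * monomial_basis m x) = 0" "m < 2 * k"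
  shows "v m = 0"
proof -
  define c where "c = (\<lambda>m. Complex (v m) (v (m + k)))"
  have "(\<Sum>m\<le>k - 1. c m * x ^ m) = 0" for x
  proof -
    have "(\<Sum>m<2*k. of_real (v m) * monomial_basis m x)
        = (\<Sum>m<k. of_real (v m) * monomial_basis m x) + (\<Sum>m<k. of_real (v (m + k)) * monomial_basis (m + k) x)"
      by (simp add: mult_2 sum.nat_group[symmetric] lessThan_atLeast0 sum.atLeastLessThan_concat[of 0 k "k + k", symmetric]
          sum.shift_bounds_nat_ivl[of _ 0 k k, simplified])
    also have "\<dots> = (\<Sum>m<k. c m * x ^ m)"
      by (simp add: monomial_basis_def c_def Complex_eq sum.distrib[symmetric] algebra_simps)
    also have "{..<k} = {..k - 1}" using k by auto
    finally show ?thesis using assms(1) by simp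
  qed
  then have c0: "c m = 0" if "m < k" for m using polyfun_eq_0[of c "k - 1"] that k by auto
  show ?thesis
  proof (cases "m < k")
    case True
    then show ?thesis using c0[OF True] by (simp add: c_def complex_eq_iff)
  next
    case False
    then show ?thesis using c0[of "m - k"] assms(2) by (simp add: c_def complex_eq_iff)
  qed
qed

text \<open>Only the top degree k - 1 reaches the coefficient of 1/x. It occurs twice, with factor 1
  at m = k - 1 and with factor i at m = 2k - 1.\<close>

lemma monomial_basis_asymptotics:
  assumes l: "((\<lambda>x. x ^ k / \<sigma> x) \<longlongrightarrow> l) at_infinity" and m: "m < 2 * k"
  shows "((\<lambda>x. monomial_basis m x / \<sigma> x * x) \<longlongrightarrow>
    l * (if m = k - 1 then 1 else if m = 2 * k - 1 then \<i> else 0)) at_infinity"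
proof -
  have pow: "((\<lambda>x. x ^ j / \<sigma> x * x) \<longlongrightarrow> l * (if j = k - 1 then 1 else 0)) at_infinity" if j: "j < k" for j
  proof -
    have 1: "((\<lambda>x. x ^ k / \<sigma> x * inverse x ^ (k - 1 - j)) \<longlongrightarrow> l * 0 ^ (k - 1 - j)) at_infinity"
      by (intro tendsto_intros l tendsto_inverse_0)
    have 2: "\<forall>\<^sub>F x in at_infinity. x ^ k / \<sigma> x * inverse x ^ (k - 1 - j) = x ^ j / \<sigma> x * x"
      unfolding eventually_at_infinity
    proof (intro exI[of _ 1] allI impI)
      fix x :: complex assume "1 \<le> norm x"
      then have "x \<noteq> 0" by auto
      moreover have "x ^ k = x ^ j * x * x ^ (k - 1 - j)"
      proof -
        have "x ^ k = x ^ (j + 1 + (k - 1 - j))" using j by simp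
        then show ?thesis by (simp only: power_add power_one_right)
      qed
      ultimately show "x ^ k / \<sigma> x * inverse x ^ (k - 1 - j) = x ^ j / \<sigma> x * x"
        by (simp add: field_simps)
    qed
    have 3: "l * 0 ^ (k - 1 - j) = l * (if j = k - 1 then 1 else 0)" using j by (auto simp: power_0_left)
    show ?thesis using Lim_transform_eventually[OF 1 2] by (simp only: 3)
  qed
  show ?thesis
  proof (cases "m < k")
    case True
    then show ?thesis using pow[OF True] by (auto simp: monomial_basis_def)
  next
    case False
    then have "m - k < k" using m by auto
    moreover have "m - k = k - 1 \<longleftrightarrow> m = 2 * k - 1" "m \<noteq> k - 1" using False m by auto
    ultimately show ?thesis
      using tendsto_mult_left[OF pow, of "m - k" \<i>] False
      by (simp add: monomial_basis_def mult_ac if_distrib[of "(*) \<i>"] if_distrib[of "(*) l"] cong: if_cong)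
  qed
qed

text \<open>Given the prescribed growth \<open>Re E + c ln \<bar>x\<bar>\<close>, the entire part \<open>u0\<close> of \<open>\<surd>D E'\<close> is
  determined up to a polynomial of degree less than \<open>k\<close>.  Its \<open>2 k\<close> real coefficients have to meet
  \<open>2 k\<close> real conditions: the periods vanish, and the real part of the residue at infinity is
  \<open>c\<close>.  The homogeneous system has only the trivial solution, since it describes bounded \<open>f\<close>.\<close>

lemma exists_re_primitive_with_asymptotics:
  assumes \<sigma>: "trivialization z k (- cball 0 R) \<sigma>"
    and E: "\<And>x. (E has_field_derivative e x) (at x)"
  shows "\<exists>u f C. u holomorphic_on UNIV \<and> re_primitive u f \<and>
    ((\<lambda>x. f (x, \<sigma> x) - (Re (E x) + c * ln (norm x))) \<longlongrightarrow> C) at_infinity"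
proof -
  obtain l where l: "l \<noteq> 0" "((\<lambda>x. x ^ k / \<sigma> x) \<longlongrightarrow> l) at_infinity" using root_ratio_limit[OF \<sigma>] by blast
  have o: "open (- cball (0::complex) R)" by (simp add: open_Compl)
  have e: "e holomorphic_on UNIV" by (rule derivative_of_entire[OF E])
  have "(\<lambda>x. \<sigma> x * e x) holomorphic_on - cball 0 R"
    using trivialization_holomorphic[OF \<sigma> o] by (intro holomorphic_intros holomorphic_on_subset[OF e]) auto
  then obtain u0 \<rho>0 where u0: "u0 holomorphic_on UNIV" "((\<lambda>x. (\<sigma> x * e x - u0 x) * x) \<longlongrightarrow> \<rho>0) at_infinity"
    using Laurent_entire_part by blast
  \<comment> \<open>\<sigma> e - u0 is O(1/x) and 1/\<sigma> is O(x^(-k)), so \<open>u0\<close>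
    contributes nothing to the residue, as k \<ge> 1.\<close>
  have lim0: "((\<lambda>x. (u0 x / \<sigma> x - e x) * x) \<longlongrightarrow> 0) at_infinity"
  proof -
    have 1: "((\<lambda>x. - ((\<sigma> x * e x - u0 x) * x) * (x ^ k / \<sigma> x * inverse x ^ k)) \<longlongrightarrow> - \<rho>0 * (l * 0 ^ k)) at_infinity"
      by (intro tendsto_intros l u0 tendsto_inverse_0)
    have 2: "\<forall>\<^sub>F x in at_infinity. - ((\<sigma> x * e x - u0 x) * x) * (x ^ k / \<sigma> x * inverse x ^ k) = (u0 x / \<sigma> x - e x) * x"
      unfolding eventually_at_infinity
    proof (intro exI allI impI)
      fix x :: complex assume "\<bar>R\<bar> + 1 \<le> norm x"
      then have "x \<in> - cball 0 R" "x \<noteq> 0" by auto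
      then have "\<sigma> x \<noteq> 0" "x \<noteq> 0" using trivializationD(2)[OF \<sigma>] by auto
      then show "- ((\<sigma> x * e x - u0 x) * x) * (x ^ k / \<sigma> x * inverse x ^ k) = (u0 x / \<sigma> x - e x) * x"
        by (simp add: field_simps)
    qed
    have 3: "- \<rho>0 * (l * 0 ^ k) = 0" using k by (simp add: power_0_left)
    show ?thesis using Lim_transform_eventually[OF 1 2] by (simp only: 3)
  qed
  define \<kappa> where "\<kappa> = (\<lambda>m. if m = k - 1 then 1 else if m = 2 * k - 1 then \<i> else 0)"
  define b where "b = monomial_basis"
  have b: "b m holomorphic_on UNIV" for m unfolding b_def by (rule monomial_basis_holomorphic)
  define comb where "comb = (\<lambda>w v x. w x + (\<Sum>m\<in>{..<2*k}. of_real (v m) * b m x))"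
  have comb_hol: "comb w v holomorphic_on UNIV" if "w holomorphic_on UNIV" for w v
    unfolding comb_def by (intro holomorphic_intros that b)
  have comb_lim: "((\<lambda>x. (comb w v x / \<sigma> x - e' x) * x) \<longlongrightarrow> (\<Sum>m\<in>{..<2*k}. of_real (v m) * (l * \<kappa> m))) at_infinity"
    if "((\<lambda>x. (w x / \<sigma> x - e' x) * x) \<longlongrightarrow> 0) at_infinity" for w e' v
  proof -
    have "((\<lambda>x. (w x / \<sigma> x - e' x) * x + (\<Sum>m\<in>{..<2*k}. of_real (v m) * (b m x / \<sigma> x * x))) \<longlongrightarrow>
        0 + (\<Sum>m\<in>{..<2*k}. of_real (v m) * (l * \<kappa> m))) at_infinity"
      unfolding b_def \<kappa>_def
      by (intro tendsto_add that tendsto_sum tendsto_mult_left monomial_basis_asymptotics[OF l(2)]) auto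
    moreover have "(w x / \<sigma> x - e' x) * x + (\<Sum>m\<in>{..<2*k}. of_real (v m) * (b m x / \<sigma> x * x))
        = (comb w v x / \<sigma> x - e' x) * x" for x
      by (simp add: comb_def add_divide_distrib distrib_right left_diff_distrib sum_divide_distrib
          sum_distrib_right mult.assoc)
    ultimately show ?thesis by simp
  qed
  have "\<exists>g s. root_path z k g s \<and> pathstart g = z 1 \<and> pathfinish g = z j" if j: "j \<in> {2..2*k}" for j
  proof -
    have "z j \<noteq> z 1" using inj k j by (auto dest!: inj_onD)
    from exists_root_path[OF this power2_csqrt] show ?thesis by blast
  qed
  then obtain g s where gs: "\<And>j. j \<in> {2..2*k} \<Longrightarrow> root_path z k (g j) (s j) \<and> pathstart (g j) = z 1 \<and> pathfinish (g j) = z j"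
    by metis
  have "\<exists>I. has_root_integral (b m) (g j) (s j) I" if "j \<in> {2..2*k}" for j m
    using has_root_integral_exists[OF b] gs[OF that] by blast
  then obtain J where J: "\<And>j m. j \<in> {2..2*k} \<Longrightarrow> has_root_integral (b m) (g j) (s j) (J j m)" by metis
  have "\<exists>I. has_root_integral u0 (g j) (s j) I" if "j \<in> {2..2*k}" for j
    using has_root_integral_exists[OF u0(1)] gs[OF that] by blast
  then obtain J0 where J0: "\<And>j. j \<in> {2..2*k} \<Longrightarrow> has_root_integral u0 (g j) (s j) (J0 j)" by metis
  have Z: "has_root_integral (\<lambda>_. 0) g s 0" for g s by (simp add: has_root_integral_def)
  have comb_int: "has_root_integral (comb w v) (g j) (s j) (I + (\<Sum>m\<in>{..<2*k}. of_real (v m) * J j m))"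
    if "j \<in> {2..2*k}" "has_root_integral w (g j) (s j) I" for w v j I
    unfolding comb_def by (rule has_root_integral_linear_combination[OF that(2) J[OF that(1)]]) auto
  have adm: "\<exists>f. re_primitive (comb w v) f"
    if "w holomorphic_on UNIV" and I: "\<And>j. j \<in> {2..2*k} \<Longrightarrow> has_root_integral w (g j) (s j) (I j)"
      "\<And>j. j \<in> {2..2*k} \<Longrightarrow> Re (I j + (\<Sum>m\<in>{..<2*k}. of_real (v m) * J j m)) = 0" for w v I
  proof (rule admissible_imp_re_primitive)
    show "comb w v \<in> admissible z k"
      unfolding admissible_def using comb_hol[OF that(1)] gs comb_int[OF _ I(1)] I(2) by blast
  qed
  \<comment> \<open>Rows 2 to 2k are the periods along the paths from \<open>z 1\<close>; row 1 is
    free for the residue.\<close>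
  define A where "A = (\<lambda>i m. if i = 1 then Re (l * \<kappa> m) else Re (J i m))"
  have row: "Re (\<Sum>m\<in>{..<2*k}. of_real (v m) * y m) = (\<Sum>m\<in>{..<2*k}. Re (y m) * v m)" for v y
    by (simp add: mult.commute)
  have "\<exists>v. \<forall>i\<in>{1..2*k}. (\<Sum>m\<in>{..<2*k}. A i m * v m) = (if i = 1 then c else - Re (J0 i))"
  proof (rule square_system_solvable)
    \<comment> \<open>Vanishing periods give a real primitive \<open>f\<close> of the polynomial
      \<open>q\<close>, and Re \<rho> = 0 removes its logarithm. So \<open>f\<close> converges at
      infinity and is 0, and with it \<open>q\<close>.\<close>
    fix v assume v: "\<forall>i\<in>{1..2*k}. (\<Sum>m\<in>{..<2*k}. A i m * v m) = 0"
    define q where "q = comb (\<lambda>_. 0) v"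
    have "Re (0 + (\<Sum>m\<in>{..<2*k}. of_real (v m) * J j m)) = 0" if "j \<in> {2..2*k}" for j
    proof -
      have "(\<Sum>m\<in>{..<2*k}. A j m * v m) = 0" using v that by auto
      then show ?thesis using that unfolding A_def add_0 row by simp
    qed
    then obtain f where f: "re_primitive q f"
      using adm[of "\<lambda>_. 0" "\<lambda>_. 0" v] Z unfolding q_def by auto
    have qh: "q holomorphic_on UNIV" unfolding q_def by (intro comb_hol) auto
    define \<rho> where "\<rho> = (\<Sum>m\<in>{..<2*k}. of_real (v m) * (l * \<kappa> m))"
    have "((\<lambda>x. (q x / \<sigma> x - 0) * x) \<longlongrightarrow> \<rho>) at_infinity"
      unfolding q_def \<rho>_def by (rule comb_lim) simp
    from re_primitive_asymptotics[OF f qh \<sigma> _ this, of "\<lambda>_. 0"]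
    obtain C where "Im \<rho> = 0" and C: "((\<lambda>x. f (x, \<sigma> x) - (0 + Re \<rho> * ln (norm x))) \<longlongrightarrow> C) at_infinity" by auto
    have "(\<Sum>m\<in>{..<2*k}. A 1 m * v m) = 0" using v k by auto
    then have "Re \<rho> = 0" unfolding \<rho>_def row by (simp add: A_def)
    then have "((\<lambda>x. f (x, \<sigma> x)) \<longlongrightarrow> C) at_infinity" using C by simp
    then have "f p = 0" if "p \<in> root_cover z k" for p
      using re_primitive_convergent_eq_0[OF f \<sigma>] that by blast
    then have "q = (\<lambda>_. 0)"
      by (intro re_primitive_unique[OF qh _ f re_primitive_zero[OF f]]) auto
    then have "(\<Sum>m<2*k. of_real (v m) * monomial_basis m x) = 0" for x
      by (simp add: q_def comb_def b_def fun_eq_iff)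
    then show "\<forall>m\<in>{..<2*k}. v m = 0" using monomial_basis_independent by blast
  qed auto
  then obtain v where v: "\<And>i. i \<in> {1..2*k} \<Longrightarrow> (\<Sum>m\<in>{..<2*k}. A i m * v m) = (if i = 1 then c else - Re (J0 i))"
    by blast
  define u where "u = comb u0 v"
  have u: "u holomorphic_on UNIV" unfolding u_def by (rule comb_hol[OF u0(1)])
  have "Re (J0 j + (\<Sum>m\<in>{..<2*k}. of_real (v m) * J j m)) = 0" if "j \<in> {2..2*k}" for j
  proof -
    have "(\<Sum>m\<in>{..<2*k}. A j m * v m) = - Re (J0 j)" using v[of j] that by auto
    then show ?thesis using that unfolding A_def plus_complex.sel row by simp
  qed
  then obtain f where f: "re_primitive u f"
    using adm[OF u0(1) J0] unfolding u_def by blast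
  define \<rho> where "\<rho> = (\<Sum>m\<in>{..<2*k}. of_real (v m) * (l * \<kappa> m))"
  have "((\<lambda>x. (u x / \<sigma> x - e x) * x) \<longlongrightarrow> \<rho>) at_infinity"
    unfolding u_def \<rho>_def by (rule comb_lim[OF lim0])
  from re_primitive_asymptotics[OF f u \<sigma> E this]
  obtain C where C: "((\<lambda>x. f (x, \<sigma> x) - (Re (E x) + Re \<rho> * ln (norm x))) \<longlongrightarrow> C) at_infinity" by blast
  have "(\<Sum>m\<in>{..<2*k}. A 1 m * v m) = c" using v[of 1] k by auto
  then have "Re \<rho> = c" unfolding \<rho>_def row by (simp add: A_def)
  then show ?thesis using u f C by blast
qed

end

subsection \<open>The correspondences\<close>

lemma one_to_one_comp:
  assumes "one_to_one A B R" "one_to_one A C S"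
  shows "one_to_one B C (\<lambda>b c. \<exists>a\<in>A. R a b \<and> S a c)"
  unfolding one_to_one_def
proof (intro conjI ballI)
  fix b assume b: "b \<in> B"
  obtain a where a: "a \<in> A" "R a b" "\<And>a'. a' \<in> A \<Longrightarrow> R a' b \<Longrightarrow> a' = a"
    using assms(1) b unfolding one_to_one_def by metis
  obtain c where c: "c \<in> C" "S a c" "\<And>c'. c' \<in> C \<Longrightarrow> S a c' \<Longrightarrow> c' = c"
    using assms(2) a(1) unfolding one_to_one_def by metis
  show "\<exists>!c. c \<in> C \<and> (\<exists>a\<in>A. R a b \<and> S a c)"
    by (rule ex1I[of _ c]) (use a c in blast)+
next
  fix c assume c: "c \<in> C"
  obtain a where a: "a \<in> A" "S a c" "\<And>a'. a' \<in> A \<Longrightarrow> S a' c \<Longrightarrow> a' = a"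
    using assms(2) c unfolding one_to_one_def by metis
  obtain b where b: "b \<in> B" "R a b" "\<And>b'. b' \<in> B \<Longrightarrow> R a b' \<Longrightarrow> b' = b"
    using assms(1) a(1) unfolding one_to_one_def by metis
  show "\<exists>!b. b \<in> B \<and> (\<exists>a\<in>A. R a b \<and> S a c)"
    by (rule ex1I[of _ b]) (use a b in blast)+
qed

lemma trivialization_at_infinity_ball:
  assumes "trivialization z k (- cball a R) \<sigma>"
  shows "\<exists>R'. trivialization z k (- cball 0 R') \<sigma>"
proof (intro exI)
  have "- cball (0::complex) (norm a + R) \<subseteq> - cball a R"
  proof (rule subsetI)
    fix x :: complex assume "x \<in> - cball 0 (norm a + R)"
    moreover have "norm x \<le> norm (x - a) + norm a" using norm_triangle_ineq[of "x - a" a] by simp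
    ultimately show "x \<in> - cball a R" by (auto simp: dist_norm norm_minus_commute)
  qed
  then show "trivialization z k (- cball 0 (norm a + R)) \<sigma>"
    using assms by (auto simp: trivialization_def intro: continuous_on_subset)
qed

context branch_data begin

lemma z2_harmonic_admissible_one_to_one:
  "one_to_one (z2_harmonic z k) (admissible z k) (integral_rel z k)"
  unfolding one_to_one_def
proof (intro conjI ballI)
  fix f assume "f \<in> z2_harmonic z k"
  then obtain u f' where u: "u holomorphic_on UNIV" "re_primitive u f'" "f = restrict f' (root_cover z k)"
    using z2_harmonic_imp_re_primitive by blast
  show "\<exists>!u. u \<in> admissible z k \<and> integral_rel z k f u"
  proof (rule ex1I[of _ u])
    show "u \<in> admissible z k \<and> integral_rel z k f u"
      using re_primitive_imp_admissible[OF u(1,2)] re_primitive_integral_rel[OF u(2)] u(3) by simp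
    \<comment> \<open>A competitor \<open>u'\<close> has a real primitive of its own; integration
      along root paths identifies it with that of \<open>u\<close> on the cover, and the real
      primitive determines \<open>u\<close>.\<close>
    fix u' assume u': "u' \<in> admissible z k \<and> integral_rel z k f u'"
    then obtain f'' where f'': "re_primitive u' f''" using admissible_imp_re_primitive by blast
    have "f' q = f'' q" if q: "q \<in> root_cover z k" for q
      using integral_rel_unique[OF _ re_primitive_integral_rel[OF f''] q, of f] u' u(3) q by simp
    moreover have "u' holomorphic_on UNIV" using u' by (simp add: admissible_def)
    ultimately show "u' = u"
      using re_primitive_unique[OF u(1) _ u(2) f''] by blast
  qed
next
  fix u assume u: "u \<in> admissible z k"
  then obtain f where f: "re_primitive u f" using admissible_imp_re_primitive by blast
  have uh: "u holomorphic_on UNIV" using u by (simp add: admissible_def)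
  show "\<exists>!f. f \<in> z2_harmonic z k \<and> integral_rel z k f u"
  proof (rule ex1I[of _ "restrict f (root_cover z k)"])
    show "restrict f (root_cover z k) \<in> z2_harmonic z k \<and> integral_rel z k (restrict f (root_cover z k)) u"
      using re_primitive_z2_harmonic[OF uh f] re_primitive_integral_rel[OF f] by blast
    fix f' assume f': "f' \<in> z2_harmonic z k \<and> integral_rel z k f' u"
    then have "f' \<in> extensional (root_cover z k)" by (simp add: z2_harmonic_def z2_function_def)
    then show "f' = restrict f (root_cover z k)"
      using integral_rel_unique[OF _ re_primitive_integral_rel[OF f]] f'
      by (intro extensionalityI[of _ "root_cover z k"]) auto
  qed
qed

lemma z2_harmonic_punctured_harmonic_one_to_one:
  assumes "trivialization z k (- cball a R) \<sigma>"
  shows "one_to_one (z2_harmonic z k) (punctured_harmonic // asymp_rel) (infinity_rel \<sigma>)"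
proof -
  obtain R' where \<sigma>: "trivialization z k (- cball 0 R') \<sigma>"
    using trivialization_at_infinity_ball[OF assms] by blast
  have o: "open (- cball (0::complex) R')" by (simp add: open_Compl)
  have restr: "\<forall>\<^sub>F x in at_infinity. f (x, \<sigma> x) = restrict f (root_cover z k) (x, \<sigma> x)" for f :: "complex \<times> complex \<Rightarrow> real"
    unfolding eventually_at_infinity
    by (intro exI[of _ "R' + 1"] allI impI) (use trivializationD(4)[OF \<sigma>] in auto)
  \<comment> \<open>Convergence against one representative passes to its whole class, whose members
    differ by convergent functions.\<close>
  have cls: "infinity_rel \<sigma> f (asymp_rel `` {h})"
    if h: "((\<lambda>x. f (x, \<sigma> x) - h x) \<longlongrightarrow> C) at_infinity" for f h C
    unfolding infinity_rel_def
  proof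
    fix h' assume "h' \<in> asymp_rel `` {h}"
    then obtain C' where C': "((\<lambda>x. h x - h' x) \<longlongrightarrow> C') at_infinity" by (auto simp: asymp_rel_def)
    then show "\<exists>C. ((\<lambda>x. f (x, \<sigma> x) - h' x) \<longlongrightarrow> C) at_infinity"
      using tendsto_add[OF h C'] by auto
  qed
  show ?thesis
    unfolding one_to_one_def
  proof (intro conjI ballI)
    fix f assume f: "f \<in> z2_harmonic z k"
    then obtain u f' where u: "u holomorphic_on UNIV" "re_primitive u f'" "f = restrict f' (root_cover z k)"
      using z2_harmonic_imp_re_primitive by blast
    have "(\<lambda>x. u x / \<sigma> x) holomorphic_on - cball 0 R'"
      using trivialization_holomorphic[OF \<sigma> o] trivializationD(2)[OF \<sigma>]
      by (intro holomorphic_intros holomorphic_on_subset[OF u(1)]) auto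
    then obtain e \<rho> where e: "e holomorphic_on UNIV" "((\<lambda>x. (u x / \<sigma> x - e x) * x) \<longlongrightarrow> \<rho>) at_infinity"
      using Laurent_entire_part by blast
    obtain E where E: "\<And>x. (E has_field_derivative e x) (at x)" using entire_primitive[OF e(1)] by blast
    define m where "m = (\<lambda>x. Re (E x) + Re \<rho> * ln (norm x))"
    obtain C where C: "((\<lambda>x. f' (x, \<sigma> x) - m x) \<longlongrightarrow> C) at_infinity"
      using re_primitive_asymptotics[OF u(2,1) \<sigma> E e(2)] unfolding m_def by blast
    define h where "h = restrict m (- {0})"
    have hp: "h \<in> punctured_harmonic" unfolding h_def m_def by (rule log_model_punctured_harmonic[OF E])
    have ev0: "\<forall>\<^sub>F x in at_infinity. x \<noteq> (0::complex)"
      unfolding eventually_at_infinity by (intro exI[of _ 1]) auto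
    have "\<forall>\<^sub>F x in at_infinity. f' (x, \<sigma> x) - m x = f (x, \<sigma> x) - h x"
      using restr[of f'] ev0 by eventually_elim (simp add: u(3) h_def)
    then have fh: "((\<lambda>x. f (x, \<sigma> x) - h x) \<longlongrightarrow> C) at_infinity"
      by (rule Lim_transform_eventually[OF C])
    show "\<exists>!c. c \<in> punctured_harmonic // asymp_rel \<and> infinity_rel \<sigma> f c"
    proof (rule ex1I[of _ "asymp_rel `` {h}"])
      show "asymp_rel `` {h} \<in> punctured_harmonic // asymp_rel \<and> infinity_rel \<sigma> f (asymp_rel `` {h})"
        using quotientI[OF hp] cls[OF fh] by blast
      fix c assume c: "c \<in> punctured_harmonic // asymp_rel \<and> infinity_rel \<sigma> f c"
      then obtain h' where h': "h' \<in> punctured_harmonic" "c = asymp_rel `` {h'}" by (auto elim: quotientE)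
      then have "h' \<in> c" using equiv_class_self[OF equiv_asymp_rel] by blast
      then obtain C' where C': "((\<lambda>x. f (x, \<sigma> x) - h' x) \<longlongrightarrow> C') at_infinity"
        using c unfolding infinity_rel_def by blast
      have "((\<lambda>x. h' x - h x) \<longlongrightarrow> C - C') at_infinity" using tendsto_diff[OF fh C'] by simp
      then have "(h', h) \<in> asymp_rel" using h'(1) hp by (auto simp: asymp_rel_def)
      then show "c = asymp_rel `` {h}" using equiv_class_eq[OF equiv_asymp_rel] h'(2) by blast
    qed
  next
    fix c assume "c \<in> punctured_harmonic // asymp_rel"
    then obtain h where h: "h \<in> punctured_harmonic" "c = asymp_rel `` {h}" by (auto elim: quotientE)
    obtain E e b C where E: "\<And>x. (E has_field_derivative e x) (at x)"
        and C: "((\<lambda>x. h x - (Re (E x) + b * ln (norm x))) \<longlongrightarrow> C) at_infinity"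
      using punctured_harmonic_asymptotics[OF h(1)] by blast
    obtain u f C' where u: "u holomorphic_on UNIV" and f: "re_primitive u f"
        and C': "((\<lambda>x. f (x, \<sigma> x) - (Re (E x) + b * ln (norm x))) \<longlongrightarrow> C') at_infinity"
      using exists_re_primitive_with_asymptotics[OF \<sigma> E] by blast
    have fh: "((\<lambda>x. f (x, \<sigma> x) - h x) \<longlongrightarrow> C' - C) at_infinity" using tendsto_diff[OF C' C] by simp
    define g where "g = restrict f (root_cover z k)"
    have "\<forall>\<^sub>F x in at_infinity. f (x, \<sigma> x) - h x = g (x, \<sigma> x) - h x"
      using restr[of f] by eventually_elim (simp add: g_def)
    then have gh: "((\<lambda>x. g (x, \<sigma> x) - h x) \<longlongrightarrow> C' - C) at_infinity"
      by (rule Lim_transform_eventually[OF fh])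
    show "\<exists>!f. f \<in> z2_harmonic z k \<and> infinity_rel \<sigma> f c"
    proof (rule ex1I[of _ g])
      show "g \<in> z2_harmonic z k \<and> infinity_rel \<sigma> g c"
        using re_primitive_z2_harmonic[OF u f] cls[OF gh] h(2) unfolding g_def by blast
      fix f' assume f': "f' \<in> z2_harmonic z k \<and> infinity_rel \<sigma> f' c"
      then obtain u' f'' where u': "u' holomorphic_on UNIV" "re_primitive u' f''" "f' = restrict f'' (root_cover z k)"
        using z2_harmonic_imp_re_primitive by blast
      have "h \<in> c" using equiv_class_self[OF equiv_asymp_rel h(1)] h(2) by blast
      then obtain C'' where "((\<lambda>x. f' (x, \<sigma> x) - h x) \<longlongrightarrow> C'') at_infinity"
        using f' unfolding infinity_rel_def by blast
      from tendsto_diff[OF this gh] have lim: "((\<lambda>x. f' (x, \<sigma> x) - g (x, \<sigma> x)) \<longlongrightarrow> C'' - (C' - C)) at_infinity"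
        by simp
      have "\<forall>\<^sub>F x in at_infinity. f' (x, \<sigma> x) - g (x, \<sigma> x) = f'' (x, \<sigma> x) - f (x, \<sigma> x)"
        using restr[of f] restr[of f''] by eventually_elim (simp add: g_def u'(3))
      then have "((\<lambda>x. f'' (x, \<sigma> x) - f (x, \<sigma> x)) \<longlongrightarrow> C'' - (C' - C)) at_infinity"
        by (rule Lim_transform_eventually[OF lim])
      \<comment> \<open>The difference of two candidates is a real primitive with a limit at
        infinity.\<close>
      then have "f'' q - f q = 0" if "q \<in> root_cover z k" for q
        by (rule re_primitive_convergent_eq_0[OF re_primitive_diff[OF u'(2) f] \<sigma> _ that])
      then show "f' = g" by (auto simp: u'(3) g_def restrict_def fun_eq_iff)
    qed
  qed
qed

end

theorem theorem2:
  fixes z :: "nat \<Rightarrow> complex" and k :: nat and a :: complex and R :: real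
    and \<sigma> :: "complex \<Rightarrow> complex"
  assumes "k \<ge> 1"
    and "inj_on z {1..2*k}"
    and "branch_points z k \<subseteq> cball a R"
    and "trivialization z k (- cball a R) \<sigma>"
  shows "one_to_one (z2_harmonic z k) (admissible z k) (integral_rel z k) \<and>
    one_to_one (z2_harmonic z k) (punctured_harmonic // asymp_rel) (infinity_rel \<sigma>) \<and>
    one_to_one (admissible z k) (punctured_harmonic // asymp_rel)
      (\<lambda>u c. \<exists>f \<in> z2_harmonic z k. integral_rel z k f u \<and> infinity_rel \<sigma> f c)"
proof -
  interpret branch_data z k by standard (fact assms)+
  show ?thesis
    using z2_harmonic_admissible_one_to_one z2_harmonic_punctured_harmonic_one_to_one[OF assms(4)]
      one_to_one_comp by blast
qed

end
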